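(* Let $K$ be a field of characteristic zero and let a Poisson algebra $\mathcal{A}=S^{-1}(P_n/I)$ be a domain of essentially finite type over $K$, where $I=(f_1,\ldots,f_m)$ is a prime but not maximal ideal of $P_n=K[x_1,\ldots,x_n]$. Let $r$ be the rank of the Jacobian matrix $\big(\frac{\partial f_i}{\partial x_j}\big)$ of $\mathcal{A}$ and let $d$ be the rank of the $n\times n$ matrix $\mathcal{C}_{\mathcal{A}}=(\{x_i,x_j\})$ (both ranks over the field of fractions of $\mathcal{A}$). Then $$\mathrm{GK}(P\mathcal{D}(\mathcal{A}))=\mathrm{GK}(\mathcal{A})+d=n-r+d.$$
   Context: A Poisson algebra over $K$ is a commutative associative (unital) $K$-algebra with a $K$-bilinear Lie bracket $\{\cdot,\cdot\}$ satisfying $\{a,xy\}=\{a,x\}y+x\{a,y\}$. An algebra of essentially finite type is a localization of an affine commutative algebra. $P\mathcal{D}(\mathcal{A})$, the algebra of Poisson differential operators on $\mathcal{A}$, is the subalgebra of $\mathrm{End}_K(\mathcal{A})$ generated by the multiplications by elements of $\mathcal{A}$ and by the derivations $\{a,\cdot\}$, $a\in\mathcal{A}$. $\mathrm{GK}$ is the Gelfand--Kirillov dimension. *)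

theory Defs
  imports
    "HOL-Analysis.Analysis"
    "HOL-Library.Poly_Mapping"
    "HOL-Library.Function_Algebras"
    "HOL-Computational_Algebra.Fraction_Field"
    "HOL-Algebra.Algebraic_Closure_Type"
begin

section \<open>Polynomials\<close>

text \<open>Exponent vectors are finitely supported functions \<open>'n \<Rightarrow>\<^sub>0 nat\<close>, and
  polynomials are finitely supported functions from exponent vectors to coefficients, with the
  convolution product of \<^theory>\<open>HOL-Library.Poly_Mapping\<close>.  The number of variables is
  \<open>CARD('n)\<close>.\<close>

type_synonym ('n, 'k) mpoly = "('n \<Rightarrow>\<^sub>0 nat) \<Rightarrow>\<^sub>0 'k"

abbreviation mpoly_ring :: "('n, 'k::comm_ring_1) mpoly ring"
  where "mpoly_ring \<equiv> ring_of_type_algebra"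

definition pconst :: "'k::comm_ring_1 \<Rightarrow> ('n, 'k) mpoly"
  where "pconst c = Poly_Mapping.single 0 c"

definition pvar :: "'n \<Rightarrow> ('n, 'k::comm_ring_1) mpoly"
  where "pvar i = Poly_Mapping.single (Poly_Mapping.single i 1) 1"

text \<open>Formal partial derivative.  For exponents with \<open>u j = 0\<close> the subtraction
  truncates, but then the coefficient vanishes.\<close>

definition pdiff :: "'n \<Rightarrow> ('n, 'k::comm_ring_1) mpoly \<Rightarrow> ('n, 'k) mpoly"
  where "pdiff j p = (\<Sum>u\<in>Poly_Mapping.keys p.
    Poly_Mapping.single (u - Poly_Mapping.single j 1)
      (of_nat (Poly_Mapping.lookup u j) * Poly_Mapping.lookup p u))"


section \<open>Localization\<close>

text \<open>\<open>\<iota>\<close> exhibits the (type-class) ring \<open>'a\<close> as the localization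
  \<open>S\<^sup>-\<^sup>1R\<close>, i.e. up to the canonical isomorphism \<open>r/s \<mapsto> \<iota> r / \<iota> s\<close>: elements of
  \<open>S\<close> become units, every element is a fraction, and \<open>r/1 = 0\<close> exactly when some
  element of \<open>S\<close> annihilates \<open>r\<close>.\<close>

definition is_localization ::
    "('r, 'x) ring_scheme \<Rightarrow> 'r set \<Rightarrow> ('r \<Rightarrow> 'a::comm_ring_1) \<Rightarrow> bool"
  where "is_localization R S \<iota> \<longleftrightarrow>
    submonoid S R \<and>
    \<iota> \<in> ring_hom R ring_of_type_algebra \<and>
    (\<forall>s\<in>S. \<iota> s dvd 1) \<and>
    (\<forall>a. \<exists>r\<in>carrier R. \<exists>s\<in>S. a * \<iota> s = \<iota> r) \<and>
    (\<forall>r\<in>carrier R. \<iota> r = 0 \<longleftrightarrow> (\<exists>s\<in>S. s \<otimes>\<^bsub>R\<^esub> r = \<zero>\<^bsub>R\<^esub>))"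

text \<open>Scalar multiplication on an algebra that receives a ring homomorphism \<open>\<phi>\<close> from
  the polynomial ring.\<close>

definition induced_scale ::
    "(('n, 'k::comm_ring_1) mpoly \<Rightarrow> 'a::comm_ring_1) \<Rightarrow> 'k \<Rightarrow> 'a \<Rightarrow> 'a"
  where "induced_scale \<phi> c a = \<phi> (pconst c) * a"


section \<open>Subalgebras and Gelfand--Kirillov dimension\<close>

text \<open>An associative algebra is given by its scalar multiplication \<open>sc\<close>, multiplication
  \<open>mul\<close> and unit \<open>e\<close>; addition comes from the type class.\<close>

definition is_subalgebra ::
    "('k::field \<Rightarrow> 'e::ab_group_add \<Rightarrow> 'e) \<Rightarrow> ('e \<Rightarrow> 'e \<Rightarrow> 'e) \<Rightarrow> 'e \<Rightarrow> 'e set \<Rightarrow> bool"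
  where "is_subalgebra sc mul e B \<longleftrightarrow>
    module.subspace sc B \<and> e \<in> B \<and> (\<forall>x\<in>B. \<forall>y\<in>B. mul x y \<in> B)"

primrec subspace_power ::
    "('k::field \<Rightarrow> 'e::ab_group_add \<Rightarrow> 'e) \<Rightarrow> ('e \<Rightarrow> 'e \<Rightarrow> 'e) \<Rightarrow> 'e \<Rightarrow> 'e set \<Rightarrow> nat \<Rightarrow> 'e set"
  where
    "subspace_power sc mul e V 0 = module.span sc {e}"
  | "subspace_power sc mul e V (Suc i) =
       module.span sc {mul x y | x y. x \<in> subspace_power sc mul e V i \<and> y \<in> V}"

text \<open>\<open>GK(B) = sup\<^sub>V limsup\<^sub>N log\<^sub>N dim (K + V + V\<^sup>2 + \<dots> + V\<^sup>N)\<close>, where \<open>V\<close>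
  ranges over the finite-dimensional subspaces of the algebra \<open>B\<close>.\<close>

definition GKdim ::
    "('k::field \<Rightarrow> 'e::ab_group_add \<Rightarrow> 'e) \<Rightarrow> ('e \<Rightarrow> 'e \<Rightarrow> 'e) \<Rightarrow> 'e \<Rightarrow> 'e set \<Rightarrow> ereal"
  where "GKdim sc mul e B =
    (SUP V \<in> {V. V \<subseteq> B \<and> (\<exists>F. finite F \<and> V = module.span sc F)}.
      limsup (\<lambda>N::nat. ereal (log (real N)
        (real (vector_space.dim sc
          (module.span sc (\<Union>i\<le>N. subspace_power sc mul e V i)))))))"


section \<open>Poisson algebras and Poisson differential operators\<close>

definition is_poisson_bracket ::
    "('k::field \<Rightarrow> 'a::comm_ring_1 \<Rightarrow> 'a) \<Rightarrow> ('a \<Rightarrow> 'a \<Rightarrow> 'a) \<Rightarrow> bool"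
  where "is_poisson_bracket sc br \<longleftrightarrow>
    (\<forall>a. Vector_Spaces.linear sc sc (\<lambda>x. br a x)) \<and>
    (\<forall>x. Vector_Spaces.linear sc sc (\<lambda>a. br a x)) \<and>
    (\<forall>a. br a a = 0) \<and>
    (\<forall>a b c. br a (br b c) + br b (br c a) + br c (br a b) = 0) \<and>
    (\<forall>a x y. br a (x * y) = br a x * y + x * br a y)"

definition End_alg :: "('k::field \<Rightarrow> 'a::ab_group_add \<Rightarrow> 'a) \<Rightarrow> ('a \<Rightarrow> 'a) set"
  where "End_alg sc = {g. Vector_Spaces.linear sc sc g}"

definition fun_scale :: "('k \<Rightarrow> 'a \<Rightarrow> 'a) \<Rightarrow> 'k \<Rightarrow> ('a \<Rightarrow> 'a) \<Rightarrow> ('a \<Rightarrow> 'a)"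
  where "fun_scale sc c g = (\<lambda>x. sc c (g x))"

text \<open>Addition of operators is pointwise (\<^theory>\<open>HOL-Library.Function_Algebras\<close>), but the
  product is composition, not the pointwise product of that theory.\<close>

definition poisson_diff_ops ::
    "('k::field \<Rightarrow> 'a::comm_ring_1 \<Rightarrow> 'a) \<Rightarrow> ('a \<Rightarrow> 'a \<Rightarrow> 'a) \<Rightarrow> ('a \<Rightarrow> 'a) set"
  where "poisson_diff_ops sc br =
    (\<lambda>B. B \<subseteq> End_alg sc \<and> is_subalgebra (fun_scale sc) (\<circ>) id B) hull
      (range (\<lambda>a x. a * x) \<union> range (\<lambda>a x. br a x))"


section \<open>The two matrices\<close>

definition to_frac :: "'a::idom \<Rightarrow> 'a fract"
  where "to_frac a = Fraction_Field.Fract a 1"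

text \<open>Row rank of the \<open>m \<times> n\<close> matrix with entries \<open>\<partial>f\<^sub>i/\<partial>x\<^sub>j\<close>; written through its rows (as in
  the definition of \<^const>\<open>rank\<close>) so that the number \<open>m\<close> of generators is an arbitrary natural
  number, including \<open>0\<close>.\<close>

definition jacobian_rank ::
    "(('n::finite, 'k::comm_ring_1) mpoly \<Rightarrow> 'a::idom) \<Rightarrow> nat \<Rightarrow> (nat \<Rightarrow> ('n, 'k) mpoly) \<Rightarrow> nat"
  where "jacobian_rank \<phi> m f =
    vec.dim {(\<chi> j. to_frac (\<phi> (pdiff j (f i)))) :: 'a fract ^ 'n | i. i < m}"

definition poisson_matrix ::
    "(('n::finite, 'k::comm_ring_1) mpoly \<Rightarrow> 'a::idom) \<Rightarrow> ('a \<Rightarrow> 'a \<Rightarrow> 'a) \<Rightarrow> 'a fract ^ 'n ^ 'n"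
  where "poisson_matrix \<phi> br = (\<chi> i j. to_frac (br (\<phi> (pvar i)) (\<phi> (pvar j))))"

end

(* Let F be the field of fractions of A and x_1, ..., x_n the images of the variables in F.  A space
   of derivations of F that is an F-subspace and closed under commutators has a coordinate frame:
   there are a set J of indices and derivations d_k (k in J) in the space with d_k x_l = [k = l] on J,
   spanning it over F.  The d_k commute, since their commutators lie in the space and vanish at the
   x_l.  For Der_K(F) the values (D x_j) fill the kernel of the Jacobian matrix, so |J| = n - r; for
   the F-span of the Hamiltonian derivations they fill the row space of C_A, so |J| = d.

   If z in F were transcendental over K[x_l : l in J], with J the set for Der_K(F), then d/dz would
   extend to a nonzero derivation of F killing all the x_l (characteristic zero).  So F is algebraic
   over K(x_l : l in J), and finitely generated subalgebras of F grow like N^(n-r) at most; the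
   monomials in the x_l are independent by applying powers of the frame.

   Operators in PD(A) are F-combinations of the monomials d^a of the Hamiltonian frame, and these are
   independent over F.  Filtering the coefficients by a finitely generated algebra stable under the
   frame bounds the growth by N^(n-r) N^d.  If g is a common denominator of the frame, the operators
   g^(2|a|) d^a lie in PD(A), and their products with the monomials in the x_l attain this growth. *)
theory Submission
  imports Defs "HOL-Real_Asymp.Real_Asymp"
begin

unbundle no fps_syntax
hide_const (open) up_ring.coeff up_ring.monom Polynomials.degree Polynomials.lead_coeff

text \<open>S is arbitrary, so neither A nor PD(A) need be finitely generated. Growth is estimated
  for one finite set of generators at a time, after its finitely many denominators have been cleared
  inside F. A frame plays the part of a transcendence basis: its derivations separate the monomials
  in the coordinates, and the absence of further derivations forces everything else to be algebraic.
  The Hamiltonian derivations of the generators neither commute nor need be independent over F.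
  Passing to a frame repairs both, at the price of denominators: the frame itself need not consist
  of operators on A. An operator P is therefore viewed as the function f -> e (P f) from A to F;
  there F multiplies and the frame differentiates on the left, which is all that growth estimates
  require. The F-span of the Hamiltonian derivations is closed under commutators because
  [ham a, ham b] = ham {a,b} and every ham a is already an F-combination of the finitely many ham
  x_i.\<close>

lemma (in vector_space) card_le_dim_family:
  assumes fI: "finite I" and vI: "v ` I \<subseteq> U" and U: "U \<subseteq> span S" and fS: "finite S"
    and ind: "\<And>c i. (\<Sum>i\<in>I. scale (c i) (v i)) = 0 \<Longrightarrow> i \<in> I \<Longrightarrow> c i = 0"
  shows "card I \<le> dim U"
proof -
  have inj: "inj_on v I"
  proof (rule inj_onI, rule ccontr)
    fix i j assume ij: "i \<in> I" "j \<in> I" "v i = v j" "i \<noteq> j"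
    let ?c = "\<lambda>k. if k = i then 1 else if k = j then - 1 else 0 :: 'a"
    have "(\<Sum>k\<in>I. scale (?c k) (v k)) = (\<Sum>k\<in>{i,j}. scale (?c k) (v k))"
      using fI ij by (intro sum.mono_neutral_right) auto
    also have "\<dots> = 0" using ij by simp
    finally have "?c i = 0" by (rule ind[of ?c]) (rule ij(1))
    then show False by simp
  qed
  have indep: "independent (v ` I)"
  proof (rule independent_if_scalars_zero)
    show "finite (v ` I)" using fI by simp
    fix f w assume "(\<Sum>x\<in>v ` I. scale (f x) x) = 0" and w: "w \<in> v ` I"
    then have "(\<Sum>i\<in>I. scale (f (v i)) (v i)) = 0"
      using inj by (simp add: sum.reindex)
    then show "f w = 0" using ind[of "\<lambda>i. f (v i)"] w by auto
  qed
  obtain B where B: "v ` I \<subseteq> B" "B \<subseteq> U" "independent B" "U \<subseteq> span B"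
    using maximal_independent_subset_extend[OF vI indep] by blast
  \<comment> \<open>An infinite basis would have \<open>card\<close> 0 and make \<open>dim U\<close>
    vanish; the finite spanning set \<open>S\<close> excludes this.\<close>
  have "finite B" using independent_span_bound[OF fS B(3)] B(2) U by auto
  have "card I = card (v ` I)" using inj by (simp add: card_image)
  also have "\<dots> \<le> card B" using B(1) \<open>finite B\<close> by (rule card_mono[rotated])
  also have "\<dots> = dim U" using basis_card_eq_dim B by blast
  finally show ?thesis .
qed

text \<open>Lets a filtration of the algebra be measured in F, and one of operators in the functions
  from A to F, where denominators are available.\<close>

lemma dim_le_card_inj_image:
  assumes "Vector_Spaces.linear s1 s2 g" and inj: "inj g" and gX: "g ` U \<subseteq> module.span s2 S"
    and fS: "finite S"
  shows "vector_space.dim s1 U \<le> card S"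
proof -
  interpret Vector_Spaces.linear s1 s2 g by fact
  obtain B where B: "B \<subseteq> U" "vs1.independent B" "U \<subseteq> vs1.span B" "card B = vs1.dim U"
    using vs1.basis_exists by blast
  have "vs2.independent (g ` B)"
    using independent_injective_image[OF B(2)] inj by (meson inj_on_subset subset_UNIV)
  then have "finite (g ` B) \<and> card (g ` B) \<le> card S"
    using vs2.independent_span_bound[OF fS] gX B(1) by (meson image_mono order_trans)
  moreover have "card (g ` B) = card B" using inj by (meson card_image inj_on_subset subset_UNIV)
  ultimately show ?thesis using B(4) by simp
qed

lemma (in vector_space) span_image_linear:
  assumes "Vector_Spaces.linear scale scale g" "x \<in> span U" "g ` U \<subseteq> span Y"
  shows "g x \<in> span Y"
proof -
  interpret Vector_Spaces.linear scale scale g by fact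
  have "g x \<in> span (g ` U)" using assms(2) span_image by blast
  then show ?thesis using assms(3) span_minimal subspace_span by blast
qed

section \<open>Filtrations by powers of a generating subspace\<close>

text \<open>The laws are required on the carrier \<open>B\<close> only: for composition,
  \<open>mul_add\<close> and \<open>mul_scale\<close> fail when the left factor is not linear, and
  the type of operators contains such functions.\<close>

locale assoc_alg = vector_space sc
  for sc :: "'k::field \<Rightarrow> 'e::ab_group_add \<Rightarrow> 'e" +
  fixes mul :: "'e \<Rightarrow> 'e \<Rightarrow> 'e" and e :: 'e and B :: "'e set"
  assumes subspace_B: "subspace B" and unit_in_B: "e \<in> B"
    and mul_closed: "x \<in> B \<Longrightarrow> y \<in> B \<Longrightarrow> mul x y \<in> B"
    and add_mul: "x \<in> B \<Longrightarrow> y \<in> B \<Longrightarrow> z \<in> B \<Longrightarrow> mul (x + y) z = mul x z + mul y z"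
    and mul_add: "x \<in> B \<Longrightarrow> y \<in> B \<Longrightarrow> z \<in> B \<Longrightarrow> mul z (x + y) = mul z x + mul z y"
    and scale_mul: "x \<in> B \<Longrightarrow> y \<in> B \<Longrightarrow> mul (sc c x) y = sc c (mul x y)"
    and mul_scale: "x \<in> B \<Longrightarrow> y \<in> B \<Longrightarrow> mul x (sc c y) = sc c (mul x y)"
    and mul_assoc: "x \<in> B \<Longrightarrow> y \<in> B \<Longrightarrow> z \<in> B \<Longrightarrow> mul (mul x y) z = mul x (mul y z)"
    and unit_mul: "x \<in> B \<Longrightarrow> mul e x = x"
    and mul_unit: "x \<in> B \<Longrightarrow> mul x e = x"
begin

abbreviation pow where "pow \<equiv> subspace_power sc mul e"

definition filt :: "'e set \<Rightarrow> nat \<Rightarrow> 'e set"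
  where "filt V N = span (\<Union>i\<le>N. pow V i)"

lemma span_sub_B: "U \<subseteq> B \<Longrightarrow> span U \<subseteq> B"
  using span_minimal subspace_B by blast

lemma zero_mul: "y \<in> B \<Longrightarrow> mul 0 y = 0"
  using scale_mul[of y y 0] by simp

lemma mul_zero: "y \<in> B \<Longrightarrow> mul y 0 = 0"
  using mul_scale[of y y 0] by simp

lemma mul_span_left:
  assumes x: "x \<in> span U" and U: "U \<subseteq> B" and y: "y \<in> B" and T: "subspace T"
    and gen: "\<And>x. x \<in> U \<Longrightarrow> mul x y \<in> T"
  shows "mul x y \<in> T"
proof -
  have "x \<in> {x \<in> B. mul x y \<in> T}"
  proof (rule span_subspace_induct[OF x])
    show "subspace {x \<in> B. mul x y \<in> T}"
      using subspace_B T y unfolding subspace_def by (auto simp: zero_mul add_mul scale_mul)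
  qed (use gen U in auto)
  then show ?thesis by simp
qed

lemma mul_span_right:
  assumes x: "x \<in> span U" and U: "U \<subseteq> B" and y: "y \<in> B" and T: "subspace T"
    and gen: "\<And>x. x \<in> U \<Longrightarrow> mul y x \<in> T"
  shows "mul y x \<in> T"
proof -
  have "x \<in> {x \<in> B. mul y x \<in> T}"
  proof (rule span_subspace_induct[OF x])
    show "subspace {x \<in> B. mul y x \<in> T}"
      using subspace_B T y unfolding subspace_def by (auto simp: mul_zero mul_add mul_scale)
  qed (use gen U in auto)
  then show ?thesis by simp
qed

lemma pow_sub_B: "V \<subseteq> B \<Longrightarrow> pow V i \<subseteq> B"
proof (induction i)
  case 0 then show ?case using span_sub_B[of "{e}"] unit_in_B by simp
next
  case (Suc i)
  then have "{mul x y |x y. x \<in> pow V i \<and> y \<in> V} \<subseteq> B" using mul_closed by blast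
  then show ?case by (simp add: span_sub_B)
qed

lemma subspace_pow: "subspace (pow V i)"
  by (cases i) auto

lemma pow_mul:
  assumes V: "V \<subseteq> B" and x: "x \<in> pow V i"
  shows "y \<in> pow V j \<Longrightarrow> mul x y \<in> pow V (i + j)"
proof (induction j arbitrary: y)
  case 0
  have xB: "x \<in> B" using x pow_sub_B[OF V] by blast
  show ?case
    by (rule mul_span_right[where U = "{e}"])
      (use 0 xB x unit_in_B in \<open>auto simp: subspace_pow mul_unit\<close>)
next
  case (Suc j)
  have xB: "x \<in> B" using x pow_sub_B[OF V] by blast
  show ?case
  proof (rule mul_span_right[OF _ _ xB subspace_pow])
    show "y \<in> span {mul a b |a b. a \<in> pow V j \<and> b \<in> V}" using Suc.prems by simp
    show "{mul a b |a b. a \<in> pow V j \<and> b \<in> V} \<subseteq> B"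
      using V pow_sub_B[OF V] mul_closed by blast
    fix z assume "z \<in> {mul a b |a b. a \<in> pow V j \<and> b \<in> V}"
    then obtain a b where ab: "z = mul a b" "a \<in> pow V j" "b \<in> V" by blast
    have "mul x z = mul (mul x a) b"
      using ab V pow_sub_B[OF V] xB by (auto simp: mul_assoc subset_iff)
    also have "\<dots> \<in> pow V (i + Suc j)"
      using Suc.IH[OF ab(2)] ab(3) by (auto intro!: span_base)
    finally show "mul x z \<in> pow V (i + Suc j)" .
  qed
qed

lemma subspace_filt: "subspace (filt V N)"
  by (simp add: filt_def)

lemma pow_sub_filt: "i \<le> N \<Longrightarrow> pow V i \<subseteq> filt V N"
  unfolding filt_def by (meson UN_upper atMost_iff order_trans span_superset)

lemma filt_mono: "M \<le> N \<Longrightarrow> filt V M \<subseteq> filt V N"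
  unfolding filt_def by (intro span_mono) (meson UN_mono atMost_subset_iff order_refl)

lemma filt_sub_B: "V \<subseteq> B \<Longrightarrow> filt V N \<subseteq> B"
  unfolding filt_def by (intro span_sub_B) (use pow_sub_B in blast)

lemma filt_mul:
  assumes V: "V \<subseteq> B" and x: "x \<in> filt V M" and y: "y \<in> filt V N"
  shows "mul x y \<in> filt V (M + N)"
proof (rule mul_span_left[OF x[unfolded filt_def] _ _ subspace_filt])
  show "(\<Union>i\<le>M. pow V i) \<subseteq> B" using pow_sub_B[OF V] by blast
  show yB: "y \<in> B" using filt_sub_B[OF V] y by blast
  fix a assume "a \<in> (\<Union>i\<le>M. pow V i)"
  then obtain i where i: "i \<le> M" "a \<in> pow V i" by blast
  have aB: "a \<in> B" using i pow_sub_B[OF V] by blast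
  show "mul a y \<in> filt V (M + N)"
  proof (rule mul_span_right[OF y[unfolded filt_def] _ aB subspace_filt])
    show "(\<Union>i\<le>N. pow V i) \<subseteq> B" using pow_sub_B[OF V] by blast
    fix b assume "b \<in> (\<Union>i\<le>N. pow V i)"
    then obtain j where j: "j \<le> N" "b \<in> pow V j" by blast
    show "mul a b \<in> filt V (M + N)"
      using pow_mul[OF V i(2) j(2)] pow_sub_filt[of "i + j" "M + N"] i j by auto
  qed
qed

lemma unit_in_filt: "e \<in> filt V N"
  using pow_sub_filt[of 0 N V] span_base[of e "{e}"] by auto

lemma gen_in_filt: "V \<subseteq> B \<Longrightarrow> v \<in> V \<Longrightarrow> v \<in> filt V 1"
proof -
  assume v: "V \<subseteq> B" "v \<in> V"
  have "mul e v \<in> pow V (Suc 0)" using v by (auto intro!: span_base)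
  then show ?thesis using pow_sub_filt[of 1 1 V] v by (auto simp: unit_mul subset_iff)
qed

text \<open>The device behind every upper bound: an increasing chain of subspaces that right
  multiplication by \<open>V\<close> moves up one step must contain the filtration. Powers grow on
  the right, so the chain itself need not be multiplicative.\<close>

lemma filt_minimal:
  assumes V: "V \<subseteq> B" and sub: "\<And>N. subspace (T N)" and mono: "\<And>M N. M \<le> N \<Longrightarrow> T M \<subseteq> T N"
    and e: "e \<in> T 0"
    and step: "\<And>N x v. x \<in> B \<Longrightarrow> x \<in> T N \<Longrightarrow> v \<in> V \<Longrightarrow> mul x v \<in> T (Suc N)"
  shows "filt V N \<subseteq> T N"
proof -
  have T: "pow V i \<subseteq> T i" for i
  proof (induction i)
    case 0 then show ?case using e sub by (simp add: span_minimal)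
  next
    case (Suc i)
    have "{mul x y |x y. x \<in> pow V i \<and> y \<in> V} \<subseteq> T (Suc i)"
      using Suc step pow_sub_B[OF V] by blast
    then show ?case using sub by (simp add: span_minimal)
  qed
  have "(\<Union>i\<le>N. pow V i) \<subseteq> T N"
    by (intro UN_least order_trans[OF T] mono) simp
  then show ?thesis unfolding filt_def using sub span_minimal by blast
qed

text \<open>Passes between the finite-dimensional subspaces over which \<open>GKdim\<close> ranges
  and the finite generating sets with which the estimates work.\<close>

lemma filt_span_eq:
  assumes V: "V \<subseteq> B"
  shows "filt (span V) N = filt V N"
proof
  show "filt (span V) N \<subseteq> filt V N"
  proof (rule filt_minimal[OF span_sub_B[OF V] subspace_filt filt_mono unit_in_filt])
    fix N x v assume x: "x \<in> B" "x \<in> filt V N" and v: "v \<in> span V"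
    show "mul x v \<in> filt V (Suc N)"
      by (rule mul_span_right[OF v V x(1) subspace_filt])
        (use filt_mul[OF V x(2) gen_in_filt[OF V]] in auto)
  qed
  show "filt V N \<subseteq> filt (span V) N"
  proof (rule filt_minimal[OF V subspace_filt filt_mono unit_in_filt])
    fix N x v assume x: "x \<in> B" "x \<in> filt (span V) N" and v: "v \<in> V"
    show "mul x v \<in> filt (span V) (Suc N)"
      using filt_mul[OF span_sub_B[OF V] x(2) gen_in_filt[OF span_sub_B[OF V]], of v] v span_base
      by auto
  qed
qed

text \<open>Supplies the finite spanning sets without which comparisons of \<open>dim\<close> would
  fail.\<close>

lemma filt_finite_dim:
  assumes V: "V \<subseteq> B" and f: "finite V"
  shows "\<exists>S. finite S \<and> filt V N \<subseteq> span S"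
proof -
  have "\<exists>S. finite S \<and> S \<subseteq> B \<and> pow V i \<subseteq> span S" for i
  proof (induction i)
    case 0 show ?case by (rule exI[of _ "{e}"]) (use unit_in_B in auto)
  next
    case (Suc i)
    then obtain S where S: "finite S" "S \<subseteq> B" "pow V i \<subseteq> span S" by blast
    let ?S = "(\<lambda>(x, y). mul x y) ` (S \<times> V)"
    have "{mul x y |x y. x \<in> pow V i \<and> y \<in> V} \<subseteq> span ?S"
    proof clarify
      fix x y assume x: "x \<in> pow V i" and y: "y \<in> V"
      have xS: "x \<in> span S" and yB: "y \<in> B" using x y S V by auto
      show "mul x y \<in> span ?S"
        by (rule mul_span_left[OF xS S(2) yB]) (use y in \<open>auto intro!: span_base\<close>)
    qed
    then have "pow V (Suc i) \<subseteq> span ?S" by (simp add: span_minimal)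
    moreover have "finite ?S" "?S \<subseteq> B" using S f V by (auto intro!: mul_closed)
    ultimately show ?case by blast
  qed
  then obtain S where S: "\<And>i. finite (S i)" "\<And>i. pow V i \<subseteq> span (S i)" by metis
  have "filt V N \<subseteq> span (\<Union>i\<le>N. S i)"
    unfolding filt_def
  proof (rule span_minimal)
    have "span (S i) \<subseteq> span (\<Union>i\<le>N. S i)" if "i \<le> N" for i
      using that by (intro span_mono) auto
    then show "(\<Union>i\<le>N. pow V i) \<subseteq> span (\<Union>i\<le>N. S i)"
      by (intro UN_least order_trans[OF S(2)]) auto
  qed simp
  moreover have "finite (\<Union>i\<le>N. S i)" using S(1) by auto
  ultimately show ?thesis by blast
qed

lemma GKdim_filt:
  "GKdim sc mul e C = (SUP V \<in> {V. V \<subseteq> C \<and> (\<exists>F. finite F \<and> V = span F)}.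
      limsup (\<lambda>N::nat. ereal (log (real N) (real (dim (filt V N))))))"
  unfolding GKdim_def filt_def ..

lemma GKdim_le:
  assumes C: "C \<subseteq> B"
    and growth: "\<And>F. finite F \<Longrightarrow> F \<subseteq> C \<Longrightarrow> \<exists>K. \<forall>N. dim (filt F N) \<le> K * (N + 1) ^ q"
  shows "GKdim sc mul e C \<le> ereal (real q)"
  unfolding GKdim_filt
proof (rule SUP_least, clarify)
  fix F assume F: "span F \<subseteq> C" "finite F"
  then have FC: "F \<subseteq> C" using span_superset by blast
  from growth[OF F(2) FC] obtain K where K: "\<And>N. dim (filt F N) \<le> K * (N + 1) ^ q" by blast
  \<comment> \<open>\<open>K + 1\<close> instead of \<open>K\<close> keeps the argument at least 1,
    hence its logarithm nonnegative; this covers dimension 0, where \<open>ln 0 = 0\<close>.\<close>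
  define a where "a = (\<lambda>N::nat. log (real N) ((real K + 1) * (real N + 1) ^ q))"
  have eq: "filt (span F) N = filt F N" for N using filt_span_eq FC C by simp
  have "limsup (\<lambda>N. ereal (log (real N) (real (dim (filt (span F) N))))) \<le> limsup (\<lambda>N. ereal (a N))"
  proof (rule Limsup_mono, rule eventually_sequentiallyI[of 2])
    fix N :: nat assume N: "N \<ge> 2"
    have big: "(real K + 1) * (real N + 1) ^ q \<ge> 1"
      using mult_mono[of 1 "real K + 1" 1 "(real N + 1) ^ q"] by (simp add: one_le_power)
    have "real (dim (filt F N)) \<le> real (K * (N + 1) ^ q)" using K by (simp only: of_nat_le_iff)
    also have "\<dots> \<le> (real K + 1) * (real N + 1) ^ q" by (simp add: algebra_simps)
    finally have le: "real (dim (filt F N)) \<le> (real K + 1) * (real N + 1) ^ q" .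
    have "log N (real (dim (filt F N))) \<le> a N"
    proof (cases "dim (filt F N) = 0")
      case True
      then show ?thesis using big N by (simp add: a_def log_def)
    next
      case False
      then show ?thesis unfolding a_def using le N big by (intro log_mono) auto
    qed
    then show "ereal (log (real N) (real (dim (filt (span F) N)))) \<le> ereal (a N)"
      by (simp add: eq)
  qed
  also have "limsup (\<lambda>N. ereal (a N)) = ereal (real q)"
  proof (rule lim_imp_Limsup)
    have "a \<longlonglongrightarrow> real q"
    proof -
      have pos: "real K + 1 > 0" by simp
      have "(\<lambda>N. (ln (real K + 1) + real q * ln (real N + 1)) / ln (real N)) \<longlonglongrightarrow> real q"
        by real_asymp
      then show ?thesis
        unfolding a_def log_def using pos by (simp add: ln_mult ln_realpow)
    qed
    then show "(\<lambda>N. ereal (a N)) \<longlonglongrightarrow> ereal (real q)" by (rule tendsto_ereal)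
  qed simp
  finally show "limsup (\<lambda>N. ereal (log (real N) (real (dim (filt (span F) N))))) \<le> ereal (real q)" .
qed

text \<open>Growth along the multiples of \<open>c\<close> is enough: rounding \<open>N\<close> down
  to \<open>c * (N div c)\<close> changes the bound by a factor that disappears after dividing by
  \<open>ln N\<close>.\<close>

lemma GKdim_ge:
  assumes C: "C \<subseteq> B" and F: "finite F" "span F \<subseteq> C" and c: "c \<ge> (1::nat)"
    and growth: "\<And>N. N ^ q \<le> dim (filt (span F) (c * N))"
  shows "ereal (real q) \<le> GKdim sc mul e C"
proof -
  have FB: "F \<subseteq> B" using F(2) C span_superset by blast
  \<comment> \<open>\<open>N / c - 1\<close> is a smooth lower bound for \<open>N div c\<close>.
    From \<open>N = 2 * c\<close> on it is at least 1, so the logarithm of its power splits.\<close>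
  define a where "a = (\<lambda>N::nat. log (real N) ((real N / real c - 1) ^ q))"
  have "a \<longlonglongrightarrow> real q"
  proof -
    have pos: "real c > 0" using c by simp
    have lim: "(\<lambda>N. real q * ln (real N / real c - 1) / ln (real N)) \<longlonglongrightarrow> real q"
      using pos by real_asymp
    have "eventually (\<lambda>N. real q * ln (real N / real c - 1) / ln (real N) = a N) sequentially"
    proof (rule eventually_sequentiallyI[of "2 * c"])
      fix N :: nat assume "2 * c \<le> N"
      then have "real N / real c \<ge> 2" using pos by (simp add: field_simps flip: of_nat_mult)
      then show "real q * ln (real N / real c - 1) / ln (real N) = a N"
        unfolding a_def log_def by (simp add: ln_realpow)
    qed
    then show ?thesis using lim by (rule Lim_transform_eventually[rotated])
  qed
  then have "limsup (\<lambda>N. ereal (a N)) = ereal (real q)"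
    by (intro lim_imp_Limsup tendsto_ereal) simp_all
  moreover have "limsup (\<lambda>N. ereal (a N))
      \<le> limsup (\<lambda>N. ereal (log (real N) (real (dim (filt (span F) N)))))"
  proof (rule Limsup_mono, rule eventually_sequentiallyI[of "2 * c"])
    fix N :: nat assume N: "2 * c \<le> N"
    have pos: "real c > 0" using c by simp
    have N1: "real N > 1" using N c by linarith
    have ge2: "real N / real c \<ge> 2" using N pos by (simp add: field_simps flip: of_nat_mult)
    have q: "real N / real c - 1 \<le> real (N div c)"
    proof -
      have "N = c * (N div c) + N mod c" by simp
      moreover have "N mod c \<le> c" using c by (simp add: less_imp_le)
      ultimately have "N \<le> c * (N div c) + c" by linarith
      then have "real N \<le> real (c * (N div c) + c)" by (simp only: of_nat_le_iff)
      then show ?thesis using pos by (simp add: field_simps)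
    qed
    have "(N div c) ^ q \<le> dim (filt (span F) (c * (N div c)))" by (rule growth)
    also have "\<dots> \<le> dim (filt (span F) N)"
    proof -
      obtain S where S: "finite S" "filt (span F) N \<subseteq> span S"
        using filt_finite_dim[OF FB F(1)] filt_span_eq[OF FB] by metis
      have sub: "filt (span F) (c * (N div c)) \<subseteq> filt (span F) N"
        by (intro filt_mono) simp
      obtain b where b: "b \<subseteq> filt (span F) (c * (N div c))" "independent b"
        "card b = dim (filt (span F) (c * (N div c)))"
        using basis_exists by metis
      have "finite b" using independent_span_bound[OF S(1) b(2)] b(1) sub S(2) by blast
      have "card b \<le> dim (filt (span F) N)"
      proof (rule card_le_dim_family[of b id, OF \<open>finite b\<close> _ S(2,1)])
        fix f i assume "(\<Sum>i\<in>b. sc (f i) (id i)) = 0" "i \<in> b"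
        then show "f i = 0" using independentD[OF b(2) \<open>finite b\<close> subset_refl, of f i] by simp
      qed (use b(1) sub in auto)
      then show ?thesis using b by simp
    qed
    finally have "real ((N div c) ^ q) \<le> real (dim (filt (span F) N))" by (simp only: of_nat_le_iff)
    then have "(real N / real c - 1) ^ q \<le> real (dim (filt (span F) N))"
      using power_mono[OF q, of q] ge2 unfolding of_nat_power by linarith
    moreover have "0 < (real N / real c - 1) ^ q" using ge2 by simp
    ultimately have "a N \<le> log (real N) (real (dim (filt (span F) N)))"
      unfolding a_def using N1 by (intro log_mono) auto
    then show "ereal (a N) \<le> ereal (log (real N) (real (dim (filt (span F) N))))" by simp
  qed
  moreover have "limsup (\<lambda>N. ereal (log (real N) (real (dim (filt (span F) N)))))
      \<le> GKdim sc mul e C"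
    unfolding GKdim_filt by (rule SUP_upper) (use F in auto)
  ultimately show ?thesis by order
qed

end

section \<open>Coordinate subsets and multi-indices\<close>

text \<open>Take \<open>J\<close> smallest such that a vector of \<open>U\<close> is determined by
  its coordinates in \<open>J\<close>. Dropping \<open>k\<close> from \<open>J\<close> destroys
  this, so some vector of \<open>U\<close> vanishes on the rest of \<open>J\<close> but not at
  \<open>k\<close>; normalising it gives \<open>\<rho> k\<close>. This is a reduced echelon basis
  with pivots \<open>J\<close>.\<close>

lemma subspace_coordinates:
  fixes U :: "('f::field^'n) set"
  assumes U: "vec.subspace U"
  obtains J and \<rho> :: "'n \<Rightarrow> 'f^'n" where "\<And>k. k \<in> J \<Longrightarrow> \<rho> k \<in> U"
    and "\<And>k l. k \<in> J \<Longrightarrow> l \<in> J \<Longrightarrow> \<rho> k $ l = (if k = l then 1 else 0)"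
    and "\<And>v. v \<in> U \<Longrightarrow> v = (\<Sum>k\<in>J. v $ k *s \<rho> k)"
    and "card J = vec.dim U"
proof -
  define inj where "inj J \<longleftrightarrow> (\<forall>v\<in>U. (\<forall>l\<in>J. v $ l = 0) \<longrightarrow> v = 0)" for J :: "'n set"
  have "inj UNIV" by (simp add: inj_def vec_eq_iff)
  then obtain J where J: "inj J" and min: "\<And>J'. inj J' \<Longrightarrow> card J \<le> card J'"
    using ex_has_least_nat[of inj UNIV card] by blast
  have "\<exists>v\<in>U. \<forall>l\<in>J. v $ l = (if k = l then 1 else 0)" if k: "k \<in> J" for k
  proof -
    have "card (J - {k}) < card J" using k by (intro psubset_card_mono) auto
    then have "\<not> inj (J - {k})" using min leD by blast
    then obtain v where v: "v \<in> U" "\<forall>l\<in>J - {k}. v $ l = 0" "v \<noteq> 0" unfolding inj_def by blast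
    have "v $ k \<noteq> 0" using J v k unfolding inj_def by blast
    then have "\<forall>l\<in>J. ((1 / v $ k) *s v) $ l = (if k = l then 1 else 0)" using v(2) by auto
    moreover have "(1 / v $ k) *s v \<in> U" using U v(1) by (rule vec.subspace_scale)
    ultimately show ?thesis by blast
  qed
  then obtain \<rho> :: "'n \<Rightarrow> 'f^'n" where \<rho>: "\<And>k. k \<in> J \<Longrightarrow> \<rho> k \<in> U"
    "\<And>k l. k \<in> J \<Longrightarrow> l \<in> J \<Longrightarrow> \<rho> k $ l = (if k = l then 1 else 0)" by metis
  have comb: "(\<Sum>k\<in>J. c k *s \<rho> k) $ l = c l" if "l \<in> J" for c l
    using that by (simp add: sum_component \<rho>(2) if_distrib[of "\<lambda>a. _ * a"] cong: if_cong)
  have expand: "v = (\<Sum>k\<in>J. v $ k *s \<rho> k)" if v: "v \<in> U" for v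
  proof -
    have "v - (\<Sum>k\<in>J. v $ k *s \<rho> k) \<in> U"
      using U v \<rho>(1) by (intro vec.subspace_diff vec.subspace_sum vec.subspace_scale)
    moreover have "(v - (\<Sum>k\<in>J. v $ k *s \<rho> k)) $ l = 0" if "l \<in> J" for l
      using comb[OF that] by simp
    ultimately have "v - (\<Sum>k\<in>J. v $ k *s \<rho> k) = 0" using J unfolding inj_def by blast
    then show ?thesis by simp
  qed
  have "U \<subseteq> vec.span (\<rho> ` J)"
  proof
    fix v assume "v \<in> U"
    then have "v = (\<Sum>k\<in>J. v $ k *s \<rho> k)" by (rule expand)
    also have "\<dots> \<in> vec.span (\<rho> ` J)"
      by (intro vec.span_sum vec.span_scale vec.span_base) auto
    finally show "v \<in> vec.span (\<rho> ` J)" .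
  qed
  then have "vec.dim U \<le> card (\<rho> ` J)" by (rule vec.dim_le_card) simp
  also have "\<dots> \<le> card J" by (rule card_image_le) simp
  finally have le: "vec.dim U \<le> card J" .
  have "card J \<le> vec.dim U"
  proof (rule vec.card_le_dim_family[of J \<rho> U "\<rho> ` J"])
    show "U \<subseteq> vec.span (\<rho> ` J)" by fact
    fix c i assume "(\<Sum>i\<in>J. c i *s \<rho> i) = 0" "i \<in> J"
    then show "c i = 0" using comb[of i c] by simp
  qed (use \<rho>(1) in auto)
  then show thesis using that[OF \<rho> expand] le by force
qed

text \<open>Exponents are multisets, so that monomials in coordinates and in derivations are both
  built by adding one factor at a time, with \<open>size\<close> as degree.\<close>

definition multi_indices :: "'n set \<Rightarrow> nat \<Rightarrow> 'n multiset set"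
  where "multi_indices J N = {\<beta>. set_mset \<beta> \<subseteq> J \<and> size \<beta> \<le> N}"

lemma multi_indices_mono: "M \<le> N \<Longrightarrow> multi_indices J M \<subseteq> multi_indices J N"
  by (auto simp: multi_indices_def)

lemma multi_indices_finite_card:
  fixes J :: "'n::finite set"
  shows "finite (multi_indices J N)" "card (multi_indices J N) \<le> (N + 1) ^ card J"
proof -
  let ?P = "J \<rightarrow>\<^sub>E {..N}" and ?f = "\<lambda>\<beta>. restrict (count \<beta>) J"
  have inj: "inj_on ?f (multi_indices J N)"
  proof (rule inj_onI)
    fix \<beta> \<gamma> assume *: "\<beta> \<in> multi_indices J N" "\<gamma> \<in> multi_indices J N" "?f \<beta> = ?f \<gamma>"
    show "\<beta> = \<gamma>"
    proof (rule multiset_eqI)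
      fix k
      show "count \<beta> k = count \<gamma> k"
      proof (cases "k \<in> J")
        case True then show ?thesis using fun_cong[OF *(3), of k] by simp
      next
        case False
        then have "k \<notin># \<beta>" "k \<notin># \<gamma>" using * by (auto simp: multi_indices_def)
        then show ?thesis by (simp add: not_in_iff)
      qed
    qed
  qed
  have sub: "?f ` multi_indices J N \<subseteq> ?P"
  proof clarify
    fix \<beta> assume "\<beta> \<in> multi_indices J N"
    then have "count \<beta> k \<le> N" for k
      using count_le_size[of \<beta> k] by (simp add: multi_indices_def)
    then show "?f \<beta> \<in> ?P" by auto
  qed
  have fin: "finite ?P" by (intro finite_PiE) auto
  show "finite (multi_indices J N)" using inj_on_finite[OF inj sub fin] .
  have "card (multi_indices J N) \<le> card ?P" by (rule card_inj_on_le[OF inj sub fin])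
  then show "card (multi_indices J N) \<le> (N + 1) ^ card J" by (simp add: card_PiE)
qed

text \<open>The box of exponents at most \<open>N\<close> has \<open>(N + 1) ^ card J\<close>
  points, all of total degree at most \<open>N * card J\<close>. The factor \<open>card J\<close> is
  absorbed by the constant in the lower bound for growth.\<close>

lemma multi_indices_card_ge:
  fixes J :: "'n::finite set"
  shows "(N + 1) ^ card J \<le> card (multi_indices J (N * card J))"
proof -
  let ?P = "J \<rightarrow>\<^sub>E {..N}" and ?g = "\<lambda>f. \<Sum>k\<in>J. replicate_mset (f k) k"
  have count: "count (?g f) k = (if k \<in> J then f k else 0)" for f k
    by (simp add: count_sum if_distrib sum.delta cong: if_cong)
  have "inj_on ?g ?P"
  proof (rule inj_onI)
    fix f h assume *: "f \<in> ?P" "h \<in> ?P" "?g f = ?g h"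
    show "f = h"
    proof (rule PiE_ext[OF *(1,2)])
      fix k assume "k \<in> J"
      then show "f k = h k" using arg_cong[OF *(3), of "\<lambda>m. count m k"] by (simp add: count)
    qed
  qed
  moreover have "?g ` ?P \<subseteq> multi_indices J (N * card J)"
  proof clarify
    fix f assume f: "f \<in> ?P"
    have "size (?g f) = (\<Sum>k\<in>J. f k)" by simp
    also have "\<dots> \<le> (\<Sum>k\<in>J. N)" using f by (intro sum_mono) auto
    finally have "size (?g f) \<le> N * card J" by (simp add: mult.commute)
    moreover have "set_mset (?g f) \<subseteq> J"
      using count[of f] by (auto simp flip: count_greater_zero_iff split: if_splits)
    ultimately show "?g f \<in> multi_indices J (N * card J)" by (simp add: multi_indices_def)
  qed
  ultimately have "card ?P \<le> card (multi_indices J (N * card J))"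
    using card_inj_on_le multi_indices_finite_card(1) by blast
  then show ?thesis by (simp add: card_PiE)
qed

section \<open>Derivations of finitely generated field extensions\<close>

locale field_ext =
  fixes \<kappa> :: "'k::field_char_0 \<Rightarrow> 'f::field" and x :: "'n::finite \<Rightarrow> 'f"
  assumes \<kappa>_add: "\<kappa> (a + b) = \<kappa> a + \<kappa> b" and \<kappa>_mult: "\<kappa> (a * b) = \<kappa> a * \<kappa> b"
    and \<kappa>_1: "\<kappa> 1 = 1"
begin

definition ks :: "'k \<Rightarrow> 'f \<Rightarrow> 'f" where "ks c z = \<kappa> c * z"

sublocale ks: vector_space ks
  by unfold_locales (simp_all add: ks_def algebra_simps \<kappa>_add \<kappa>_mult \<kappa>_1)

sublocale alg: assoc_alg ks "(*)" 1 UNIV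
  by unfold_locales (simp_all add: ks_def algebra_simps ks.subspace_UNIV)

lemma \<kappa>_0 [simp]: "\<kappa> 0 = 0"
  using \<kappa>_add[of 0 0] by (metis add.right_neutral add_left_cancel)

lemma \<kappa>_uminus: "\<kappa> (- a) = - \<kappa> a"
  using \<kappa>_add[of a "- a"] by (simp add: add_eq_0_iff)

lemma \<kappa>_eq_0_iff [simp]: "\<kappa> a = 0 \<longleftrightarrow> a = 0"
proof
  show "a = 0" if "\<kappa> a = 0"
  proof (rule ccontr)
    assume "a \<noteq> 0"
    then have "\<kappa> a * \<kappa> (1 / a) = 1" by (simp flip: \<kappa>_mult add: \<kappa>_1)
    then show False using that by simp
  qed
qed simp

lemma \<kappa>_of_nat: "\<kappa> (of_nat n) = of_nat n"
  by (induction n) (simp_all add: \<kappa>_add \<kappa>_1)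

text \<open>\<open>'f\<close> is only of class \<open>field\<close>; characteristic zero reaches it
  through the injectivity of \<open>\<kappa>\<close>.\<close>

lemma of_nat_eq_0_iff' [simp]: "(of_nat n :: 'f) = 0 \<longleftrightarrow> n = 0"
  by (metis \<kappa>_of_nat \<kappa>_eq_0_iff of_nat_eq_0_iff)

definition mon :: "'n multiset \<Rightarrow> 'f" where "mon \<beta> = prod_mset (image_mset x \<beta>)"

lemma mon_simps [simp]: "mon {#} = 1" "mon (add_mset k \<beta>) = x k * mon \<beta>"
  "mon (\<beta> + \<gamma>) = mon \<beta> * mon \<gamma>"
  by (simp_all add: mon_def)

definition polys :: "'n set \<Rightarrow> 'f set"
  where "polys J = ks.span {mon \<beta> |\<beta>. set_mset \<beta> \<subseteq> J}"

definition subring :: "'f set \<Rightarrow> bool"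
  where "subring B \<longleftrightarrow> (\<forall>c. \<kappa> c \<in> B) \<and> (\<forall>a\<in>B. \<forall>b\<in>B. a + b \<in> B \<and> a * b \<in> B)"

lemma subring_simps:
  assumes "subring B"
  shows "0 \<in> B" "1 \<in> B" "\<kappa> c \<in> B" "a \<in> B \<Longrightarrow> b \<in> B \<Longrightarrow> a + b \<in> B"
    "a \<in> B \<Longrightarrow> b \<in> B \<Longrightarrow> a * b \<in> B" "a \<in> B \<Longrightarrow> - a \<in> B" "a \<in> B \<Longrightarrow> b \<in> B \<Longrightarrow> a - b \<in> B"
proof -
  show *: "\<kappa> c \<in> B" "a \<in> B \<Longrightarrow> b \<in> B \<Longrightarrow> a + b \<in> B" "a \<in> B \<Longrightarrow> b \<in> B \<Longrightarrow> a * b \<in> B" for a b c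
    using assms by (auto simp: subring_def)
  show "0 \<in> B" "1 \<in> B" using *(1)[of 0] *(1)[of 1] by (simp_all add: \<kappa>_1)
  show m: "- a \<in> B" if "a \<in> B" for a
    using *(3)[OF *(1)[of "- 1"] that] by (simp add: \<kappa>_uminus \<kappa>_1)
  show "a - b \<in> B" if "a \<in> B" "b \<in> B" for a b
    using *(2)[OF that(1) m[OF that(2)]] by simp
qed

lemma subring_sum: "subring B \<Longrightarrow> (\<And>i. i \<in> I \<Longrightarrow> g i \<in> B) \<Longrightarrow> sum g I \<in> B"
  by (induction I rule: infinite_finite_induct) (auto simp: subring_simps)

lemma subring_subspace: "subring B \<Longrightarrow> ks.subspace B"
  by (auto simp: ks.subspace_def ks_def subring_simps)

lemma subring_polys: "subring (polys J)"
  unfolding subring_def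
proof (intro conjI allI ballI)
  fix c show "\<kappa> c \<in> polys J"
    using ks.span_scale[OF ks.span_base, of 1 "{mon \<beta> |\<beta>. set_mset \<beta> \<subseteq> J}" c]
    unfolding polys_def by (force simp: ks_def intro: exI[of _ "{#}"])
next
  fix a b assume a: "a \<in> polys J" and b: "b \<in> polys J"
  then show "a + b \<in> polys J" unfolding polys_def by (rule ks.span_add)
  show "a * b \<in> polys J"
  proof (rule alg.mul_span_left[OF a[unfolded polys_def]])
    fix a assume "a \<in> {mon \<beta> |\<beta>. set_mset \<beta> \<subseteq> J}"
    then obtain \<beta> where \<beta>: "a = mon \<beta>" "set_mset \<beta> \<subseteq> J" by blast
    show "a * b \<in> polys J"
    proof (rule alg.mul_span_right[OF b[unfolded polys_def]])
      fix b assume "b \<in> {mon \<beta> |\<beta>. set_mset \<beta> \<subseteq> J}"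
      then obtain \<gamma> where "b = mon \<gamma>" "set_mset \<gamma> \<subseteq> J" by blast
      then have "a * b = mon (\<beta> + \<gamma>)" "set_mset (\<beta> + \<gamma>) \<subseteq> J" using \<beta> by auto
      then show "a * b \<in> polys J" unfolding polys_def by (intro ks.span_base) blast
    qed (auto simp: polys_def)
  qed (auto simp: polys_def)
qed

lemma mon_in_polys: "set_mset \<beta> \<subseteq> J \<Longrightarrow> mon \<beta> \<in> polys J"
  unfolding polys_def by (intro ks.span_base) blast

lemma x_in_polys: "j \<in> J \<Longrightarrow> x j \<in> polys J"
  using mon_in_polys[of "{#j#}" J] by simp

lemma polys_minimal: "subring B \<Longrightarrow> (\<And>j. j \<in> J \<Longrightarrow> x j \<in> B) \<Longrightarrow> polys J \<subseteq> B"
  unfolding polys_def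
proof (rule ks.span_minimal)
  assume B: "subring B" "\<And>j. j \<in> J \<Longrightarrow> x j \<in> B"
  have "set_mset \<beta> \<subseteq> J \<Longrightarrow> mon \<beta> \<in> B" for \<beta>
    by (induction \<beta>) (use B in \<open>auto simp: subring_simps\<close>)
  then show "{mon \<beta> |\<beta>. set_mset \<beta> \<subseteq> J} \<subseteq> B" by blast
qed (rule subring_subspace)

text \<open>Only the values on \<open>B\<close> matter, and they may leave \<open>B\<close>: this is
  a K-derivation from a subalgebra to the field, the object that is extended one generator at a
  time.\<close>

definition der_on :: "'f set \<Rightarrow> ('f \<Rightarrow> 'f) \<Rightarrow> bool"
  where "der_on B D \<longleftrightarrow> (\<forall>c. D (\<kappa> c) = 0) \<and>
    (\<forall>a\<in>B. \<forall>b\<in>B. D (a + b) = D a + D b \<and> D (a * b) = D a * b + a * D b)"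

abbreviation der :: "('f \<Rightarrow> 'f) \<Rightarrow> bool" where "der \<equiv> der_on UNIV"

lemma der_on_simps:
  assumes "subring B" "der_on B D"
  shows "D (\<kappa> c) = 0" "D 0 = 0" "D 1 = 0" "a \<in> B \<Longrightarrow> b \<in> B \<Longrightarrow> D (a + b) = D a + D b"
    "a \<in> B \<Longrightarrow> b \<in> B \<Longrightarrow> D (a * b) = D a * b + a * D b" "a \<in> B \<Longrightarrow> D (- a) = - D a"
    "a \<in> B \<Longrightarrow> b \<in> B \<Longrightarrow> D (a - b) = D a - D b"
proof -
  show k: "D (\<kappa> c) = 0" for c using assms by (auto simp: der_on_def)
  show "D 0 = 0" "D 1 = 0" using k[of 0] k[of 1] by (simp_all add: \<kappa>_1)
  show *: "D (a + b) = D a + D b" "D (a * b) = D a * b + a * D b" if "a \<in> B" "b \<in> B" for a b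
    using assms that by (auto simp: der_on_def)
  show m: "D (- a) = - D a" if "a \<in> B" for a
    using *(1)[OF that, of "- a"] that assms \<open>D 0 = 0\<close> by (simp add: subring_simps add_eq_0_iff)
  show "D (a - b) = D a - D b" if "a \<in> B" "b \<in> B" for a b
    using *(1)[OF that(1), of "- b"] m[OF that(2)] that assms by (simp add: subring_simps)
qed

lemma der_on_sum:
  assumes "subring B" "der_on B D"
  shows "(\<And>i. i \<in> I \<Longrightarrow> g i \<in> B) \<Longrightarrow> D (sum g I) = (\<Sum>i\<in>I. D (g i))"
  by (induction I rule: infinite_finite_induct)
    (auto simp: der_on_simps[OF assms] subring_sum[OF assms(1)])

lemma subring_UNIV: "subring UNIV"
  by (simp add: subring_def)

lemmas der_simps = der_on_simps[OF subring_UNIV, simplified]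
lemmas der_sum = der_on_sum[OF subring_UNIV, simplified]

lemma der_ks: "der D \<Longrightarrow> D (ks c z) = ks c (D z)"
  by (simp add: ks_def der_simps)

lemma der_of_nat: "der D \<Longrightarrow> D (of_nat n * z) = of_nat n * D z"
  using der_ks[of D "of_nat n" z] by (simp add: ks_def \<kappa>_of_nat)

lemma der_power: "der D \<Longrightarrow> D (z ^ n) = of_nat n * z ^ (n - 1) * D z"
proof (induction n)
  case (Suc n) then show ?case by (cases n) (simp_all add: der_simps algebra_simps)
qed (simp add: der_simps)

lemma der_divide: "der D \<Longrightarrow> b \<noteq> 0 \<Longrightarrow> D (a / b) = (D a - (a / b) * D b) / b"
proof -
  assume D: "der D" and b: "b \<noteq> 0"
  have "D a = D (a / b) * b + (a / b) * D b" using der_simps(5)[OF D, of "a / b" b] b by simp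
  then show ?thesis using b by (simp add: field_simps)
qed

lemma der_eq_on_polys:
  assumes "der D" "der D'" "\<And>j. D (x j) = D' (x j)" "p \<in> polys UNIV"
  shows "D p = D' p"
proof -
  have "subring {p. D p = D' p}" by (auto simp: subring_def der_simps assms(1,2))
  then have "polys UNIV \<subseteq> {p. D p = D' p}" by (rule polys_minimal) (use assms in auto)
  then show ?thesis using assms by blast
qed

text \<open>The quotient rule forces the value. It is independent of the chosen fraction because the
  identity p q' = p' q lives in \<open>B\<close>, where it can be differentiated.\<close>

lemma der_on_fraction_extension:
  assumes B: "subring B" and D: "der_on B D" and frac: "\<And>z. \<exists>p\<in>B. \<exists>q\<in>B. q \<noteq> 0 \<and> z = p / q"
  obtains D' where "der D'" "\<And>b. b \<in> B \<Longrightarrow> D' b = D b"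
proof -
  \<comment> \<open>This form of the quotient rule contains the fraction itself, so two
    representations of the same \<open>z\<close> are compared by one cross-multiplication.\<close>
  define val where "val p q = (D p - (p / q) * D q) / q" for p q
  from frac obtain P Q where PQ: "\<And>z. P z \<in> B" "\<And>z. Q z \<in> B" "\<And>z. Q z \<noteq> 0" "\<And>z. z = P z / Q z"
    by metis
  define D' where "D' z = val (P z) (Q z)" for z
  have wd: "D' z = val p q" if p: "p \<in> B" "q \<in> B" "q \<noteq> 0" "z = p / q" for z p q
  proof -
    let ?p = "P z" and ?q = "Q z"
    have z: "p = z * q" "?p = z * ?q" using p(3,4) PQ(3,4)[of z] by (simp_all add: nonzero_eq_divide_eq)
    have "p * ?q = ?p * q" using z by simp
    then have "D p * ?q + p * D ?q = D ?p * q + ?p * D q"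
      using der_on_simps(5)[OF B D] p PQ(1,2) by metis
    then have "(D p - z * D q) * ?q = (D ?p - z * D ?q) * q"
      using z by (simp add: algebra_simps)
    then show ?thesis unfolding D'_def val_def
      using PQ(3)[of z] PQ(4)[of z, symmetric] p(3,4) by (simp add: frac_eq_eq)
  qed
  note ss = subring_simps[OF B] and ds = der_on_simps[OF B D]
  have *: "D' (a + b) = D' a + D' b \<and> D' (a * b) = D' a * b + a * D' b" for a b
  proof
    let ?p = "P a" and ?q = "Q a" and ?r = "P b" and ?s = "Q b"
    have nz: "?q \<noteq> 0" "?s \<noteq> 0" using PQ by auto
    have a: "a * ?q = ?p" "b * ?s = ?r" using PQ(3,4)[of a] PQ(3,4)[of b] nz
      by (simp_all add: nonzero_eq_divide_eq)
    have "D' (a + b) = val (?p * ?s + ?r * ?q) (?q * ?s)"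
      by (rule wd) (use PQ nz a in \<open>auto simp: ss field_simps\<close>)
    also have "\<dots> = (D ?p * ?s + (a * ?q) * D ?s + (D ?r * ?q + (b * ?s) * D ?q)
        - (a + b) * (D ?q * ?s + ?q * D ?s)) / (?q * ?s)"
    proof -
      have "(?p * ?s + ?r * ?q) / (?q * ?s) = a + b"
        using nz by (simp add: add_divide_distrib flip: PQ(4))
      then show ?thesis unfolding val_def using PQ(1,2) by (simp add: ds ss a)
    qed
    finally have sum: "D' (a + b) = (D ?p * ?s + (a * ?q) * D ?s + (D ?r * ?q + (b * ?s) * D ?q)
        - (a + b) * (D ?q * ?s + ?q * D ?s)) / (?q * ?s)" .
    have "D' (a * b) = val (?p * ?r) (?q * ?s)"
      by (rule wd) (use PQ nz a in \<open>auto simp: ss field_simps\<close>)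
    also have "\<dots> = (D ?p * (b * ?s) + (a * ?q) * D ?r
        - (a * b) * (D ?q * ?s + ?q * D ?s)) / (?q * ?s)"
    proof -
      have "(?p * ?r) / (?q * ?s) = a * b"
        by (simp add: PQ(4)[symmetric] times_divide_times_eq[symmetric])
      then show ?thesis unfolding val_def using PQ(1,2) by (simp add: ds ss a)
    qed
    finally have prod: "D' (a * b) = (D ?p * (b * ?s) + (a * ?q) * D ?r
        - (a * b) * (D ?q * ?s + ?q * D ?s)) / (?q * ?s)" .
    have val: "D' a = (D ?p - a * D ?q) / ?q" "D' b = (D ?r - b * D ?s) / ?s"
      by (simp_all add: D'_def val_def flip: PQ(4))
    show "D' (a + b) = D' a + D' b" "D' (a * b) = D' a * b + a * D' b"
      unfolding sum prod val using nz by (simp_all add: field_simps)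
  qed
  have ext: "D' b = D b" if "b \<in> B" for b
    using wd[of b 1 b] that by (simp add: val_def ss ds)
  have "der D'" using * ext ss ds unfolding der_on_def by simp
  then show thesis using ext that by blast
qed

end

section \<open>Extending a derivation from a ring B to B[z]\<close>

context field_ext
begin

definition coeffs_in :: "'f set \<Rightarrow> 'f poly \<Rightarrow> bool"
  where "coeffs_in B p \<longleftrightarrow> (\<forall>i. coeff p i \<in> B)"

definition adj :: "'f set \<Rightarrow> 'f \<Rightarrow> 'f set"
  where "adj B z = {poly p z |p. coeffs_in B p}"

lemma coeffs_in_simps:
  assumes B: "subring B"
  shows "coeffs_in B 0" "b \<in> B \<Longrightarrow> coeffs_in B [:b:]" "coeffs_in B p \<Longrightarrow> coeffs_in B q \<Longrightarrow> coeffs_in B (p + q)"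
    "coeffs_in B p \<Longrightarrow> coeffs_in B q \<Longrightarrow> coeffs_in B (p * q)"
    "coeffs_in B p \<Longrightarrow> coeffs_in B q \<Longrightarrow> coeffs_in B (p - q)"
    "b \<in> B \<Longrightarrow> coeffs_in B (monom b n)"
    "coeffs_in B p \<Longrightarrow> coeffs_in B (pderiv p)"
proof -
  note ss = subring_simps[OF B]
  have nat: "of_nat n \<in> B" for n using ss(3)[of "of_nat n"] by (simp add: \<kappa>_of_nat)
  show "coeffs_in B (pderiv p)" if "coeffs_in B p"
    using that ss nat by (simp add: coeffs_in_def coeff_pderiv del: of_nat_Suc)
  show "coeffs_in B (p * q)" if "coeffs_in B p" "coeffs_in B q"
    using that unfolding coeffs_in_def coeff_mult by (auto intro!: subring_sum[OF B] ss(5))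
qed (auto simp: coeffs_in_def subring_simps[OF B] coeff_pCons split: nat.splits)

lemma adj_subring:
  assumes B: "subring B"
  shows "subring (adj B z)"
  unfolding subring_def adj_def
proof (intro conjI allI ballI; clarsimp)
  note cs = coeffs_in_simps[OF B]
  show "\<exists>p. \<kappa> c = poly p z \<and> coeffs_in B p" for c
    using B by (intro exI[of _ "[:\<kappa> c:]"]) (simp add: cs subring_simps)
  fix p q assume pq: "coeffs_in B p" "coeffs_in B q"
  show "\<exists>r. poly p z + poly q z = poly r z \<and> coeffs_in B r"
    using pq by (intro exI[of _ "p + q"]) (simp add: cs)
  show "\<exists>r. poly p z * poly q z = poly r z \<and> coeffs_in B r"
    using pq by (intro exI[of _ "p * q"]) (simp add: cs)
qed

lemma adj_base: "subring B \<Longrightarrow> B \<subseteq> adj B z"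
  unfolding adj_def by (auto intro!: exI[of _ "[:_:]"] simp: coeffs_in_simps)

lemma adj_gen: "subring B \<Longrightarrow> z \<in> adj B z"
  unfolding adj_def
  by (auto intro!: exI[of _ "monom 1 1"] simp: coeffs_in_simps subring_simps poly_monom)

text \<open>The only candidate for the value at \<open>p(z)\<close> of an extension of \<open>D\<close> with \<open>z \<mapsto> v\<close>.\<close>

definition der_val :: "('f \<Rightarrow> 'f) \<Rightarrow> 'f \<Rightarrow> 'f \<Rightarrow> 'f poly \<Rightarrow> 'f"
  where "der_val D z v p = poly (map_poly D p) z + poly (pderiv p) z * v"

lemma der_val_simps:
  assumes B: "subring B" and D: "der_on B D" and p: "coeffs_in B p" and q: "coeffs_in B q"
  shows "der_val D z v (p + q) = der_val D z v p + der_val D z v q"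
    and "der_val D z v (p - q) = der_val D z v p - der_val D z v q"
    and "der_val D z v (p * q) = der_val D z v p * poly q z + poly p z * der_val D z v q"
proof -
  note ds = der_on_simps[OF B D]
  have pB: "coeff p i \<in> B" "coeff q i \<in> B" for i using p q by (auto simp: coeffs_in_def)
  have add: "map_poly D (p + q) = map_poly D p + map_poly D q"
    by (rule poly_eqI) (simp add: coeff_map_poly ds pB)
  have diff: "map_poly D (p - q) = map_poly D p - map_poly D q"
    by (rule poly_eqI) (simp add: coeff_map_poly ds pB)
  have mult: "map_poly D (p * q) = map_poly D p * q + p * map_poly D q"
  proof (rule poly_eqI)
    fix n
    have "coeff (map_poly D (p * q)) n = D (\<Sum>i\<le>n. coeff p i * coeff q (n - i))"
      by (simp add: coeff_map_poly ds coeff_mult)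
    also have "\<dots> = (\<Sum>i\<le>n. D (coeff p i * coeff q (n - i)))"
      by (rule der_on_sum[OF B D]) (simp add: pB subring_simps[OF B])
    also have "\<dots> = (\<Sum>i\<le>n. D (coeff p i) * coeff q (n - i) + coeff p i * D (coeff q (n - i)))"
      by (simp add: ds pB)
    also have "\<dots> = coeff (map_poly D p * q + p * map_poly D q) n"
      by (simp add: coeff_mult coeff_map_poly ds sum.distrib)
    finally show "coeff (map_poly D (p * q)) n = coeff (map_poly D p * q + p * map_poly D q) n" .
  qed
  show "der_val D z v (p + q) = der_val D z v p + der_val D z v q"
    "der_val D z v (p - q) = der_val D z v p - der_val D z v q"
    "der_val D z v (p * q) = der_val D z v p * poly q z + poly p z * der_val D z v q"
    unfolding der_val_def add diff mult pderiv_add pderiv_diff pderiv_mult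
    by (simp_all add: algebra_simps)
qed

text \<open>Two polynomials with the same value at \<open>z\<close> differ by a relation of
  \<open>z\<close> over \<open>B\<close>, so the candidate value is well defined as soon as it
  vanishes on relations.\<close>

lemma der_on_adj:
  assumes B: "subring B" and D: "der_on B D"
    and wd: "\<And>p. coeffs_in B p \<Longrightarrow> poly p z = 0 \<Longrightarrow> der_val D z v p = 0"
  obtains D' where "der_on (adj B z) D'" "\<And>b. b \<in> B \<Longrightarrow> D' b = D b" "D' z = v"
proof -
  note cs = coeffs_in_simps[OF B] and ds = der_on_simps[OF B D] and ss = subring_simps[OF B]
  define D' where "D' a = der_val D z v (SOME p. coeffs_in B p \<and> poly p z = a)" for a
  have eq: "D' (poly p z) = der_val D z v p" if p: "coeffs_in B p" for p
  proof -
    define q where "q = (SOME q. coeffs_in B q \<and> poly q z = poly p z)"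
    have q: "coeffs_in B q" "poly q z = poly p z"
      using someI[of "\<lambda>q. coeffs_in B q \<and> poly q z = poly p z" p] p unfolding q_def by auto
    have "der_val D z v (q - p) = 0" using q p by (intro wd) (simp_all add: cs)
    then show ?thesis using der_val_simps(2)[OF B D q(1) p] by (simp add: D'_def q_def)
  qed
  have const: "D' b = D b" if "b \<in> B" for b
    using eq[of "[:b:]"] that by (simp add: cs der_val_def map_poly_pCons ds)
  have "der_on (adj B z) D'"
    unfolding der_on_def
  proof (intro conjI allI ballI)
    show "D' (\<kappa> c) = 0" for c using const ss ds by simp
    fix a b assume "a \<in> adj B z" "b \<in> adj B z"
    then obtain p q where pq: "coeffs_in B p" "coeffs_in B q" "a = poly p z" "b = poly q z"
      by (auto simp: adj_def)
    show "D' (a + b) = D' a + D' b"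
      using eq[of "p + q"] pq der_val_simps(1)[OF B D pq(1,2)] by (simp add: eq cs)
    show "D' (a * b) = D' a * b + a * D' b"
      using eq[of "p * q"] pq der_val_simps(3)[OF B D pq(1,2)] by (simp add: eq cs)
  qed
  moreover have "D' z = v"
    using eq[of "monom 1 1"] by (simp add: cs ss poly_monom der_val_def map_poly_monom ds pderiv_monom)
  ultimately show thesis using const that by blast
qed

text \<open>For algebraic \<open>z\<close> the value \<open>v\<close> is forced by the vanishing of \<open>der_val\<close> at a polynomial
  of minimal degree; characteristic zero makes its derivative nonzero at \<open>z\<close>.\<close>

lemma der_on_adj_exists:
  assumes B: "subring B" and D: "der_on B D"
  obtains D' where "der_on (adj B z) D'" "\<And>b. b \<in> B \<Longrightarrow> D' b = D b"
proof (cases "\<exists>p. coeffs_in B p \<and> p \<noteq> 0 \<and> poly p z = 0")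
  case False
  \<comment> \<open>For transcendental \<open>z\<close> the only relation is the zero polynomial, so
    any value at \<open>z\<close> is admissible; 0 is taken.\<close>
  then have "der_val D z 0 p = 0" if "coeffs_in B p" "poly p z = 0" for p
    using that by (auto simp: der_val_def)
  then show thesis using der_on_adj[OF B D] that by metis
next
  case True
  note cs = coeffs_in_simps[OF B] and ss = subring_simps[OF B]
  obtain m where m: "coeffs_in B m" "m \<noteq> 0" "poly m z = 0"
    and min: "\<And>p. coeffs_in B p \<Longrightarrow> p \<noteq> 0 \<Longrightarrow> poly p z = 0 \<Longrightarrow> degree m \<le> degree p"
    using True ex_has_least_nat[of "\<lambda>p. coeffs_in B p \<and> p \<noteq> 0 \<and> poly p z = 0" _ degree] by metis
  have deg: "degree m \<noteq> 0"
  proof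
    assume "degree m = 0"
    then obtain c where "m = [:c:]" by (rule degree_eq_zeroE)
    then show False using m by simp
  qed
  have "pderiv m \<noteq> 0"
  proof
    assume "pderiv m = 0"
    then have "coeff (pderiv m) (degree m - 1) = 0" by simp
    then show False using deg m(2) by (simp add: coeff_pderiv del: of_nat_Suc)
  qed
  moreover have "degree (pderiv m) < degree m"
  proof -
    have "degree (pderiv m) \<le> degree m - 1"
      by (rule degree_le) (simp add: coeff_pderiv coeff_eq_0 del: of_nat_Suc)
    then show ?thesis using deg by linarith
  qed
  ultimately have nz: "poly (pderiv m) z \<noteq> 0" using min[of "pderiv m"] cs(7)[OF m(1)] by auto
  define v where "v = - poly (map_poly D m) z / poly (pderiv m) z"
  have vm: "der_val D z v m = 0" using nz by (simp add: der_val_def v_def)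
  have "coeffs_in B p \<Longrightarrow> poly p z = 0 \<Longrightarrow> der_val D z v p = 0" for p
  proof (induction "degree p" arbitrary: p rule: less_induct)
    case less
    show ?case
    proof (cases "p = 0")
      case True then show ?thesis by (simp add: der_val_def)
    next
      case False
      then have le: "degree m \<le> degree p" using min less.prems by blast
      let ?a = "lead_coeff m" and ?t = "monom (lead_coeff p) (degree p - degree m)"
      have lc: "?a \<in> B" "lead_coeff p \<in> B" using m(1) less.prems by (auto simp: coeffs_in_def)
      \<comment> \<open>\<open>B\<close> is only a ring, so this is pseudo-division:
        \<open>p\<close> is multiplied by the leading coefficient of \<open>m\<close> before its top
        term is cancelled.\<close>
      define q where "q = [:?a:] * p - ?t * m"
      have cq: "coeffs_in B ([:?a:] * p)" "coeffs_in B (?t * m)" "coeffs_in B [:?a:]" "coeffs_in B ?t"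
        using lc m(1) less.prems by (simp_all add: cs del: mult_pCons_left)
      have q: "coeffs_in B q" "poly q z = 0"
        using cq less.prems m(3) unfolding q_def by (simp_all add: cs del: mult_pCons_left)
      have "der_val D z v q = 0"
      proof (cases "q = 0")
        case True then show ?thesis by (simp add: der_val_def)
      next
        case False
        have "degree q < degree p"
        proof -
          have dp: "degree p \<noteq> 0" using le deg by simp
          have "degree q \<le> degree p"
            unfolding q_def
          proof (rule degree_diff_le)
            show "degree ([:?a:] * p) \<le> degree p" by simp
            show "degree (?t * m) \<le> degree p"
              using degree_mult_le[of ?t m] degree_monom_le[of "lead_coeff p" "degree p - degree m"] le
              by linarith
          qed
          moreover have "coeff q (degree p) = 0"
            using le coeff_monom_mult[of "lead_coeff p" "degree p - degree m" m "degree p"]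
            by (simp add: q_def mult.commute)
          ultimately show ?thesis using dp False
            by (metis leading_coeff_0_iff le_neq_implies_less)
        qed
        then show ?thesis using less.hyps q by blast
      qed
      \<comment> \<open>All other Leibniz terms vanish: \<open>p\<close> and \<open>m\<close> are
        zero at \<open>z\<close>, and \<open>v\<close> was chosen so that \<open>der_val\<close>
        kills \<open>m\<close>.\<close>
      moreover have "der_val D z v q = ?a * der_val D z v p"
        unfolding q_def using der_val_simps(2)[OF B D cq(1,2)]
          der_val_simps(3)[OF B D cq(3) less.prems(1)] der_val_simps(3)[OF B D cq(4) m(1)]
        by (simp add: vm m(3) less.prems(2) del: mult_pCons_left)
      ultimately show ?thesis using m(2) by simp
    qed
  qed
  then show thesis using der_on_adj[OF B D] that by metis
qed

lemma der_on_adjoin_finite: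
  assumes "finite Z" and B: "subring B" and D: "der_on B D"
  shows "\<exists>B' D'. subring B' \<and> B \<subseteq> B' \<and> Z \<subseteq> B' \<and> der_on B' D' \<and> (\<forall>b\<in>B. D' b = D b)"
  using assms(1)
proof induction
  case empty then show ?case using B D by blast
next
  case (insert z Z)
  then obtain B' D' where 1: "subring B'" "B \<subseteq> B'" "Z \<subseteq> B'" "der_on B' D'" "\<forall>b\<in>B. D' b = D b"
    by blast
  obtain D'' where "der_on (adj B' z) D''" "\<And>b. b \<in> B' \<Longrightarrow> D'' b = D' b"
    using der_on_adj_exists[OF 1(1,4)] by metis
  then show ?case using 1 adj_subring[OF 1(1)] adj_base[OF 1(1), of z] adj_gen[OF 1(1), of z]
    by (intro exI[of _ "adj B' z"] exI[of _ D'']) auto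
qed

end

section \<open>Derivations of a field generated by finitely many elements\<close>

locale fg_field = field_ext \<kappa> x
  for \<kappa> :: "'k::field_char_0 \<Rightarrow> 'f::field" and x :: "'n::finite \<Rightarrow> 'f" +
  assumes frac: "\<exists>p\<in>polys UNIV. \<exists>q\<in>polys UNIV. q \<noteq> 0 \<and> z = p / q"
begin

lemma der_eqI:
  assumes "der D" "der D'" "\<And>j. D (x j) = D' (x j)"
  shows "D z = D' z"
proof -
  obtain p q where *: "p \<in> polys UNIV" "q \<in> polys UNIV" "q \<noteq> 0" "z = p / q" using frac by blast
  then show ?thesis using der_eq_on_polys[OF assms] assms by (simp add: der_divide)
qed

text \<open>After the finitely many generators have been adjoined to \<open>B\<close>, the fractions
  of the resulting ring exhaust the field, and the quotient rule finishes.\<close>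

lemma der_extends:
  assumes B: "subring B" and D: "der_on B D"
  obtains D' where "der D'" "\<And>b. b \<in> B \<Longrightarrow> D' b = D b"
proof -
  obtain B' D' where 1: "subring B'" "B \<subseteq> B'" "range x \<subseteq> B'" "der_on B' D'" "\<forall>b\<in>B. D' b = D b"
    using der_on_adjoin_finite[OF _ B D, of "range x"] by auto
  have "polys UNIV \<subseteq> B'" by (rule polys_minimal[OF 1(1)]) (use 1 in auto)
  then have "\<exists>p\<in>B'. \<exists>q\<in>B'. q \<noteq> 0 \<and> z = p / q" for z using frac[of z] by blast
  then obtain D'' where "der D''" "\<And>b. b \<in> B' \<Longrightarrow> D'' b = D' b"
    using der_on_fraction_extension[OF 1(1,4)] by metis
  then show thesis using that 1 by (metis subsetD)
qed

lemma algebraic_if_no_derivation: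
  assumes J: "\<And>D z. der D \<Longrightarrow> (\<forall>j\<in>J. D (x j) = 0) \<Longrightarrow> D z = 0"
  shows "\<exists>p. p \<noteq> 0 \<and> coeffs_in (polys J) p \<and> poly p z = 0"
proof (rule ccontr)
  assume none: "\<not> ?thesis"
  have D: "der_on (polys J) (\<lambda>_. 0)" by (simp add: der_on_def)
  \<comment> \<open>With no relation to respect, the zero derivation may be extended by the value 1
    at \<open>z\<close>.\<close>
  have "der_val (\<lambda>_. 0) z 1 p = 0" if "coeffs_in (polys J) p" "poly p z = 0" for p
    using none that by (auto simp: der_val_def)
  then obtain D1 where D1: "der_on (adj (polys J) z) D1" "\<And>b. b \<in> polys J \<Longrightarrow> D1 b = 0" "D1 z = 1"
    using der_on_adj[OF subring_polys D] by metis
  obtain D2 where D2: "der D2" "\<And>b. b \<in> adj (polys J) z \<Longrightarrow> D2 b = D1 b"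
    using der_extends[OF adj_subring[OF subring_polys] D1(1)] by metis
  have "D2 (x j) = 0" if "j \<in> J" for j
    using D2(2) D1(2) x_in_polys[OF that] adj_base[OF subring_polys] by (metis subsetD)
  then have "D2 z = 0" using J D2(1) by blast
  then show False using D2(2) D1(3) adj_gen[OF subring_polys] by simp
qed

end

section \<open>Growth of finitely generated subalgebras\<close>

context field_ext
begin

text \<open>The \<open>polys J\<close>-submodule of the field generated by \<open>E\<close>, written
  as a K-span so that bilinear induction applies to it.\<close>

definition poly_span :: "'n set \<Rightarrow> 'f set \<Rightarrow> 'f set"
  where "poly_span J E = ks.span {r * u |r u. r \<in> polys J \<and> u \<in> E}"

lemma poly_span_mult:
  assumes "r \<in> polys J" "u \<in> poly_span J E"
  shows "r * u \<in> poly_span J E"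
  unfolding poly_span_def
proof (rule alg.mul_span_right[OF assms(2)[unfolded poly_span_def]])
  fix w assume "w \<in> {r * u |r u. r \<in> polys J \<and> u \<in> E}"
  then obtain s u where su: "w = s * u" "s \<in> polys J" "u \<in> E" by blast
  then have "r * w = (r * s) * u" "r * s \<in> polys J"
    using assms(1) subring_simps(5)[OF subring_polys] by (auto simp: mult.assoc)
  then show "r * w \<in> ks.span {r * u |r u. r \<in> polys J \<and> u \<in> E}"
    using su by (intro ks.span_base) blast
qed auto

lemma poly_span_base: "u \<in> E \<Longrightarrow> u \<in> poly_span J E"
  unfolding poly_span_def
  by (rule ks.span_base) (use subring_simps(2)[OF subring_polys] in force)

lemma poly_span_sum: "(\<And>i. i \<in> I \<Longrightarrow> g i \<in> poly_span J E) \<Longrightarrow> sum g I \<in> poly_span J E"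
  unfolding poly_span_def by (rule ks.span_sum)

lemma poly_span_image:
  assumes "u \<in> poly_span J E" "\<And>e. e \<in> E \<Longrightarrow> e * z \<in> poly_span J E'"
  shows "u * z \<in> poly_span J E'"
proof (rule alg.mul_span_left[OF assms(1)[unfolded poly_span_def]])
  fix w assume "w \<in> {r * u |r u. r \<in> polys J \<and> u \<in> E}"
  then obtain s u where su: "w = s * u" "s \<in> polys J" "u \<in> E" by blast
  then show "w * z \<in> poly_span J E'"
    using poly_span_mult[OF su(2) assms(2)[OF su(3)]] by (simp add: mult.assoc)
qed (auto simp: poly_span_def)

text \<open>The elements of \<open>W\<close> are algebraic but not integral, so a finite module
  stable under them exists only up to a denominator. Adjoining \<open>z\<close> of degree
  \<open>m\<close> replaces \<open>E\<close> by its products with \<open>z ^ j\<close> for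
  \<open>j < m\<close>, and \<open>h\<close> absorbs the leading coefficient of the
  relation.\<close>

lemma algebraic_common_module:
  assumes alg: "\<And>z. \<exists>p. p \<noteq> 0 \<and> coeffs_in (polys J) p \<and> poly p z = 0"
    and W: "finite W"
  shows "\<exists>E h. finite E \<and> 1 \<in> E \<and> h \<in> polys J \<and> h \<noteq> 0 \<and>
    (\<forall>w\<in>W. \<forall>e\<in>E. h * w * e \<in> poly_span J E)"
  using W
proof induction
  case empty
  show ?case by (intro exI[of _ "{1}"] exI[of _ 1]) (simp add: subring_simps[OF subring_polys])
next
  case (insert z W)
  note ss = subring_simps[OF subring_polys[of J]]
  obtain E h where E: "finite E" "1 \<in> E" "h \<in> polys J" "h \<noteq> 0"
    "\<And>w e. w \<in> W \<Longrightarrow> e \<in> E \<Longrightarrow> h * w * e \<in> poly_span J E" using insert.IH by blast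
  obtain p where p: "p \<noteq> 0" "coeffs_in (polys J) p" "poly p z = 0" using alg by blast
  define m where "m = degree p"
  define l where "l = lead_coeff p"
  have m: "m \<noteq> 0"
  proof
    assume "m = 0"
    then obtain c where "p = [:c:]" unfolding m_def by (rule degree_eq_zeroE)
    then show False using p by simp
  qed
  have c: "coeff p i \<in> polys J" for i using p(2) by (simp add: coeffs_in_def)
  have l: "l \<in> polys J" "l \<noteq> 0" using c p(1) by (auto simp: l_def)
  have top: "l * z ^ m = (\<Sum>i<m. - coeff p i * z ^ i)"
  proof -
    have "0 = (\<Sum>i\<le>m. coeff p i * z ^ i)" using p(3) by (simp add: poly_altdef m_def)
    also have "{..m} = insert m {..<m}" by auto
    finally show ?thesis by (simp add: l_def m_def sum_negf add_eq_0_iff)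
  qed
  define E' where "E' = (\<lambda>(e, j). e * z ^ j) ` (E \<times> {..<m})"
  have E'I: "e * z ^ j \<in> E'" if "e \<in> E" "j < m" for e j using that by (auto simp: E'_def)
  have "finite E'" using E(1) by (simp add: E'_def)
  moreover have "1 \<in> E'" using E'I[OF E(2), of 0] m by simp
  moreover have "h * l \<in> polys J" "h * l \<noteq> 0" using E l ss by auto
  moreover have "(h * l) * w * e' \<in> poly_span J E'" if w: "w \<in> insert z W" and e': "e' \<in> E'" for w e'
  proof -
    obtain e j where e: "e' = e * z ^ j" "e \<in> E" "j < m" using e' by (auto simp: E'_def)
    \<comment> \<open>Multiplication by \<open>z\<close> either stays among the listed powers or
      reaches \<open>z ^ m\<close>, where \<open>top\<close> rewrites it.\<close>
    consider "w \<in> W" | "w = z" "Suc j < m" | "w = z" "Suc j = m" using w e(3) by fastforce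
    then show ?thesis
    proof cases
      case 1
      have "(h * w * e) * z ^ j \<in> poly_span J E'"
        by (rule poly_span_image[OF E(5)[OF 1 e(2)]]) (use e E'I poly_span_base in auto)
      from poly_span_mult[OF l(1) this] show ?thesis by (simp add: e(1) mult_ac)
    next
      case 2
      have "(h * l) * (e * z ^ Suc j) \<in> poly_span J E'"
        by (intro poly_span_mult poly_span_base E'I) (use E l ss e 2 in auto)
      then show ?thesis by (simp add: e(1) 2 mult_ac)
    next
      case 3
      have "(h * l) * w * e' = h * e * (l * z ^ m)" by (simp add: e(1) 3 mult_ac flip: 3(2))
      also have "\<dots> = (\<Sum>i<m. (h * - coeff p i) * (e * z ^ i))"
        unfolding top by (simp add: sum_distrib_left mult_ac)
      also have "\<dots> \<in> poly_span J E'"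
        by (intro poly_span_sum poly_span_mult poly_span_base E'I ss(5,6)) (use E c e in auto)
      finally show ?thesis .
    qed
  qed
  ultimately show ?case by blast
qed

definition bounded_span :: "'n set \<Rightarrow> 'f set \<Rightarrow> nat \<Rightarrow> 'f set"
  where "bounded_span J E M = ks.span {mon \<beta> * u |\<beta> u. \<beta> \<in> multi_indices J M \<and> u \<in> E}"

lemma subspace_bounded_span: "ks.subspace (bounded_span J E M)"
  by (simp add: bounded_span_def)

lemma bounded_span_mono: "M \<le> N \<Longrightarrow> bounded_span J E M \<subseteq> bounded_span J E N"
  unfolding bounded_span_def using multi_indices_mono[of M N J] by (intro ks.span_mono) blast

lemma mon_bounded_span:
  assumes "\<beta> \<in> multi_indices J M" "u \<in> bounded_span J E N"
  shows "mon \<beta> * u \<in> bounded_span J E (M + N)"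
proof (rule alg.mul_span_right[OF assms(2)[unfolded bounded_span_def]])
  fix w assume "w \<in> {mon \<beta> * u |\<beta> u. \<beta> \<in> multi_indices J N \<and> u \<in> E}"
  then obtain \<gamma> u where w: "w = mon \<gamma> * u" "\<gamma> \<in> multi_indices J N" "u \<in> E" by blast
  then have "mon \<beta> * w = mon (\<beta> + \<gamma>) * u" "\<beta> + \<gamma> \<in> multi_indices J (M + N)"
    using assms(1) by (auto simp: multi_indices_def mult.assoc)
  then show "mon \<beta> * w \<in> bounded_span J E (M + N)"
    unfolding bounded_span_def using w(3) by (intro ks.span_base) blast
qed (auto simp: subspace_bounded_span)

lemma bounded_span_mult:
  assumes a: "a \<in> bounded_span J {1} M" and u: "u \<in> bounded_span J E N"
  shows "a * u \<in> bounded_span J E (M + N)"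
proof (rule alg.mul_span_left[OF a[unfolded bounded_span_def]])
  fix w assume "w \<in> {mon \<beta> * u |\<beta> u. \<beta> \<in> multi_indices J M \<and> u \<in> {1}}"
  then show "w * u \<in> bounded_span J E (M + N)" using mon_bounded_span u by auto
qed (auto simp: subspace_bounded_span)

lemma poly_span_bounded:
  assumes "u \<in> poly_span J E"
  shows "\<exists>M. u \<in> bounded_span J E M"
proof -
  have poly: "\<exists>M. r \<in> bounded_span J {1} M" if "r \<in> polys J" for r
    using that unfolding polys_def
  proof (induction rule: ks.span_induct_alt)
    case base show ?case using ks.span_zero unfolding bounded_span_def by blast
  next
    case (step c y r)
    then obtain \<beta> M where *: "y = mon \<beta>" "set_mset \<beta> \<subseteq> J" "r \<in> bounded_span J {1} M" by blast
    have "y \<in> bounded_span J {1} (size \<beta> + M)"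
      unfolding bounded_span_def using * by (intro ks.span_base) (auto simp: multi_indices_def)
    moreover have "r \<in> bounded_span J {1} (size \<beta> + M)"
      using *(3) bounded_span_mono[of M "size \<beta> + M" J "{1}"] by auto
    ultimately show ?case using ks.subspace_add ks.subspace_scale subspace_bounded_span by metis
  qed
  show ?thesis
    using assms unfolding poly_span_def
  proof (induction rule: ks.span_induct_alt)
    case base show ?case using ks.span_zero unfolding bounded_span_def by blast
  next
    case (step c y u)
    then obtain r e M N where *: "y = r * e" "e \<in> E" "r \<in> bounded_span J {1} M" "u \<in> bounded_span J E N"
      using poly by blast
    have "mon {#} * e \<in> bounded_span J E 0"
      unfolding bounded_span_def using *(2)
      by (intro ks.span_base) (auto simp: multi_indices_def intro!: exI[of _ "{#}"])
    then have "y \<in> bounded_span J E (M + N)"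
      using bounded_span_mult[OF *(3), of e E 0] bounded_span_mono[of M "M + N" J E] *(1) by auto
    moreover have "u \<in> bounded_span J E (M + N)"
      using *(4) bounded_span_mono[of N "M + N" J E] by auto
    ultimately show ?case using ks.subspace_add ks.subspace_scale subspace_bounded_span by metis
  qed
qed

text \<open>With \<open>h\<close> and \<open>E\<close> as in \<open>algebraic_common_module\<close>, the filtration satisfies
  \<open>h\<^sup>N W\<^sup>N \<subseteq> \<Sum>\<^sub>e P\<^sub>N\<^sub>D e\<close>, where \<open>P\<^sub>N\<^sub>D\<close> is the space of polynomials of degree at most \<open>ND\<close>.\<close>

lemma growth_bound:
  assumes alg: "\<And>z. \<exists>p. p \<noteq> 0 \<and> coeffs_in (polys J) p \<and> poly p z = 0"
    and W: "finite W"
  shows "\<exists>C. \<forall>N. \<exists>S. finite S \<and> card S \<le> C * (N + 1) ^ card J \<and> alg.filt W N \<subseteq> ks.span S"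
proof -
  obtain E h where E: "finite E" "1 \<in> E" "h \<in> polys J" "h \<noteq> 0"
    "\<And>w e. w \<in> W \<Longrightarrow> e \<in> E \<Longrightarrow> h * w * e \<in> poly_span J E"
    using algebraic_common_module[OF alg W] by blast
  have "h \<in> poly_span J {1}" using poly_span_mult[OF E(3) poly_span_base[of 1 "{1}"]] by simp
  then obtain M0 where M0: "h \<in> bounded_span J {1} M0" using poly_span_bounded by blast
  have "\<forall>q\<in>W \<times> E. \<exists>M. h * fst q * snd q \<in> bounded_span J E M"
    using E(5) poly_span_bounded by force
  then obtain f where f: "\<And>q. q \<in> W \<times> E \<Longrightarrow> h * fst q * snd q \<in> bounded_span J E (f q)" by metis
  \<comment> \<open>One degree bound for \<open>h\<close> and for all products
    \<open>h * w * e\<close>; the sum stands in for a maximum.\<close>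
  define D where "D = M0 + sum f (W \<times> E)"
  have D: "h * w * e \<in> bounded_span J E D" if "w \<in> W" "e \<in> E" for w e
  proof -
    have "f (w, e) \<le> sum f (W \<times> E)" by (rule member_le_sum) (use that W E(1) in auto)
    then have "bounded_span J E (f (w, e)) \<subseteq> bounded_span J E D"
      by (intro bounded_span_mono) (simp add: D_def)
    then show ?thesis using f[of "(w, e)"] that by auto
  qed
  have hD: "h \<in> bounded_span J {1} D"
    using M0 bounded_span_mono[of M0 D J "{1}"] by (auto simp: D_def)
  define T where "T N = {u. h ^ N * u \<in> bounded_span J E (N * D)}" for N
  have "alg.filt W N \<subseteq> T N" for N
  proof (rule alg.filt_minimal)
    show "ks.subspace (T N)" for N
      using subspace_bounded_span[of J E "N * D"] unfolding T_def ks.subspace_def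
      by (auto simp: distrib_left ks_def mult.left_commute)
    \<comment> \<open>Monotonicity costs further powers of \<open>h\<close>, each of degree at most
      \<open>D\<close>; this is why \<open>D\<close> includes \<open>M0\<close>.\<close>
    show "T M \<subseteq> T N" if "M \<le> N" for M N
    proof
      fix u assume u: "u \<in> T M"
      have "h ^ k * (h ^ M * u) \<in> bounded_span J E (k * D + M * D)" for k
      proof (induction k)
        case 0 then show ?case using u by (simp add: T_def)
      next
        case (Suc k) then show ?case using bounded_span_mult[OF hD Suc] by (simp add: mult_ac add_ac)
      qed
      from this[of "N - M"] show "u \<in> T N" using that
        by (simp add: T_def mult.assoc[symmetric] flip: power_add add_mult_distrib)
    qed
    have "mon {#} * 1 \<in> bounded_span J E 0"
      unfolding bounded_span_def using E(2) by (intro ks.span_base) (force simp: multi_indices_def)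
    then show "1 \<in> T 0" by (simp add: T_def)
    fix N u w assume u: "u \<in> T N" and w: "w \<in> W"
    have "(h ^ N * u) * (h * w) \<in> bounded_span J E (N * D + D)"
    proof (rule alg.mul_span_left[of "h ^ N * u"])
      show "h ^ N * u \<in> ks.span {mon \<beta> * u |\<beta> u. \<beta> \<in> multi_indices J (N * D) \<and> u \<in> E}"
        using u by (simp add: T_def bounded_span_def)
      fix y assume "y \<in> {mon \<beta> * u |\<beta> u. \<beta> \<in> multi_indices J (N * D) \<and> u \<in> E}"
      then obtain \<beta> e where y: "y = mon \<beta> * e" "\<beta> \<in> multi_indices J (N * D)" "e \<in> E" by blast
      have "mon \<beta> * (h * w * e) \<in> bounded_span J E (N * D + D)"
        by (rule mon_bounded_span[OF y(2) D[OF w y(3)]])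
      then show "y * (h * w) \<in> bounded_span J E (N * D + D)" by (simp add: y(1) mult_ac)
    qed (auto simp: subspace_bounded_span)
    then show "u * w \<in> T (Suc N)" by (simp add: T_def mult_ac add_ac)
  qed simp
  define S where "S N = (\<lambda>(\<beta>, e). mon \<beta> * e / h ^ N) ` (multi_indices J (N * D) \<times> E)" for N
  have "finite (S N) \<and> card (S N) \<le> ((D + 1) ^ card J * card E) * (N + 1) ^ card J
    \<and> alg.filt W N \<subseteq> ks.span (S N)" for N
  proof (intro conjI)
    show "finite (S N)" using E(1) by (simp add: S_def multi_indices_finite_card)
    have "card (S N) \<le> card (multi_indices J (N * D) \<times> E)"
      unfolding S_def by (rule card_image_le) (use E(1) in \<open>simp add: multi_indices_finite_card\<close>)
    also have "\<dots> \<le> (N * D + 1) ^ card J * card E"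
      by (simp add: card_cartesian_product multi_indices_finite_card(2)[of J "N * D", simplified])
    also have "\<dots> \<le> ((D + 1) * (N + 1)) ^ card J * card E"
      by (intro mult_right_mono power_mono) (auto simp: algebra_simps)
    finally show "card (S N) \<le> ((D + 1) ^ card J * card E) * (N + 1) ^ card J"
      by (simp only: power_mult_distrib mult_ac)
    show "alg.filt W N \<subseteq> ks.span (S N)"
    proof
      fix u assume "u \<in> alg.filt W N"
      then have "h ^ N * u \<in> bounded_span J E (N * D)" using \<open>alg.filt W N \<subseteq> T N\<close> by (auto simp: T_def)
      then have "(h ^ N * u) * (1 / h ^ N) \<in> ks.span (S N)"
        unfolding bounded_span_def
        by (rule alg.mul_span_left) (auto simp: S_def intro!: ks.span_base rev_image_eqI)
      then show "u \<in> ks.span (S N)" using E(4) by simp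
    qed
  qed
  then show ?thesis by blast
qed

end

section \<open>Commuting frames\<close>

context field_ext
begin

lemma der_zero: "der (\<lambda>_. 0)"
  by (simp add: der_on_def)

lemma der_add: "der D \<Longrightarrow> der E \<Longrightarrow> der (\<lambda>z. D z + E z)"
  by (simp add: der_on_def algebra_simps)

lemma der_scale: "der D \<Longrightarrow> der (\<lambda>z. a * D z)"
  by (simp add: der_on_def algebra_simps)

lemma der_sum_fun: "(\<And>i. i \<in> I \<Longrightarrow> der (D i)) \<Longrightarrow> der (\<lambda>z. \<Sum>i\<in>I. D i z)"
  by (induction I rule: infinite_finite_induct) (auto simp: der_zero der_add)

lemma der_commutator:
  assumes "der D" "der E"
  shows "der (\<lambda>z. D (E z) - E (D z))"
  unfolding der_on_def
  by (simp add: der_simps[OF assms(1)] der_simps[OF assms(2)] algebra_simps)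

end

text \<open>Outside \<open>J\<close> the frame is zero, so commutation and stability statements can
  range over all indices without side conditions.\<close>

locale frame = fg_field \<kappa> x for \<kappa> :: "'k::field_char_0 \<Rightarrow> 'f::field" and x :: "'n::finite \<Rightarrow> 'f" +
  fixes J :: "'n set" and dd :: "'n \<Rightarrow> 'f \<Rightarrow> 'f"
  assumes dd_der: "der (dd k)"
    and dd_zero: "k \<notin> J \<Longrightarrow> dd k z = 0"
    and dd_comm: "dd k (dd l z) = dd l (dd k z)"
    and dd_x: "k \<in> J \<Longrightarrow> l \<in> J \<Longrightarrow> dd k (x l) = (if k = l then 1 else 0)"
begin

text \<open>The fold over an unordered multiset is meaningful because the frame commutes.\<close>

definition Dm :: "'n multiset \<Rightarrow> 'f \<Rightarrow> 'f"
  where "Dm \<alpha> = fold_mset (\<lambda>k g. dd k \<circ> g) id \<alpha>"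

lemma Dm_empty [simp]: "Dm {#} z = z"
  by (simp add: Dm_def)

lemma Dm_add: "Dm (add_mset k \<alpha>) z = dd k (Dm \<alpha> z)"
proof -
  interpret comp_fun_commute "\<lambda>k g. dd k \<circ> g"
    by unfold_locales (simp add: fun_eq_iff dd_comm)
  show ?thesis by (simp add: Dm_def)
qed

lemma Dm_add_right: "Dm (add_mset k \<alpha>) z = Dm \<alpha> (dd k z)"
proof (induction \<alpha>)
  case (add l \<alpha>)
  have "Dm (add_mset k (add_mset l \<alpha>)) z = dd l (Dm (add_mset k \<alpha>) z)"
    by (simp add: add_mset_commute[of k l] Dm_add)
  then show ?case using add by (simp add: Dm_add)
qed (simp add: Dm_add)

lemma Dm_0: "Dm \<alpha> 0 = 0"
  by (induction \<alpha>) (simp_all add: Dm_add der_simps(2)[OF dd_der])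

lemma Dm_sum: "Dm \<alpha> (sum g I) = (\<Sum>i\<in>I. Dm \<alpha> (g i))"
  by (induction \<alpha>) (simp_all add: Dm_add der_sum[OF dd_der])

lemma Dm_ks: "Dm \<alpha> (ks c z) = ks c (Dm \<alpha> z)"
  by (induction \<alpha>) (simp_all add: Dm_add der_ks[OF dd_der])

lemma Dm_of_nat: "Dm \<alpha> (of_nat n * z) = of_nat n * Dm \<alpha> z"
  by (induction \<alpha>) (simp_all add: Dm_add der_of_nat[OF dd_der])

lemma dd_mon:
  assumes "k \<in> J"
  shows "set_mset \<gamma> \<subseteq> J \<Longrightarrow> dd k (mon \<gamma>) = of_nat (count \<gamma> k) * mon (\<gamma> - {#k#})"
proof (induction \<gamma>)
  case empty
  then show ?case using der_simps(3)[OF dd_der] by simp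
next
  case (add l \<gamma>)
  then have l: "l \<in> J" "set_mset \<gamma> \<subseteq> J" by auto
  have "dd k (mon (add_mset l \<gamma>)) = dd k (x l) * mon \<gamma> + x l * dd k (mon \<gamma>)"
    by (simp add: der_simps(5)[OF dd_der])
  also have "\<dots> = (if k = l then 1 else 0) * mon \<gamma> + of_nat (count \<gamma> k) * (x l * mon (\<gamma> - {#k#}))"
    using add.IH[OF l(2)] dd_x[OF assms l(1)] by (simp add: mult_ac)
  also have "\<dots> = of_nat (count (add_mset l \<gamma>) k) * mon (add_mset l \<gamma> - {#k#})"
  proof (cases "k \<in># \<gamma>")
    case True
    then obtain \<gamma>' where "\<gamma> = add_mset k \<gamma>'" by (meson mset_add)
    then show ?thesis by (auto simp: algebra_simps)
  next
    case False
    then show ?thesis by (auto simp: not_in_iff)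
  qed
  finally show ?case .
qed

text \<open>Triangularity: a monomial of derivations whose order is at least the degree of
  \<open>\<gamma>\<close> kills \<open>mon \<gamma>\<close> unless the exponents agree. In that case
  a product of factorials remains, nonzero in characteristic zero; its exact value is left open as
  \<open>c\<close>.\<close>

lemma Dm_mon:
  assumes "set_mset \<alpha> \<subseteq> J" "set_mset \<gamma> \<subseteq> J" "size \<gamma> \<le> size \<alpha>"
  shows "\<exists>c::nat. c \<noteq> 0 \<and> Dm \<alpha> (mon \<gamma>) = (if \<alpha> = \<gamma> then of_nat c else 0)"
  using assms
proof (induction \<alpha> arbitrary: \<gamma>)
  case empty
  then show ?case by (intro exI[of _ 1]) auto
next
  case (add k \<alpha>)
  have eq: "Dm (add_mset k \<alpha>) (mon \<gamma>) = of_nat (count \<gamma> k) * Dm \<alpha> (mon (\<gamma> - {#k#}))"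
    using add.prems by (simp add: Dm_add_right dd_mon Dm_of_nat)
  show ?case
  proof (cases "k \<in># \<gamma>")
    case False
    then show ?thesis using eq by (intro exI[of _ 1]) (auto simp: not_in_iff)
  next
    case True
    then obtain \<gamma>' where \<gamma>: "\<gamma> = add_mset k \<gamma>'" by (meson mset_add)
    obtain c :: nat where "c \<noteq> 0" "Dm \<alpha> (mon \<gamma>') = (if \<alpha> = \<gamma>' then of_nat c else 0)"
      using add.IH[of \<gamma>'] add.prems \<gamma> by auto
    then show ?thesis using eq \<gamma> by (intro exI[of _ "count \<gamma> k * c"]) (auto simp: algebra_simps)
  qed
qed

text \<open>Among the terms with nonzero coefficient choose one of largest degree and apply its
  \<open>Dm\<close>: by triangularity no other term survives.\<close>

lemma mon_independent:
  assumes fin: "finite Bs" and J: "\<And>\<beta>. \<beta> \<in> Bs \<Longrightarrow> set_mset \<beta> \<subseteq> J"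
    and sum: "(\<Sum>\<beta>\<in>Bs. ks (c \<beta>) (mon \<beta>)) = 0" and \<beta>: "\<beta> \<in> Bs"
  shows "c \<beta> = 0"
proof (rule ccontr)
  assume nz: "c \<beta> \<noteq> 0"
  let ?N = "{\<beta> \<in> Bs. c \<beta> \<noteq> 0}"
  have "finite (size ` ?N)" "size ` ?N \<noteq> {}" using fin \<beta> nz by auto
  then obtain \<alpha> where \<alpha>: "\<alpha> \<in> ?N" "size \<alpha> = Max (size ` ?N)" using Max_in by (metis (no_types, lifting) imageE)
  have max: "size \<gamma> \<le> size \<alpha>" if "\<gamma> \<in> ?N" for \<gamma> using \<alpha>(2) that fin by simp
  have "0 = (\<Sum>\<beta>\<in>Bs. ks (c \<beta>) (Dm \<alpha> (mon \<beta>)))"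
    using arg_cong[OF sum, of "Dm \<alpha>"] by (simp add: Dm_sum Dm_ks Dm_0)
  also have "\<dots> = (\<Sum>\<beta>\<in>{\<alpha>}. ks (c \<beta>) (Dm \<alpha> (mon \<beta>)))"
  proof (rule sum.mono_neutral_right[OF fin], use \<alpha> in blast, rule ballI)
    fix \<gamma> assume "\<gamma> \<in> Bs - {\<alpha>}"
    then show "ks (c \<gamma>) (Dm \<alpha> (mon \<gamma>)) = 0"
      using Dm_mon[of \<alpha> \<gamma>] J max[of \<gamma>] \<alpha>(1) by (cases "c \<gamma> = 0") (auto simp: ks_def)
  qed
  finally show False using Dm_mon[of \<alpha> \<alpha>] J[of \<alpha>] \<alpha>(1) by (auto simp: ks_def)
qed

text \<open>Dual to the independence of monomials: here the coefficients are arbitrary field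
  elements, and evaluation at the monomial of an index of least order isolates one of them. The test
  elements are monomials in the generators, so they come from the algebra and can be fed to
  operators on it.\<close>

lemma Dm_independent:
  assumes fin: "finite T" and J: "\<And>\<alpha>. \<alpha> \<in> T \<Longrightarrow> set_mset \<alpha> \<subseteq> J"
    and sum: "\<And>\<gamma>. (\<Sum>\<alpha>\<in>T. a \<alpha> * Dm \<alpha> (mon \<gamma>)) = 0" and \<beta>: "\<beta> \<in> T"
  shows "a \<beta> = 0"
proof (rule ccontr)
  assume nz: "a \<beta> \<noteq> 0"
  obtain \<alpha> where \<alpha>: "\<alpha> \<in> T" "a \<alpha> \<noteq> 0"
    and min: "\<And>\<gamma>. \<gamma> \<in> T \<Longrightarrow> a \<gamma> \<noteq> 0 \<Longrightarrow> size \<alpha> \<le> size \<gamma>"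
    using ex_has_least_nat[of "\<lambda>\<alpha>. \<alpha> \<in> T \<and> a \<alpha> \<noteq> 0" \<beta> size] \<beta> nz by blast
  have "0 = (\<Sum>\<beta>\<in>T. a \<beta> * Dm \<beta> (mon \<alpha>))" using sum by simp
  also have "\<dots> = (\<Sum>\<beta>\<in>{\<alpha>}. a \<beta> * Dm \<beta> (mon \<alpha>))"
  proof (rule sum.mono_neutral_right[OF fin], use \<alpha> in blast, rule ballI)
    fix \<gamma> assume "\<gamma> \<in> T - {\<alpha>}"
    then show "a \<gamma> * Dm \<gamma> (mon \<alpha>) = 0"
      using Dm_mon[of \<gamma> \<alpha>] J min[of \<gamma>] \<alpha>(1) by (cases "a \<gamma> = 0") auto
  qed
  finally show False using Dm_mon[of \<alpha> \<alpha>] J[of \<alpha>] \<alpha> by auto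
qed

end

text \<open>The commutator of two elements of a coordinate frame vanishes on the coordinates, so it is zero.\<close>

lemma (in fg_field) frame_exists:
  fixes L :: "('f \<Rightarrow> 'f) set"
  assumes der: "\<And>D. D \<in> L \<Longrightarrow> der D" and zero: "(\<lambda>_. 0) \<in> L"
    and add: "\<And>D E. D \<in> L \<Longrightarrow> E \<in> L \<Longrightarrow> (\<lambda>z. D z + E z) \<in> L"
    and scale: "\<And>D a. D \<in> L \<Longrightarrow> (\<lambda>z. a * D z) \<in> L"
    and comm: "\<And>D E. D \<in> L \<Longrightarrow> E \<in> L \<Longrightarrow> (\<lambda>z. D (E z) - E (D z)) \<in> L"
  shows "\<exists>J dd. frame \<kappa> x J dd \<and> (\<forall>k. dd k \<in> L) \<and>
    (\<forall>D\<in>L. \<forall>z. D z = (\<Sum>k\<in>J. D (x k) * dd k z)) \<and>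
    card J = vec.dim ((\<lambda>D. (\<chi> j. D (x j)) :: 'f^'n) ` L)"
proof -
  let ?v = "\<lambda>D::'f \<Rightarrow> 'f. (\<chi> j. D (x j)) :: 'f^'n"
  have sub: "vec.subspace (?v ` L)"
    unfolding vec.subspace_def
  proof (intro conjI ballI allI)
    show "0 \<in> ?v ` L" using zero by (force simp: vec_eq_iff)
    fix u assume "u \<in> ?v ` L"
    then obtain D where D: "u = ?v D" "D \<in> L" by blast
    show "c *s u \<in> ?v ` L" for c
      by (rule image_eqI[OF _ scale[OF D(2), of c]]) (simp add: D(1) vec_eq_iff)
    fix w assume "w \<in> ?v ` L"
    then obtain E where E: "w = ?v E" "E \<in> L" by blast
    show "u + w \<in> ?v ` L"
      by (rule image_eqI[OF _ add[OF D(2) E(2)]]) (simp add: D(1) E(1) vec_eq_iff)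
  qed
  obtain J and \<rho> :: "'n \<Rightarrow> 'f^'n" where \<rho>: "\<And>k. k \<in> J \<Longrightarrow> \<rho> k \<in> ?v ` L"
    "\<And>k l. k \<in> J \<Longrightarrow> l \<in> J \<Longrightarrow> \<rho> k $ l = (if k = l then 1 else 0)"
    "\<And>u. u \<in> ?v ` L \<Longrightarrow> u = (\<Sum>k\<in>J. u $ k *s \<rho> k)" "card J = vec.dim (?v ` L)"
    by (rule subspace_coordinates[OF sub]) (rule that)
  from \<rho>(1) have "\<forall>k\<in>J. \<exists>D. D \<in> L \<and> \<rho> k = ?v D" by blast
  then obtain d0 where d0: "\<And>k. k \<in> J \<Longrightarrow> d0 k \<in> L" "\<And>k. k \<in> J \<Longrightarrow> \<rho> k = ?v (d0 k)" by metis
  define dd where "dd k = (if k \<in> J then d0 k else (\<lambda>_. 0))" for k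
  have ddL: "dd k \<in> L" for k using d0(1) zero by (simp add: dd_def)
  have dd_x: "dd k (x l) = (if k = l then 1 else 0)" if "k \<in> J" "l \<in> J" for k l
    using \<rho>(2)[OF that] d0(2)[OF that(1)] that by (simp add: dd_def)
  have expand: "D z = (\<Sum>k\<in>J. D (x k) * dd k z)" if D: "D \<in> L" for D z
  proof (rule der_eqI[OF der[OF D], where D' = "\<lambda>z. \<Sum>k\<in>J. D (x k) * dd k z"])
    show "der (\<lambda>z. \<Sum>k\<in>J. D (x k) * dd k z)"
      by (intro der_sum_fun der_scale der ddL)
    fix j
    have "?v D = (\<Sum>k\<in>J. ?v D $ k *s \<rho> k)" using \<rho>(3) D by blast
    then have "?v D $ j = (\<Sum>k\<in>J. ?v D $ k *s \<rho> k) $ j" by (rule arg_cong)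
    then have "D (x j) = (\<Sum>k\<in>J. D (x k) * \<rho> k $ j)"
      by (simp only: vec_lambda_beta sum_component vector_smult_component)
    also have "\<dots> = (\<Sum>k\<in>J. D (x k) * dd k (x j))"
      by (rule sum.cong) (simp_all add: d0(2) dd_def)
    finally show "D (x j) = (\<Sum>k\<in>J. D (x k) * dd k (x j))" .
  qed
  have "frame \<kappa> x J dd"
  proof
    show "der (dd k)" for k using der ddL by blast
    show "dd k z = 0" if "k \<notin> J" for k z using that by (simp add: dd_def)
    show "dd k (x l) = (if k = l then 1 else 0)" if "k \<in> J" "l \<in> J" for k l using dd_x that .
    show "dd k (dd l z) = dd l (dd k z)" for k l z
    proof (cases "k \<in> J \<and> l \<in> J")
      case True
      have "dd k (dd l z) - dd l (dd k z) = 0"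
        using expand[OF comm[OF ddL[of k] ddL[of l]], of z] True
        by (simp add: dd_x der_simps(2,3)[OF der[OF ddL]] if_distrib[of "dd _"] cong: if_cong)
      then show ?thesis by simp
    next
      case False
      then show ?thesis by (auto simp: dd_def der_simps(2)[OF der[OF d0(1)]])
    qed
  qed
  then show ?thesis
    using ddL expand \<rho>(4) by (intro exI[of _ J] exI[of _ dd] conjI allI ballI) simp_all
qed

section \<open>Hamiltonian derivations of the field of fractions\<close>

locale poisson_alg = fg_field \<kappa> x
  for \<kappa> :: "'k::field_char_0 \<Rightarrow> 'f::field" and x :: "'n::finite \<Rightarrow> 'f" +
  fixes e :: "'a::idom \<Rightarrow> 'f" and sc :: "'k \<Rightarrow> 'a \<Rightarrow> 'a" and \<xi> :: "'n \<Rightarrow> 'a"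
    and br :: "'a \<Rightarrow> 'a \<Rightarrow> 'a"
  assumes e_add: "e (a + b) = e a + e b" and e_mult: "e (a * b) = e a * e b"
    and e_1: "e 1 = 1" and inj_e: "inj e" and e_sc: "e (sc c a) = \<kappa> c * e a"
    and e_\<xi>: "e (\<xi> j) = x j" and poisson: "is_poisson_bracket sc br"
begin

lemma e_0 [simp]: "e 0 = 0"
  using e_add[of 0 0] by (metis add.right_neutral add_left_cancel)

lemma e_minus: "e (- a) = - e a"
  using e_add[of a "- a"] by (simp add: add_eq_0_iff)

lemma e_diff: "e (a - b) = e a - e b"
  using e_add[of a "- b"] by (simp add: e_minus)

lemma e_eq_iff [simp]: "e a = e b \<longleftrightarrow> a = b"
  using inj_e by (auto dest: injD)

lemma e_eq_0_iff [simp]: "e a = 0 \<longleftrightarrow> a = 0"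
  using e_eq_iff[of a 0] by simp

sublocale A: vector_space sc
proof unfold_locales
  show "sc c (a + b) = sc c a + sc c b" for c a b
    unfolding e_eq_iff[symmetric] by (simp add: e_add e_sc algebra_simps)
  show "sc (c + d) a = sc c a + sc d a" for c d a
    unfolding e_eq_iff[symmetric] by (simp add: e_add e_sc \<kappa>_add algebra_simps)
  show "sc c (sc d a) = sc (c * d) a" for c d a
    unfolding e_eq_iff[symmetric] by (simp add: e_sc \<kappa>_mult)
  show "sc 1 a = a" for a
    unfolding e_eq_iff[symmetric] by (simp add: e_sc \<kappa>_1)
qed

lemma sc_mult: "sc c (a * b) = sc c a * b" "sc c (a * b) = a * sc c b"
  unfolding e_eq_iff[symmetric] by (simp_all add: e_sc e_mult)

sublocale Aalg: assoc_alg sc "(*)" 1 UNIV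
  by unfold_locales (simp_all add: A.subspace_UNIV distrib_left distrib_right sc_mult mult.assoc
    flip: sc_mult)

lemma subring_range_e: "subring (range e)"
  unfolding subring_def
proof (intro conjI allI ballI; clarsimp)
  show "\<kappa> c \<in> range e" for c using e_sc[of c 1] by (metis e_1 mult.right_neutral rangeI)
  show "e a + e b \<in> range e" "e a * e b \<in> range e" for a b by (simp_all flip: e_add e_mult)
qed

lemma polys_sub_range_e: "polys UNIV \<subseteq> range e"
  by (rule polys_minimal[OF subring_range_e]) (metis e_\<xi> rangeI)

lemma frac_e: "\<exists>a b. b \<noteq> 0 \<and> z = e a / e b"
proof -
  obtain p q where pq: "p \<in> range e" "q \<in> range e" "q \<noteq> 0" "z = p / q"
    using frac[of z] polys_sub_range_e by blast
  then show ?thesis by force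
qed

lemma br_add: "br a (b + c) = br a b + br a c" and br_sc: "br a (sc k b) = sc k (br a b)"
proof -
  have "Vector_Spaces.linear sc sc (br a)" using poisson by (simp add: is_poisson_bracket_def)
  then interpret l: Vector_Spaces.linear sc sc "br a" .
  show "br a (b + c) = br a b + br a c" "br a (sc k b) = sc k (br a b)"
    by (simp_all add: l.add l.scale)
qed

lemma br_add_left: "br (a + b) c = br a c + br b c"
proof -
  have "Vector_Spaces.linear sc sc (\<lambda>a. br a c)" using poisson by (simp add: is_poisson_bracket_def)
  then interpret l: Vector_Spaces.linear sc sc "\<lambda>a. br a c" .
  show ?thesis by (simp add: l.add)
qed

lemma br_self: "br a a = 0" and br_mult: "br a (b * c) = br a b * c + b * br a c"
  and br_jacobi: "br a (br b c) + br b (br c a) + br c (br a b) = 0"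
  using poisson by (auto simp: is_poisson_bracket_def)

lemma br_antisym: "br a b = - br b a"
proof -
  have "br (a + b) (a + b) = 0" by (rule br_self)
  then have "br a b + br b a = 0" unfolding br_add br_add_left by (simp add: br_self add.commute)
  then show ?thesis by (simp add: eq_neg_iff_add_eq_0)
qed

lemma br_1: "br a 1 = 0"
  using br_mult[of a 1 1] by (metis add_left_cancel add.right_neutral mult.right_neutral mult_1)

text \<open>The extension of \<open>br a\<close> to the field. A derivation is determined by its
  values at the \<open>x j\<close>, so the choice is unique.\<close>

definition ham :: "'a \<Rightarrow> 'f \<Rightarrow> 'f"
  where "ham a = (SOME D. der D \<and> (\<forall>b. D (e b) = e (br a b)))"

lemma ham: "der (ham a)" "ham a (e b) = e (br a b)"
proof -
  define D where "D = (\<lambda>z. e (br a (inv_into UNIV e z)))"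
  have De: "D (e b) = e (br a b)" for b by (simp add: D_def inv_into_f_f[OF inj_e])
  have "der_on (range e) D"
    unfolding der_on_def
  proof (intro conjI allI ballI)
    have "\<kappa> c = e (sc c 1)" for c by (simp add: e_sc e_1)
    then show "D (\<kappa> c) = 0" for c by (simp add: De br_sc br_1 A.scale_zero_right)
    fix u v assume "u \<in> range e" "v \<in> range e"
    then obtain b c where bc: "u = e b" "v = e c" by blast
    show "D (u + v) = D u + D v"
      by (simp add: bc De br_add flip: e_add)
    show "D (u * v) = D u * v + u * D v"
      by (simp add: bc De br_mult flip: e_mult e_add)
  qed
  moreover have "\<exists>p\<in>range e. \<exists>q\<in>range e. q \<noteq> 0 \<and> z = p / q" for z
    using frac_e[of z] by force
  ultimately obtain D' where "der D'" "\<And>b. b \<in> range e \<Longrightarrow> D' b = D b"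
    using der_on_fraction_extension[OF subring_range_e] by metis
  then have "\<exists>D. der D \<and> (\<forall>b. D (e b) = e (br a b))" using De by auto
  from someI_ex[OF this] show "der (ham a)" "ham a (e b) = e (br a b)"
    unfolding ham_def by auto
qed

lemma ham_x: "ham a (x j) = e (br a (\<xi> j))"
  using ham(2)[of a "\<xi> j"] by (simp add: e_\<xi>)

text \<open>Both sides are derivations of the field, so only the generators need checking, and there
  the claim is the Jacobi identity.\<close>

lemma ham_commutator: "ham a (ham b z) - ham b (ham a z) = ham (br a b) z"
proof (rule der_eqI[where D = "\<lambda>z. ham a (ham b z) - ham b (ham a z)"])
  show "der (\<lambda>z. ham a (ham b z) - ham b (ham a z))" by (intro der_commutator ham)
  fix j
  have "br a (br b (\<xi> j)) + - br b (br a (\<xi> j)) = br (br a b) (\<xi> j)"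
    using br_jacobi[of a b "\<xi> j"] br_antisym[of "\<xi> j" a] br_antisym[of "\<xi> j" "br a b"]
      br_add[of b "br a (\<xi> j)" "- br a (\<xi> j)"] br_add[of b 0 0]
    by (simp add: add_eq_0_iff algebra_simps)
  from arg_cong[OF this, of e] show "ham a (ham b (x j)) - ham b (ham a (x j)) = ham (br a b) (x j)"
    by (simp add: ham_x ham(2) e_diff)
qed (rule ham)

text \<open>Only the generators enter, to match the rows of the Poisson matrix; the Hamiltonian
  derivations of all other elements turn out to lie in this span too.\<close>

definition ham_space :: "('f \<Rightarrow> 'f) set"
  where "ham_space = {D. \<exists>c. \<forall>z. D z = (\<Sum>i\<in>UNIV. c i * ham (\<xi> i) z)}"

lemma ham_space_der: "D \<in> ham_space \<Longrightarrow> der D"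
proof -
  assume "D \<in> ham_space"
  then obtain c where "D = (\<lambda>z. \<Sum>i\<in>UNIV. c i * ham (\<xi> i) z)" by (auto simp: ham_space_def)
  then show ?thesis by (simp add: der_sum_fun der_scale ham)
qed

lemma ham_space_zero: "(\<lambda>_. 0) \<in> ham_space"
  unfolding ham_space_def by (auto intro: exI[of _ "\<lambda>_. 0"])

lemma ham_space_add: "D \<in> ham_space \<Longrightarrow> E \<in> ham_space \<Longrightarrow> (\<lambda>z. D z + E z) \<in> ham_space"
  unfolding ham_space_def
proof clarsimp
  fix c d
  show "\<exists>b. \<forall>z. (\<Sum>i\<in>UNIV. c i * ham (\<xi> i) z) + (\<Sum>i\<in>UNIV. d i * ham (\<xi> i) z)
      = (\<Sum>i\<in>UNIV. b i * ham (\<xi> i) z)"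
    by (rule exI[of _ "\<lambda>i. c i + d i"]) (simp add: distrib_right sum.distrib)
qed

lemma ham_space_scale: "D \<in> ham_space \<Longrightarrow> (\<lambda>z. a * D z) \<in> ham_space"
  unfolding ham_space_def
proof clarsimp
  fix c
  show "\<exists>b. \<forall>z. a * (\<Sum>i\<in>UNIV. c i * ham (\<xi> i) z) = (\<Sum>i\<in>UNIV. b i * ham (\<xi> i) z)"
    by (rule exI[of _ "\<lambda>i. a * c i"]) (simp add: sum_distrib_left mult.assoc)
qed

lemma ham_space_sum: "(\<And>i. i \<in> I \<Longrightarrow> D i \<in> ham_space) \<Longrightarrow> (\<lambda>z. \<Sum>i\<in>I. D i z) \<in> ham_space"
  by (induction I rule: infinite_finite_induct) (auto simp: ham_space_zero ham_space_add)

text \<open>By skew-symmetry the expansion of \<open>{a, x\<^sub>j}\<close> in the rows of the Poisson matrix amounts to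
  expanding \<open>z \<mapsto> {x\<^sub>j, z}\<close> along partial derivatives of \<open>z\<close>, uniformly in \<open>j\<close>.\<close>

lemma ham_expansion: "\<exists>c. \<forall>j. ham (\<xi> j) z = (\<Sum>i\<in>UNIV. c i * ham (\<xi> j) (x i))"
proof -
  \<comment> \<open>One \<open>c\<close> must serve all \<open>j\<close>; the Leibniz rule then
    makes \<open>G\<close> a subring, with coefficients that still do not depend on
    \<open>j\<close>.\<close>
  define G where "G = {z. \<exists>c. \<forall>j. ham (\<xi> j) z = (\<Sum>i\<in>UNIV. c i * ham (\<xi> j) (x i))}"
  have "subring G"
    unfolding subring_def
  proof (intro conjI allI ballI)
    show "\<kappa> c \<in> G" for c
      unfolding G_def by (auto intro!: exI[of _ "\<lambda>_. 0"] simp: der_simps(1)[OF ham(1)])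
    fix a b assume "a \<in> G" "b \<in> G"
    then obtain c d where cd: "\<And>j. ham (\<xi> j) a = (\<Sum>i\<in>UNIV. c i * ham (\<xi> j) (x i))"
      "\<And>j. ham (\<xi> j) b = (\<Sum>i\<in>UNIV. d i * ham (\<xi> j) (x i))" unfolding G_def by blast
    have "ham (\<xi> j) (a + b) = (\<Sum>i\<in>UNIV. (c i + d i) * ham (\<xi> j) (x i))" for j
      by (simp add: der_simps(4)[OF ham(1)] cd distrib_right sum.distrib)
    then show "a + b \<in> G" unfolding G_def by (auto intro: exI[of _ "\<lambda>i. c i + d i"])
    have "ham (\<xi> j) (a * b) = (\<Sum>i\<in>UNIV. (b * c i + a * d i) * ham (\<xi> j) (x i))" for j
      by (simp add: der_simps(5)[OF ham(1)] cd sum.distrib sum_distrib_left sum_distrib_right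
        algebra_simps)
    then show "a * b \<in> G" unfolding G_def by (auto intro: exI[of _ "\<lambda>i. b * c i + a * d i"])
  qed
  then have polys: "polys UNIV \<subseteq> G"
  proof (rule polys_minimal)
    fix k
    have "ham (\<xi> j) (x k) = (\<Sum>i\<in>UNIV. (if i = k then 1 else 0) * ham (\<xi> j) (x i))" for j
      by (simp add: if_distrib[of "\<lambda>a. a * _"] cong: if_cong)
    then show "x k \<in> G" unfolding G_def by (auto intro: exI[of _ "\<lambda>i. if i = k then 1 else 0"])
  qed
  obtain p q where pq: "p \<in> polys UNIV" "q \<in> polys UNIV" "q \<noteq> 0" "z = p / q" using frac by blast
  then have "p \<in> G" "q \<in> G" using polys by auto
  then obtain c d where cd: "\<And>j. ham (\<xi> j) p = (\<Sum>i\<in>UNIV. c i * ham (\<xi> j) (x i))"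
    "\<And>j. ham (\<xi> j) q = (\<Sum>i\<in>UNIV. d i * ham (\<xi> j) (x i))" unfolding G_def by blast
  have "ham (\<xi> j) z = (\<Sum>i\<in>UNIV. (c i - z * d i) / q * ham (\<xi> j) (x i))" for j
  proof -
    have "ham (\<xi> j) z = (ham (\<xi> j) p - z * ham (\<xi> j) q) / q"
      using der_divide[OF ham(1) pq(3), of "\<xi> j" p] pq(4) by simp
    then show ?thesis
      by (simp add: cd sum_divide_distrib sum_distrib_left flip: sum_subtractf)
        (simp add: algebra_simps)
  qed
  then show ?thesis by (intro exI[of _ "\<lambda>i. (c i - z * d i) / q"]) simp
qed

lemma ham_in_ham_space: "ham a \<in> ham_space"
proof -
  obtain c where c: "\<And>j. ham (\<xi> j) (e a) = (\<Sum>i\<in>UNIV. c i * ham (\<xi> j) (x i))"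
    using ham_expansion by metis
  have "ham a z = (\<Sum>i\<in>UNIV. c i * ham (\<xi> i) z)" for z
  proof (rule der_eqI[where D' = "\<lambda>z. \<Sum>i\<in>UNIV. c i * ham (\<xi> i) z"])
    show "der (\<lambda>z. \<Sum>i\<in>UNIV. c i * ham (\<xi> i) z)" by (intro der_sum_fun der_scale ham)
    fix j
    have "ham a (x j) = - ham (\<xi> j) (e a)"
      by (simp add: ham_x ham(2) br_antisym[of a] e_minus)
    also have "\<dots> = (\<Sum>i\<in>UNIV. c i * ham (\<xi> i) (x j))"
      unfolding c by (simp add: ham_x br_antisym[of "\<xi> j"] e_minus sum_negf)
    finally show "ham a (x j) = (\<Sum>i\<in>UNIV. c i * ham (\<xi> i) (x j))" .
  qed (rule ham)
  then show ?thesis by (auto simp: ham_space_def)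
qed

text \<open>[c D, E] = c [D, E] - E(c) D, and the extra term stays in the span because its
  coefficients are arbitrary field elements. Expanding one argument at a time reduces everything to
  brackets of Hamiltonian derivations.\<close>

lemma ham_space_commutator:
  assumes D: "D \<in> ham_space" and E: "E \<in> ham_space"
  shows "(\<lambda>z. D (E z) - E (D z)) \<in> ham_space"
proof -
  have 1: "(\<lambda>z. ham a (E z) - E (ham a z)) \<in> ham_space" if E: "E \<in> ham_space" for a E
  proof -
    obtain c where c: "\<And>z. E z = (\<Sum>i\<in>UNIV. c i * ham (\<xi> i) z)" using E by (auto simp: ham_space_def)
    have "(\<lambda>z. ham a (E z) - E (ham a z)) =
        (\<lambda>z. \<Sum>i\<in>UNIV. ham a (c i) * ham (\<xi> i) z + c i * ham (br a (\<xi> i)) z)"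
      by (simp add: fun_eq_iff c der_sum[OF ham(1)] der_simps(5)[OF ham(1)] algebra_simps
        flip: sum_subtractf ham_commutator)
    also have "\<dots> \<in> ham_space"
      by (intro ham_space_sum ham_space_add ham_space_scale ham_in_ham_space)
    finally show ?thesis .
  qed
  obtain c where c: "\<And>z. D z = (\<Sum>i\<in>UNIV. c i * ham (\<xi> i) z)" using D by (auto simp: ham_space_def)
  have dE: "der E" using E by (rule ham_space_der)
  have "(\<lambda>z. D (E z) - E (D z)) =
      (\<lambda>z. \<Sum>i\<in>UNIV. c i * (ham (\<xi> i) (E z) - E (ham (\<xi> i) z)) + (- E (c i)) * ham (\<xi> i) z)"
    by (simp add: fun_eq_iff c der_sum[OF dE] der_simps(5)[OF dE] algebra_simps flip: sum_subtractf)
  also have "\<dots> \<in> ham_space"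
    by (intro ham_space_sum ham_space_add ham_space_scale ham_in_ham_space 1 E)
  finally show ?thesis .
qed

end

section \<open>Gelfand--Kirillov dimension of the algebra\<close>

context field_ext
begin

lemma common_denominator:
  assumes B: "subring B" and frac: "\<And>z. \<exists>p\<in>B. \<exists>q\<in>B. q \<noteq> 0 \<and> z = p / q" and "finite Z"
  shows "\<exists>s\<in>B. s \<noteq> 0 \<and> (\<forall>z\<in>Z. s * z \<in> B)"
  using \<open>finite Z\<close>
proof induction
  case empty
  then show ?case using subring_simps(2)[OF B] by (intro bexI[of _ 1]) auto
next
  case (insert z Z)
  then obtain s where s: "s \<in> B" "s \<noteq> 0" "\<And>z. z \<in> Z \<Longrightarrow> s * z \<in> B" by blast
  obtain p q where pq: "p \<in> B" "q \<in> B" "q \<noteq> 0" "z = p / q" using frac by blast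
  have "q * s * w \<in> B" if "w \<in> insert z Z" for w
  proof (cases "w = z")
    case True
    then have "q * s * w = s * p" using pq by simp
    then show ?thesis using subring_simps(5)[OF B s(1) pq(1)] by (simp only:)
  next
    case False
    then show ?thesis using s(3)[of w] that pq subring_simps(5)[OF B, of q "s * w"] by (simp add: mult.assoc)
  qed
  then show ?case using s pq subring_simps(5)[OF B] by (intro bexI[of _ "q * s"]) auto
qed

end

context poisson_alg
begin

definition monA :: "'n multiset \<Rightarrow> 'a" where "monA \<beta> = prod_mset (image_mset \<xi> \<beta>)"

lemma e_monA: "e (monA \<beta>) = mon \<beta>"
  by (induction \<beta>) (simp_all add: monA_def mon_def e_1 e_mult e_\<xi>)

lemma e_sum: "e (sum g I) = (\<Sum>i\<in>I. e (g i))"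
  by (induction I rule: infinite_finite_induct) (simp_all add: e_add)

lemma linear_e: "Vector_Spaces.linear sc ks e"
  by unfold_locales (simp_all add: e_add e_sc ks_def)

text \<open>\<open>e\<close> carries the filtration generated by \<open>F\<close> into the one
  generated by its image in the field, where \<open>growth_bound\<close> counts.\<close>

lemma GK_algebra_le:
  assumes alg: "\<And>z. \<exists>p. p \<noteq> 0 \<and> coeffs_in (polys J) p \<and> poly p z = 0"
  shows "GKdim sc (*) 1 UNIV \<le> ereal (real (card J))"
proof (rule Aalg.GKdim_le)
  fix F :: "'a set" assume F: "finite F"
  obtain C where C: "\<And>N. \<exists>S. finite S \<and> card S \<le> C * (N + 1) ^ card J \<and> alg.filt (e ` F) N \<subseteq> ks.span S"
    using growth_bound[OF alg, of "e ` F"] F by blast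
  have "A.dim (Aalg.filt F N) \<le> C * (N + 1) ^ card J" for N
  proof -
    have "Aalg.filt F N \<subseteq> {a. e a \<in> alg.filt (e ` F) N}" for N
    proof (rule Aalg.filt_minimal)
      show "A.subspace {a. e a \<in> alg.filt (e ` F) N}" for N
        using alg.subspace_filt[of "e ` F" N] unfolding ks.subspace_def A.subspace_def
        by (auto simp: e_add e_sc ks_def)
      show "{a. e a \<in> alg.filt (e ` F) M} \<subseteq> {a. e a \<in> alg.filt (e ` F) N}" if "M \<le> N" for M N
        using alg.filt_mono[OF that, of "e ` F"] by blast
      show "1 \<in> {a. e a \<in> alg.filt (e ` F) 0}" using alg.unit_in_filt by (simp add: e_1)
      show "a * v \<in> {a. e a \<in> alg.filt (e ` F) (Suc N)}"
        if "a \<in> {a. e a \<in> alg.filt (e ` F) N}" "v \<in> F" for N a v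
        using alg.filt_mul[OF _ _ alg.gen_in_filt, of "e ` F" "e a" N "e v"] that by (simp add: e_mult)
    qed simp
    moreover obtain S where S: "finite S" "card S \<le> C * (N + 1) ^ card J" "alg.filt (e ` F) N \<subseteq> ks.span S"
      using C by blast
    ultimately have "A.dim (Aalg.filt F N) \<le> card S"
      by (intro dim_le_card_inj_image[OF linear_e inj_e _ S(1)]) blast
    then show ?thesis using S(2) by simp
  qed
  then show "\<exists>K. \<forall>N. A.dim (Aalg.filt F N) \<le> K * (N + 1) ^ card J" by blast
qed simp

lemma GK_algebra_ge:
  assumes "frame \<kappa> x J dd"
  shows "ereal (real (card J)) \<le> GKdim sc (*) 1 UNIV"
proof -
  interpret frame \<kappa> x J dd by fact
  let ?V = "A.span (\<xi> ` J)"
  have mem: "set_mset \<beta> \<subseteq> J \<Longrightarrow> monA \<beta> \<in> Aalg.filt ?V (size \<beta>)" for \<beta>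
  proof (induction \<beta>)
    case empty
    then show ?case using Aalg.unit_in_filt[of ?V 0] by (simp add: monA_def)
  next
    case (add k \<beta>)
    then have "\<xi> k \<in> Aalg.filt ?V 1" by (intro Aalg.gen_in_filt A.span_base) auto
    then have "\<xi> k * monA \<beta> \<in> Aalg.filt ?V (1 + size \<beta>)" using add by (intro Aalg.filt_mul) auto
    then show ?case by (simp add: monA_def)
  qed
  show ?thesis
  \<comment> \<open>The monomials used at stage \<open>N\<close> have degree at most
    \<open>N * card J\<close>; the extra 1 keeps the constant positive when \<open>J\<close> is
    empty.\<close>
  proof (rule Aalg.GKdim_ge[where F = "\<xi> ` J" and c = "card J + 1"])
    fix N
    let ?I = "multi_indices J (N * card J)"
    have "N ^ card J \<le> (N + 1) ^ card J" by (intro power_mono) auto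
    also have "\<dots> \<le> card ?I" by (rule multi_indices_card_ge)
    also have "\<dots> \<le> A.dim (Aalg.filt ?V ((card J + 1) * N))"
    proof -
      obtain S where S: "finite S" "Aalg.filt ?V ((card J + 1) * N) \<subseteq> A.span S"
        using Aalg.filt_finite_dim[of "\<xi> ` J" "(card J + 1) * N"] Aalg.filt_span_eq[of "\<xi> ` J"] by auto
      show ?thesis
      proof (rule A.card_le_dim_family[where v = monA, OF multi_indices_finite_card(1) _ S(2,1)])
        show "monA ` ?I \<subseteq> Aalg.filt ?V ((card J + 1) * N)"
        proof clarify
          fix \<beta> assume \<beta>: "\<beta> \<in> ?I"
          then have "size \<beta> \<le> (card J + 1) * N" by (simp add: multi_indices_def mult.commute)
          then show "monA \<beta> \<in> Aalg.filt ?V ((card J + 1) * N)"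
            using mem[of \<beta>] Aalg.filt_mono[of "size \<beta>" _ ?V] \<beta> by (auto simp: multi_indices_def)
        qed
        fix c \<beta> assume *: "(\<Sum>i\<in>?I. sc (c i) (monA i)) = 0" "\<beta> \<in> ?I"
        have "(\<Sum>i\<in>?I. ks (c i) (mon i)) = 0"
          using arg_cong[OF *(1), of e] by (simp add: e_sum e_sc e_monA ks_def)
        from mon_independent[OF multi_indices_finite_card(1) _ this *(2)] show "c \<beta> = 0"
          by (auto simp: multi_indices_def)
      qed
    qed
    finally show "N ^ card J \<le> A.dim (Aalg.filt ?V ((card J + 1) * N))" .
  qed auto
qed

section \<open>Operators on the algebra and functions from it to the field\<close>

sublocale Op: assoc_alg "fun_scale sc" "(\<circ>)" id "End_alg sc"
proof -
  have lin: "P (a + b) = P a + P b" "P (sc c a) = sc c (P a)" if "P \<in> End_alg sc" for P a b c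
  proof -
    interpret l: Vector_Spaces.linear sc sc P using that by (simp add: End_alg_def)
    show "P (a + b) = P a + P b" "P (sc c a) = sc c (P a)" by (simp_all add: l.add l.scale)
  qed
  have linI: "P \<in> End_alg sc" if "\<And>a b. P (a + b) = P a + P b" "\<And>c a. P (sc c a) = sc c (P a)" for P
    unfolding End_alg_def using that by (simp add: Vector_Spaces.linear_iff A.vector_space_axioms)
  interpret vector_space "fun_scale sc :: 'k \<Rightarrow> ('a \<Rightarrow> 'a) \<Rightarrow> 'a \<Rightarrow> 'a"
    by unfold_locales (auto simp: fun_scale_def fun_eq_iff A.scale_right_distrib A.scale_left_distrib)
  show "assoc_alg (fun_scale sc) (\<circ>) id (End_alg sc)"
  proof unfold_locales
    show "subspace (End_alg sc)"
      unfolding subspace_def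
      by (auto intro!: linI simp: fun_scale_def lin algebra_simps A.scale_right_distrib A.scale_left_commute)
    show "id \<in> End_alg sc" by (rule linI) auto
    show "P \<circ> Q \<in> End_alg sc" if "P \<in> End_alg sc" "Q \<in> End_alg sc" for P Q
      by (rule linI) (auto simp: lin that)
  qed (auto simp: fun_eq_iff fun_scale_def lin)
qed

lemma End_algI: "(\<And>a b. P (a + b) = P a + P b) \<Longrightarrow> (\<And>c a. P (sc c a) = sc c (P a)) \<Longrightarrow> P \<in> End_alg sc"
  unfolding End_alg_def by (simp add: Vector_Spaces.linear_iff A.vector_space_axioms)

lemma mult_in_End: "(\<lambda>b. a * b) \<in> End_alg sc"
  by (rule End_algI) (simp_all add: distrib_left flip: sc_mult)

lemma br_in_End: "br a \<in> End_alg sc"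
  by (rule End_algI) (simp_all add: br_add br_sc)

lemma poisson_diff_ops_sub_End: "poisson_diff_ops sc br \<subseteq> End_alg sc"
  unfolding poisson_diff_ops_def
proof (rule hull_minimal)
  show "range (\<lambda>a x. a * x) \<union> range br \<subseteq> End_alg sc" using mult_in_End br_in_End by auto
  show "End_alg sc \<subseteq> End_alg sc \<and> is_subalgebra (fun_scale sc) (\<circ>) id (End_alg sc)"
    using Op.subspace_B Op.unit_in_B Op.mul_closed by (simp add: is_subalgebra_def)
qed

text \<open>Scalars for the functions from the algebra to the field. An operator \<open>P\<close>
  enters this space as \<open>\<lambda>f. e (P f)\<close>, where it can be compared with field
  combinations of the \<open>Dm \<alpha>\<close>.\<close>

definition fks :: "'k \<Rightarrow> ('a \<Rightarrow> 'f) \<Rightarrow> 'a \<Rightarrow> 'f" where "fks c H = (\<lambda>f. ks c (H f))"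

sublocale FF: vector_space fks
  by unfold_locales (auto simp: fks_def fun_eq_iff ks.scale_right_distrib ks.scale_left_distrib)

lemma FF_span_sum:
  "(\<And>i. i \<in> I \<Longrightarrow> H i \<in> FF.span Y) \<Longrightarrow> (\<lambda>f. \<Sum>i\<in>I. H i f) \<in> FF.span Y"
proof (induction I rule: infinite_finite_induct)
  case (insert i I)
  have "(\<lambda>f. \<Sum>i\<in>insert i I. H i f) = H i + (\<lambda>f. \<Sum>i\<in>I. H i f)"
    using insert by (auto simp: fun_eq_iff)
  then show ?case using insert by (auto intro: FF.span_add)
qed (auto intro: FF.span_zero simp flip: zero_fun_def)

end

section \<open>Gelfand--Kirillov dimension of the Poisson differential operators\<close>

text \<open>The two assumptions serve opposite bounds: \<open>ham_frame\<close> writes brackets in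
  the frame, for the upper bound, and \<open>dd_ham\<close> recovers the frame from brackets up to a
  denominator, for the lower one.\<close>

locale poisson_frame = poisson_alg \<kappa> x e sc \<xi> br + frame \<kappa> x J dd
  for \<kappa> :: "'k::field_char_0 \<Rightarrow> 'f::field" and x :: "'n::finite \<Rightarrow> 'f"
    and e :: "'a::idom \<Rightarrow> 'f" and sc \<xi> br J dd +
  assumes ham_frame: "ham a z = (\<Sum>k\<in>J. ham a (x k) * dd k z)"
    and dd_ham: "dd k \<in> ham_space"
begin

text \<open>Filtrations of the coefficients in which a derivation of the frame costs one step, so
  that moving derivations past coefficients keeps the growth under control.\<close>

definition good :: "(nat \<Rightarrow> 'f set) \<Rightarrow> bool"
  where "good G \<longleftrightarrow> (\<forall>N. ks.subspace (G N)) \<and> (\<forall>M N. M \<le> N \<longrightarrow> G M \<subseteq> G N) \<and> 1 \<in> G 0 \<and>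
    (\<forall>M N u v. u \<in> G M \<longrightarrow> v \<in> G N \<longrightarrow> u * v \<in> G (M + N)) \<and>
    (\<forall>k N u. u \<in> G N \<longrightarrow> dd k u \<in> G (Suc N))"

text \<open>One index bounds the level of the coefficient and the order of the derivation at once;
  the count is then a product of two powers of \<open>N\<close>.\<close>

definition gens :: "(nat \<Rightarrow> 'f set) \<Rightarrow> nat \<Rightarrow> ('a \<Rightarrow> 'f) set"
  where "gens G N = {\<lambda>f. w * Dm \<alpha> (e f) |w \<alpha>. w \<in> G N \<and> \<alpha> \<in> multi_indices J N}"

lemma goodD:
  assumes "good G"
  shows "M \<le> N \<Longrightarrow> G M \<subseteq> G N" "1 \<in> G 0" "u \<in> G M \<Longrightarrow> v \<in> G N \<Longrightarrow> u * v \<in> G (M + N)"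
    "u \<in> G N \<Longrightarrow> dd k u \<in> G (Suc N)"
  using assms by (simp_all add: good_def)

lemma gens_mono:
  assumes "good G" "M \<le> N"
  shows "gens G M \<subseteq> gens G N"
  using goodD(1)[OF assms] multi_indices_mono[OF assms(2), of J] unfolding gens_def by blast

lemma FF_linearI:
  assumes "\<And>H K. T (\<lambda>f. H f + K f) = (\<lambda>f. T H f + T K f)" "\<And>c H. T (fks c H) = fks c (T H)"
  shows "Vector_Spaces.linear fks fks T"
  using assms by (simp add: Vector_Spaces.linear_iff FF.vector_space_axioms plus_fun_def)

lemma gens_mult:
  assumes G: "good G" and H: "H \<in> FF.span (gens G N)" and w: "w \<in> G M"
  shows "(\<lambda>f. w * H f) \<in> FF.span (gens G (M + N))"
proof (rule FF.span_image_linear[OF _ H, where g = "\<lambda>H f. w * H f"])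
  show "Vector_Spaces.linear fks fks (\<lambda>H f. w * H f)"
    by (rule FF_linearI) (simp_all add: fks_def ks_def algebra_simps)
  show "(\<lambda>H f. w * H f) ` gens G N \<subseteq> FF.span (gens G (M + N))"
  proof clarify
    fix K assume "K \<in> gens G N"
    then obtain u \<alpha> where K: "K = (\<lambda>f. u * Dm \<alpha> (e f))" "u \<in> G N" "\<alpha> \<in> multi_indices J N"
      by (auto simp: gens_def)
    have "w * u \<in> G (M + N)" using goodD(3)[OF G w K(2)] .
    moreover have "\<alpha> \<in> multi_indices J (M + N)" using K(3) multi_indices_mono[of N "M + N" J] by auto
    ultimately have "(\<lambda>f. (w * u) * Dm \<alpha> (e f)) \<in> gens G (M + N)" unfolding gens_def by blast
    then show "(\<lambda>f. w * K f) \<in> FF.span (gens G (M + N))"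
      using K(1) by (simp add: FF.span_base mult.assoc)
  qed
qed

lemma gens_dd:
  assumes G: "good G" and H: "H \<in> FF.span (gens G N)"
  shows "(\<lambda>f. dd k (H f)) \<in> FF.span (gens G (Suc N))"
proof (rule FF.span_image_linear[OF _ H, where g = "\<lambda>H f. dd k (H f)"])
  show "Vector_Spaces.linear fks fks (\<lambda>H f. dd k (H f))"
    by (rule FF_linearI) (simp_all add: fks_def der_simps(4)[OF dd_der] der_ks[OF dd_der])
  show "(\<lambda>H f. dd k (H f)) ` gens G N \<subseteq> FF.span (gens G (Suc N))"
  proof clarify
    fix K assume "K \<in> gens G N"
    then obtain u \<alpha> where K: "K = (\<lambda>f. u * Dm \<alpha> (e f))" "u \<in> G N" "\<alpha> \<in> multi_indices J N"
      by (auto simp: gens_def)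
    show "(\<lambda>f. dd k (K f)) \<in> FF.span (gens G (Suc N))"
    proof (cases "k \<in> J")
      case False
      then have "(\<lambda>f. dd k (K f)) = 0" by (auto simp: dd_zero)
      then show ?thesis by (simp add: FF.span_zero)
    next
      case True
      have "dd k u \<in> G (Suc N)" "u \<in> G (Suc N)"
        using goodD(4)[OF G K(2)] goodD(1)[OF G, of N "Suc N"] K(2) by auto
      moreover have "\<alpha> \<in> multi_indices J (Suc N)" "add_mset k \<alpha> \<in> multi_indices J (Suc N)"
        using K(3) True by (auto simp: multi_indices_def)
      ultimately have "(\<lambda>f. dd k u * Dm \<alpha> (e f)) \<in> gens G (Suc N)"
        "(\<lambda>f. u * Dm (add_mset k \<alpha>) (e f)) \<in> gens G (Suc N)" unfolding gens_def by blast+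
      then have "(\<lambda>f. dd k u * Dm \<alpha> (e f)) + (\<lambda>f. u * Dm (add_mset k \<alpha>) (e f))
          \<in> FF.span (gens G (Suc N))" by (intro FF.span_add FF.span_base)
      then show ?thesis unfolding K(1) by (simp add: plus_fun_def der_simps(5)[OF dd_der] Dm_add)
    qed
  qed
qed

text \<open>\<open>P\<close> is applied after an arbitrary function \<open>h\<close>, which makes
  the cost additive under composition. Taking \<open>h = id\<close> recovers the position of
  \<open>P\<close> itself.\<close>

definition raises :: "(nat \<Rightarrow> 'f set) \<Rightarrow> nat \<Rightarrow> ('a \<Rightarrow> 'a) \<Rightarrow> bool"
  where "raises G c P \<longleftrightarrow> (\<forall>N h. (\<lambda>f. e (h f)) \<in> FF.span (gens G N) \<longrightarrow>
    (\<lambda>f. e (P (h f))) \<in> FF.span (gens G (N + c)))"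

lemma raises_mono:
  assumes "good G" "raises G c P" "c \<le> d"
  shows "raises G d P"
  unfolding raises_def
proof (intro allI impI)
  fix N h assume "(\<lambda>f. e (h f)) \<in> FF.span (gens G N)"
  then have "(\<lambda>f. e (P (h f))) \<in> FF.span (gens G (N + c))"
    using assms(2) unfolding raises_def by blast
  moreover have "gens G (N + c) \<subseteq> gens G (N + d)" using assms by (intro gens_mono) auto
  ultimately show "(\<lambda>f. e (P (h f))) \<in> FF.span (gens G (N + d))"
    using FF.span_mono by blast
qed

lemma raisesD:
  "raises G c P \<Longrightarrow> (\<lambda>f. e (h f)) \<in> FF.span (gens G N) \<Longrightarrow>
    (\<lambda>f. e (P (h f))) \<in> FF.span (gens G (N + c))"
  unfolding raises_def by blast

lemma raises_comp:
  assumes "raises G c P" "raises G d Q"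
  shows "raises G (c + d) (P \<circ> Q)"
  unfolding raises_def
proof (intro allI impI)
  fix N h assume "(\<lambda>f. e (h f)) \<in> FF.span (gens G N)"
  then show "(\<lambda>f. e ((P \<circ> Q) (h f))) \<in> FF.span (gens G (N + (c + d)))"
    using raisesD[OF assms(1) raisesD[OF assms(2)], of h N] by (simp add: add_ac)
qed

lemma raises_subspace: "Op.subspace {P. raises G c P}"
  unfolding Op.subspace_def
proof (intro conjI ballI allI; clarsimp simp: raises_def)
  show "(\<lambda>f. 0) \<in> FF.span (gens G (N + c))" for N
    using FF.span_zero[of "gens G (N + c)"] by (simp add: zero_fun_def)
  fix N h
  assume h: "(\<lambda>f. e (h f)) \<in> FF.span (gens G N)"
  fix P :: "'a \<Rightarrow> 'a"
  assume P: "\<forall>N h. (\<lambda>f. e (h f)) \<in> FF.span (gens G N) \<longrightarrow> (\<lambda>f. e (P (h f))) \<in> FF.span (gens G (N + c))"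
  show "(\<lambda>f. e (fun_scale sc d P (h f))) \<in> FF.span (gens G (N + c))" for d
    using FF.span_scale[of "\<lambda>f. e (P (h f))" _ d] P h by (simp add: fks_def ks_def fun_scale_def e_sc)
  fix Q :: "'a \<Rightarrow> 'a"
  assume Q: "\<forall>N h. (\<lambda>f. e (h f)) \<in> FF.span (gens G N) \<longrightarrow> (\<lambda>f. e (Q (h f))) \<in> FF.span (gens G (N + c))"
  show "(\<lambda>f. e (P (h f) + Q (h f))) \<in> FF.span (gens G (N + c))"
    using FF.span_add[of "\<lambda>f. e (P (h f))" _ "\<lambda>f. e (Q (h f))"] P Q h by (simp add: plus_fun_def e_add)
qed

lemma raises_mult: "good G \<Longrightarrow> e a \<in> G 1 \<Longrightarrow> raises G 1 (\<lambda>b. a * b)"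
  unfolding raises_def using gens_mult[of G _ _ "e a" 1] by (simp add: e_mult add.commute)

text \<open>One step pays for the derivation of the frame and one for its coefficient
  \<open>e (br a (\<xi> k))\<close>.\<close>

lemma raises_br:
  assumes G: "good G" and a: "\<And>k. k \<in> J \<Longrightarrow> e (br a (\<xi> k)) \<in> G 1"
  shows "raises G 2 (br a)"
  unfolding raises_def
proof (intro allI impI)
  fix N h assume h: "(\<lambda>f. e (h f)) \<in> FF.span (gens G N)"
  have "(\<lambda>f. e (br a (h f))) = (\<lambda>f. \<Sum>k\<in>J. e (br a (\<xi> k)) * dd k (e (h f)))"
    using ham_frame[of a "e (h _)"] by (simp add: ham(2) ham_x)
  also have "\<dots> \<in> FF.span (gens G (1 + Suc N))"
    by (intro FF_span_sum gens_mult gens_dd G h a)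
  finally show "(\<lambda>f. e (br a (h f))) \<in> FF.span (gens G (N + 2))" by simp
qed

text \<open>An operator involves only a finite set \<open>W\<close> of coefficients.
  \<open>W\<close> and \<open>c\<close> are fixed before \<open>G\<close>, so that one filtration
  can later be chosen for a whole finite set of operators. The operators with this property form a
  subalgebra containing the generators.\<close>

lemma operators_raise:
  assumes "P \<in> poisson_diff_ops sc br"
  shows "\<exists>W c. finite W \<and> (\<forall>G. good G \<longrightarrow> W \<subseteq> G 1 \<longrightarrow> raises G c P)"
proof -
  define R where "R = {P \<in> End_alg sc. \<exists>W c. finite W \<and> (\<forall>G. good G \<longrightarrow> W \<subseteq> G 1 \<longrightarrow> raises G c P)}"
  have RI: "P \<in> R" if "P \<in> End_alg sc" "finite W" "\<And>G. good G \<Longrightarrow> W \<subseteq> G 1 \<Longrightarrow> raises G c P" for P W c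
    unfolding R_def using that by (intro CollectI conjI exI[of _ W] exI[of _ c]) auto
  have RE: "\<exists>W c. finite W \<and> (\<forall>G. good G \<longrightarrow> W \<subseteq> G 1 \<longrightarrow> raises G c P)" if "P \<in> R" for P
    using that unfolding R_def by simp
  have "poisson_diff_ops sc br \<subseteq> R"
    unfolding poisson_diff_ops_def
  proof (rule hull_minimal)
    have "(\<lambda>b. a * b) \<in> R" for a
      by (rule RI[of _ "{e a}" 1, OF mult_in_End _ raises_mult]) auto
    moreover have "br a \<in> R" for a
      by (rule RI[of _ "(\<lambda>k. e (br a (\<xi> k))) ` J" 2, OF br_in_End _ raises_br]) auto
    ultimately show "range (\<lambda>a x. a * x) \<union> range br \<subseteq> R" by auto
    show "R \<subseteq> End_alg sc \<and> is_subalgebra (fun_scale sc) (\<circ>) id R"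
      unfolding is_subalgebra_def
    proof (intro conjI ballI)
      show "R \<subseteq> End_alg sc" by (auto simp: R_def)
      have zero: "raises G c 0" for G c
        using Op.subspace_0[OF raises_subspace] by simp
      show "id \<in> R"
        by (rule RI[of _ "{}" 0, OF Op.unit_in_B]) (auto simp: raises_def)
      have ext: "\<exists>W c. finite W \<and> (\<forall>G. good G \<longrightarrow> W \<subseteq> G 1 \<longrightarrow> raises G c P \<and> raises G c Q)"
        if PR: "P \<in> R" and QR: "Q \<in> R" for P Q
      proof -
        obtain W c where W: "finite W" "\<forall>G. good G \<longrightarrow> W \<subseteq> G 1 \<longrightarrow> raises G c P"
          using RE[OF PR] by (elim exE conjE)
        obtain V d where V: "finite V" "\<forall>G. good G \<longrightarrow> V \<subseteq> G 1 \<longrightarrow> raises G d Q"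
          using RE[OF QR] by (elim exE conjE)
        show ?thesis
        proof (intro exI[of _ "W \<union> V"] exI[of _ "c + d"] conjI allI impI)
          fix G assume G: "good G" "W \<union> V \<subseteq> G 1"
          show "raises G (c + d) P" by (rule raises_mono[OF G(1) W(2)[rule_format]]) (use G in auto)
          show "raises G (c + d) Q" by (rule raises_mono[OF G(1) V(2)[rule_format]]) (use G in auto)
        qed (use W V in auto)
      qed
      show "P \<circ> Q \<in> R" if PQ: "P \<in> R" "Q \<in> R" for P Q
      proof -
        obtain W c where "finite W" "\<forall>G. good G \<longrightarrow> W \<subseteq> G 1 \<longrightarrow> raises G c P \<and> raises G c Q"
          using ext[OF PQ] by (elim exE conjE)
        moreover have "P \<circ> Q \<in> End_alg sc" using PQ Op.mul_closed by (simp add: R_def)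
        ultimately show ?thesis by (intro RI[of _ W "c + c"] raises_comp) auto
      qed
      show "Op.subspace R"
        unfolding Op.subspace_def
      proof (intro conjI ballI allI)
        show "0 \<in> R" by (rule RI[of _ "{}" 0, OF Op.subspace_0[OF Op.subspace_B] _ zero]) auto
        fix P assume P: "P \<in> R"
        obtain W c where W: "finite W" "\<forall>G. good G \<longrightarrow> W \<subseteq> G 1 \<longrightarrow> raises G c P"
          using RE[OF P] by (elim exE conjE)
        have "raises G c (fun_scale sc k P)" if "good G" "W \<subseteq> G 1" for G k
          using Op.subspace_scale[OF raises_subspace, of P G c k] W(2) that by simp
        moreover have "fun_scale sc k P \<in> End_alg sc" for k
          using P Op.subspace_scale[OF Op.subspace_B] by (simp add: R_def)
        ultimately show "fun_scale sc k P \<in> R" for k using W(1) by (intro RI[of _ W c])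
        fix Q assume Q: "Q \<in> R"
        obtain V d where V: "finite V" "\<forall>G. good G \<longrightarrow> V \<subseteq> G 1 \<longrightarrow> raises G d P \<and> raises G d Q"
          using ext[OF P Q] by (elim exE conjE)
        have "raises G d (P + Q)" if "good G" "V \<subseteq> G 1" for G
          using Op.subspace_add[OF raises_subspace, of P G d Q] V(2) that by simp
        moreover have "P + Q \<in> End_alg sc"
          using P Q Op.subspace_add[OF Op.subspace_B] by (simp add: R_def)
        ultimately show "P + Q \<in> R" using V(1) by (intro RI[of _ V d])
      qed
    qed
  qed
  then show ?thesis using assms by (auto simp: R_def)
qed

text \<open>The ring \<open>K[x, 1/s]\<close> contains \<open>W\<close> and is stable under the frame once \<open>s\<close> is a common
  denominator of \<open>W\<close> and of the elements \<open>\<partial>\<^sub>k x\<^sub>j\<close>.\<close>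

lemma good_filtration_exists:
  assumes alg: "\<And>z. \<exists>p. p \<noteq> 0 \<and> coeffs_in (polys J') p \<and> poly p z = 0" and W: "finite W"
  shows "\<exists>G C. good G \<and> W \<subseteq> G 1 \<and>
    (\<forall>N. \<exists>S. finite S \<and> card S \<le> C * (N + 1) ^ card J' \<and> G N \<subseteq> ks.span S)"
proof -
  define Z where "Z = W \<union> (\<Union>k. range (\<lambda>j. dd k (x j)))"
  have "finite Z" using W by (simp add: Z_def)
  then have "\<exists>s\<in>polys UNIV. s \<noteq> 0 \<and> (\<forall>z\<in>Z. s * z \<in> polys UNIV)"
    by (rule common_denominator[OF subring_polys frac])
  then obtain s where s: "s \<in> polys UNIV" "s \<noteq> 0" "\<forall>z\<in>Z. s * z \<in> polys UNIV"
    by (elim bexE conjE)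
  define V where "V = insert (1 / s) (range x)"
  have fV: "finite V" by (simp add: V_def)
  define B where "B = (\<Union>N. alg.filt V N)"
  have memB: "u \<in> B" if "u \<in> alg.filt V N" for u N using that by (auto simp: B_def)
  have B: "subring B"
    unfolding subring_def
  proof (intro conjI allI ballI)
    show "\<kappa> c \<in> B" for c
      using ks.subspace_scale[OF alg.subspace_filt alg.unit_in_filt, of c V 0] by (intro memB) (simp add: ks_def)
    fix a b assume "a \<in> B" "b \<in> B"
    then obtain M N where MN: "a \<in> alg.filt V M" "b \<in> alg.filt V N" by (auto simp: B_def)
    have "a \<in> alg.filt V (M + N)" "b \<in> alg.filt V (M + N)"
      using MN alg.filt_mono[of M "M + N" V] alg.filt_mono[of N "M + N" V] by auto
    then show "a + b \<in> B" by (intro memB ks.subspace_add[OF alg.subspace_filt])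
    show "a * b \<in> B" using alg.filt_mul[OF _ MN] by (intro memB) simp
  qed
  note sB = subring_simps[OF B]
  have VB: "V \<subseteq> B" using memB[OF alg.gen_in_filt] by auto
  then have xB: "x j \<in> B" and isB: "1 / s \<in> B" for j by (auto simp: V_def)
  have pB: "polys UNIV \<subseteq> B" by (rule polys_minimal[OF B xB])
  have ZB: "z \<in> B" if "z \<in> Z" for z
  proof -
    have "(s * z) * (1 / s) \<in> B" using s(3)[rule_format, OF that] pB isB sB(5) by blast
    then show ?thesis using s(2) by simp
  qed
  have ddp: "dd k p \<in> B" if "p \<in> polys UNIV" for p k
  proof -
    have "subring {p \<in> B. dd k p \<in> B}"
      by (auto simp: subring_def sB der_simps[OF dd_der])
    then have "polys UNIV \<subseteq> {p \<in> B. dd k p \<in> B}"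
    proof (rule polys_minimal)
      fix j
      show "x j \<in> {p \<in> B. dd k p \<in> B}" using xB ZB[of "dd k (x j)"] by (auto simp: Z_def)
    qed
    then show ?thesis using that by blast
  qed
  have ddV: "dd k v \<in> B" if v: "v \<in> V" for k v
  proof (cases "v = 1 / s")
    case True
    have "dd k (1 / s) = - ((1 / s) * (1 / s) * dd k s)"
      using der_divide[OF dd_der s(2), of k 1] by (simp add: der_simps(3)[OF dd_der])
    also have "\<dots> \<in> B" by (intro sB(5,6) isB ddp s(1))
    finally show ?thesis using True by simp
  next
    case False
    then obtain j where "v = x j" using v by (auto simp: V_def)
    then show ?thesis using ZB[of "dd k (x j)"] by (auto simp: Z_def)
  qed
  define Y where "Y = W \<union> (\<Union>k. dd k ` V)"
  have "Y \<subseteq> B" using ZB ddV by (auto simp: Y_def Z_def)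
  then have "\<forall>y\<in>Y. \<exists>N. y \<in> alg.filt V N" by (auto simp: B_def)
  then obtain n where n: "\<And>y. y \<in> Y \<Longrightarrow> y \<in> alg.filt V (n y)" by metis
  \<comment> \<open>A common level for the elements of \<open>W\<close> and all derivatives of the
    generators \<open>V\<close>.\<close>
  define c where "c = Suc (sum n Y)"
  have fY: "finite Y" using W fV by (simp add: Y_def)
  have Yc: "y \<in> alg.filt V c" if "y \<in> Y" for y
  proof -
    have "n y \<le> c" using member_le_sum[of y Y n] that fY by (simp add: c_def)
    then show ?thesis using n[OF that] alg.filt_mono by blast
  qed
  \<comment> \<open>Membership of \<open>u\<close> itself is carried along because the Leibniz term
    \<open>u * dd k v\<close> needs it.\<close>
  have dd_filt: "alg.filt V N \<subseteq> {u \<in> alg.filt V N. dd k u \<in> alg.filt V (N + c)}" for N k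
  proof (rule alg.filt_minimal)
    show "ks.subspace {u \<in> alg.filt V N. dd k u \<in> alg.filt V (N + c)}" for N
      using alg.subspace_filt[of V N] alg.subspace_filt[of V "N + c"] unfolding ks.subspace_def
      by (auto simp: der_simps(2,4)[OF dd_der] der_ks[OF dd_der])
    show "{u \<in> alg.filt V M. dd k u \<in> alg.filt V (M + c)} \<subseteq> {u \<in> alg.filt V N. dd k u \<in> alg.filt V (N + c)}"
      if "M \<le> N" for M N
      using alg.filt_mono[OF that, of V] alg.filt_mono[of "M + c" "N + c" V] that by auto
    show "1 \<in> {u \<in> alg.filt V 0. dd k u \<in> alg.filt V (0 + c)}"
      using alg.unit_in_filt ks.subspace_0[OF alg.subspace_filt] by (simp add: der_simps(3)[OF dd_der])
    fix N u v assume u: "u \<in> {u \<in> alg.filt V N. dd k u \<in> alg.filt V (N + c)}" and v: "v \<in> V"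
    have "u * v \<in> alg.filt V (N + 1)" using u alg.gen_in_filt[OF _ v] by (intro alg.filt_mul) auto
    moreover have "dd k u * v \<in> alg.filt V ((N + c) + 1)"
      using u alg.gen_in_filt[OF _ v] by (intro alg.filt_mul) auto
    moreover have "u * dd k v \<in> alg.filt V (N + c)"
      using u v Yc[of "dd k v"] by (intro alg.filt_mul) (auto simp: Y_def)
    then have "u * dd k v \<in> alg.filt V ((N + c) + 1)"
      using alg.filt_mono[of "N + c" "(N + c) + 1" V] by auto
    ultimately show "u * v \<in> {u \<in> alg.filt V (Suc N). dd k u \<in> alg.filt V (Suc N + c)}"
      using ks.subspace_add[OF alg.subspace_filt] by (simp add: der_simps(5)[OF dd_der])
  qed simp
  \<comment> \<open>A derivation raises the level in \<open>V\<close> by at most \<open>c\<close>;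
    running through the filtration \<open>c\<close> times faster makes that a single step and puts
    \<open>W\<close> into level 1.\<close>
  define G where "G N = alg.filt V (c * N)" for N
  have "good G"
    unfolding good_def G_def
  proof (intro conjI allI impI)
    show "alg.filt V (c * M) \<subseteq> alg.filt V (c * N)" if "M \<le> N" for M N
      using that by (intro alg.filt_mono) simp
    show "u * v \<in> alg.filt V (c * (M + N))" if "u \<in> alg.filt V (c * M)" "v \<in> alg.filt V (c * N)" for M N u v
      using alg.filt_mul[OF _ that] by (simp add: distrib_left)
    show "dd k u \<in> alg.filt V (c * Suc N)" if "u \<in> alg.filt V (c * N)" for k N u
      using dd_filt[of "c * N" k] that by (auto simp: add.commute)
  qed (auto simp: alg.subspace_filt alg.unit_in_filt)
  moreover have "W \<subseteq> G 1" using Yc by (auto simp: G_def Y_def)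
  moreover have "\<exists>C. \<forall>N. \<exists>S. finite S \<and> card S \<le> C * (N + 1) ^ card J' \<and> G N \<subseteq> ks.span S"
  proof -
    obtain C where C: "\<And>N. \<exists>S. finite S \<and> card S \<le> C * (N + 1) ^ card J' \<and> alg.filt V N \<subseteq> ks.span S"
      using growth_bound[OF alg fV] by blast
    have "\<exists>S. finite S \<and> card S \<le> (C * (c + 1) ^ card J') * (N + 1) ^ card J' \<and> G N \<subseteq> ks.span S" for N
    proof -
      obtain S where S: "finite S" "card S \<le> C * (c * N + 1) ^ card J'" "G N \<subseteq> ks.span S"
        using C[of "c * N"] unfolding G_def by blast
      note S(2)
      also have "C * (c * N + 1) ^ card J' \<le> C * ((c + 1) * (N + 1)) ^ card J'"
        by (intro mult_left_mono power_mono) (auto simp: algebra_simps)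
      finally show ?thesis using S(1,3) by (auto simp only: power_mult_distrib mult.assoc)
    qed
    then show ?thesis by blast
  qed
  ultimately show ?thesis by blast
qed

text \<open>\<open>J'\<close> and \<open>J\<close> are independent data: over the coordinates in
  \<open>J'\<close> the field is algebraic, which counts coefficients, while \<open>J\<close>
  indexes the Hamiltonian frame and counts orders of differentiation.\<close>

theorem GK_operators_le:
  assumes alg: "\<And>z. \<exists>p. p \<noteq> 0 \<and> coeffs_in (polys J') p \<and> poly p z = 0"
  shows "GKdim (fun_scale sc) (\<circ>) id (poisson_diff_ops sc br) \<le> ereal (real (card J' + card J))"
proof (rule Op.GKdim_le[OF poisson_diff_ops_sub_End])
  fix F assume F: "finite F" "F \<subseteq> poisson_diff_ops sc br"
  have "\<forall>P\<in>F. \<exists>W c. finite W \<and> (\<forall>G. good G \<longrightarrow> W \<subseteq> G 1 \<longrightarrow> raises G c P)"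
    using operators_raise F(2) by blast
  then obtain W c where Wc: "\<And>P. P \<in> F \<Longrightarrow> finite (W P)"
    "\<And>P G. P \<in> F \<Longrightarrow> good G \<Longrightarrow> W P \<subseteq> G 1 \<Longrightarrow> raises G (c P) P" by metis
  have "finite (\<Union>P\<in>F. W P)" using F(1) Wc(1) by blast
  then obtain G C where G: "good G" "(\<Union>P\<in>F. W P) \<subseteq> G 1"
    and C: "\<And>N. \<exists>S. finite S \<and> card S \<le> C * (N + 1) ^ card J' \<and> G N \<subseteq> ks.span S"
    using good_filtration_exists[OF alg] by metis
  define d where "d = sum c F"
  have raise: "raises G d P" if "P \<in> F" for P
  proof (rule raises_mono[OF G(1)])
    show "raises G (c P) P" using Wc(2)[OF that G(1)] G(2) that by blast
    show "c P \<le> d" using member_le_sum[of P F c] that F(1) by (simp add: d_def)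
  qed
  have FE: "F \<subseteq> End_alg sc" using F(2) poisson_diff_ops_sub_End by blast
  have filt: "Op.filt F N \<subseteq> {P. raises G (N * d) P}" for N
  proof (rule Op.filt_minimal[OF FE raises_subspace])
    show "{P. raises G (M * d) P} \<subseteq> {P. raises G (N * d) P}" if "M \<le> N" for M N
      using raises_mono[OF G(1)] that by auto
    show "id \<in> {P. raises G (0 * d) P}" by (simp add: raises_def)
    show "P \<circ> Q \<in> {P. raises G (Suc N * d) P}" if "P \<in> {P. raises G (N * d) P}" "Q \<in> F" for N P Q
      using raises_comp[of G "N * d" P d Q] raise[OF that(2)] that(1) by (simp add: add.commute)
  qed
  have "Op.dim (Op.filt F N) \<le> (C * (d + 1) ^ (card J' + card J)) * (N + 1) ^ (card J' + card J)" for N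
  proof -
    obtain S where S: "finite S" "card S \<le> C * (N * d + 1) ^ card J'" "G (N * d) \<subseteq> ks.span S"
      using C by blast
    define Y where "Y = (\<lambda>(w, \<alpha>) f. w * Dm \<alpha> (e f)) ` (S \<times> multi_indices J (N * d))"
    have fY: "finite Y" using S(1) by (simp add: Y_def multi_indices_finite_card)
    have gens: "gens G (N * d) \<subseteq> FF.span Y"
    proof
      fix H assume "H \<in> gens G (N * d)"
      then obtain w \<alpha> where H: "H = (\<lambda>f. w * Dm \<alpha> (e f))" "w \<in> G (N * d)" "\<alpha> \<in> multi_indices J (N * d)"
        by (auto simp: gens_def)
      have "ks.span S \<subseteq> {w. (\<lambda>f. w * Dm \<alpha> (e f)) \<in> FF.span Y}"
      proof (rule ks.span_minimal)
        show "S \<subseteq> {w. (\<lambda>f. w * Dm \<alpha> (e f)) \<in> FF.span Y}"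
          using H(3) by (auto simp: Y_def intro!: FF.span_base)
        show "ks.subspace {w. (\<lambda>f. w * Dm \<alpha> (e f)) \<in> FF.span Y}"
          unfolding ks.subspace_def
        proof (intro conjI ballI allI; clarsimp)
          show "(\<lambda>f. 0) \<in> FF.span Y" using FF.span_zero[of Y] by (simp add: zero_fun_def)
          fix u v assume u: "(\<lambda>f. u * Dm \<alpha> (e f)) \<in> FF.span Y"
          show "(\<lambda>f. ks c u * Dm \<alpha> (e f)) \<in> FF.span Y" for c
            using FF.span_scale[OF u, of c] by (simp add: fks_def ks_def mult.assoc)
          assume v: "(\<lambda>f. v * Dm \<alpha> (e f)) \<in> FF.span Y"
          show "(\<lambda>f. (u + v) * Dm \<alpha> (e f)) \<in> FF.span Y"
            using FF.span_add[OF u v] by (simp add: plus_fun_def distrib_right)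
        qed
      qed
      then show "H \<in> FF.span Y" using S(3) H by blast
    qed
    have base: "(\<lambda>f. e (id f)) \<in> FF.span (gens G 0)"
    proof (rule FF.span_base)
      have "1 \<in> G 0" using G(1) by (simp add: good_def)
      then have "(\<lambda>f. 1 * Dm {#} (e f)) \<in> gens G 0"
        unfolding gens_def multi_indices_def by (intro CollectI exI conjI refl) auto
      then show "(\<lambda>f. e (id f)) \<in> gens G 0" by simp
    qed
    \<comment> \<open>The identity sits at level 0, so applying \<open>raises\<close> to it places
      \<open>P\<close> itself at level \<open>N * d\<close>.\<close>
    have img: "(\<lambda>P f. e (P f)) ` Op.filt F N \<subseteq> FF.span Y"
    proof clarify
      fix P assume "P \<in> Op.filt F N"
      then have "raises G (N * d) P" using filt by blast
      then have "(\<lambda>f. e (P (id f))) \<in> FF.span (gens G (0 + N * d))" using base unfolding raises_def by blast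
      then show "(\<lambda>f. e (P f)) \<in> FF.span Y"
        using FF.span_minimal[OF gens FF.subspace_span] by auto
    qed
    have lin: "Vector_Spaces.linear (fun_scale sc) fks (\<lambda>P f. e (P f))"
      by (simp add: Vector_Spaces.linear_iff FF.vector_space_axioms Op.vector_space_axioms fun_eq_iff
        e_add e_sc fks_def ks_def fun_scale_def)
    have "inj (\<lambda>P f. e (P f))" by (rule injI) (auto simp: fun_eq_iff)
    then have "Op.dim (Op.filt F N) \<le> card Y" using dim_le_card_inj_image[OF lin _ img fY] by blast
    also have "\<dots> \<le> card (S \<times> multi_indices J (N * d))"
      unfolding Y_def by (rule card_image_le) (use S(1) in \<open>simp add: multi_indices_finite_card\<close>)
    also have "\<dots> \<le> (C * (N * d + 1) ^ card J') * (N * d + 1) ^ card J"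
      unfolding card_cartesian_product by (intro mult_mono S(2) multi_indices_finite_card(2)) auto
    also have "\<dots> = C * (N * d + 1) ^ (card J' + card J)" by (simp add: power_add)
    also have "\<dots> \<le> C * ((d + 1) * (N + 1)) ^ (card J' + card J)"
      by (intro mult_left_mono power_mono) (auto simp: algebra_simps)
    finally show ?thesis by (simp only: power_mult_distrib mult.assoc)
  qed
  then show "\<exists>K. \<forall>N. Op.dim (Op.filt F N) \<le> K * (N + 1) ^ (card J' + card J)" by blast
qed

end

section \<open>Lower growth bound for the Poisson differential operators\<close>

lemma sum_fun_apply: "(\<Sum>i\<in>I. H i) f = (\<Sum>i\<in>I. H i f)"
  by (induction I rule: infinite_finite_induct) simp_all

context poisson_frame
begin

lemma subring_fraction_e: "\<exists>p\<in>range e. \<exists>q\<in>range e. q \<noteq> 0 \<and> z = p / q"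
  using frac_e[of z] by force

lemma frame_denominator:
  "\<exists>g b. g \<noteq> 0 \<and> (\<forall>k z. e g * dd k z = (\<Sum>i\<in>UNIV. e (b k i) * ham (\<xi> i) z))"
proof -
  have "\<forall>k. \<exists>c. \<forall>z. dd k z = (\<Sum>i\<in>UNIV. c i * ham (\<xi> i) z)"
    using dd_ham by (simp add: ham_space_def)
  then obtain c where c: "\<And>k z. dd k z = (\<Sum>i\<in>UNIV. c k i * ham (\<xi> i) z)" by metis
  have "finite (\<Union>k. range (c k))" by simp
  from common_denominator[OF subring_range_e subring_fraction_e this]
  obtain s where s: "s \<in> range e" "s \<noteq> 0" "\<forall>z\<in>(\<Union>k. range (c k)). s * z \<in> range e"
    by (elim bexE conjE)
  then obtain g where g: "s = e g" "g \<noteq> 0" by auto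
  have "\<forall>k i. \<exists>b. e g * c k i = e b" using s(3) g(1) by blast
  then obtain b where b: "\<And>k i. e g * c k i = e (b k i)" by metis
  have "e g * dd k z = (\<Sum>i\<in>UNIV. e (b k i) * ham (\<xi> i) z)" for k z
    by (simp add: c sum_distrib_left mult.assoc flip: b)
  then show ?thesis using g(2) by blast
qed

lemma span_sub_poisson_diff_ops:
  assumes "\<And>B. B \<subseteq> End_alg sc \<Longrightarrow> is_subalgebra (fun_scale sc) (\<circ>) id B \<Longrightarrow>
    (\<And>a. (\<lambda>b. a * b) \<in> B) \<Longrightarrow> (\<And>a. br a \<in> B) \<Longrightarrow> F \<subseteq> B"
  shows "Op.span F \<subseteq> poisson_diff_ops sc br"
  unfolding poisson_diff_ops_def hull_def
proof (rule Inter_greatest, clarify)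
  fix P B assume B: "range (\<lambda>a x. a * x) \<union> range br \<subseteq> B" "B \<subseteq> End_alg sc"
    "is_subalgebra (fun_scale sc) (\<circ>) id B" and P: "P \<in> Op.span F"
  have "F \<subseteq> B" by (rule assms[OF B(2,3)]) (use B(1) in auto)
  moreover have "Op.subspace B" using B(3) by (simp add: is_subalgebra_def)
  ultimately show "P \<in> B" using P Op.span_minimal by blast
qed

text \<open>The operators \<open>g\<^bsup>2|\<alpha>|\<^esup> \<partial>\<^sup>\<alpha>\<close> lie in the filtration generated by \<open>g\<close>, \<open>g\<partial>\<^sub>k\<close> and
  \<open>g\<partial>\<^sub>k(g)\<close>, because
  \<open>g\<^bsup>2m+2\<^esup> \<partial>\<^sub>k \<partial>\<^sup>\<alpha> = g (g\<partial>\<^sub>k) g\<^bsup>2m\<^esup> \<partial>\<^sup>\<alpha> - 2m (g\<partial>\<^sub>k(g)) g\<^bsup>2m\<^esup> \<partial>\<^sup>\<alpha>\<close>.\<close>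

theorem GK_operators_ge:
  assumes "frame \<kappa> x J' dd'"
  shows "ereal (real (card J' + card J)) \<le> GKdim (fun_scale sc) (\<circ>) id (poisson_diff_ops sc br)"
proof -
  interpret N: frame \<kappa> x J' dd' by fact
  obtain g b where g: "g \<noteq> 0" and b: "\<And>k z. e g * dd k z = (\<Sum>i\<in>UNIV. e (b k i) * ham (\<xi> i) z)"
    using frame_denominator by metis
  \<comment> \<open>\<open>P k\<close> realises \<open>g\<close> times the k-th frame derivation as
    an operator on the algebra.\<close>
  define P where "P k f = (\<Sum>i\<in>UNIV. b k i * br (\<xi> i) f)" for k f
  have eP: "e (P k f) = e g * dd k (e f)" for k f
    by (simp add: P_def e_sum e_mult b ham(2))
  define F where "F = (\<lambda>j f. \<xi> j * f) ` J' \<union> {\<lambda>f. g * f} \<union> range P \<union> range (\<lambda>k f. P k g * f)"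
  have fF: "finite F" by (simp add: F_def)
  let ?V = "Op.span F"
  have PD: "?V \<subseteq> poisson_diff_ops sc br"
  proof (rule span_sub_poisson_diff_ops)
    fix B assume B: "B \<subseteq> End_alg sc" "is_subalgebra (fun_scale sc) (\<circ>) id B"
      and gen: "\<And>a. (\<lambda>b. a * b) \<in> B" "\<And>a. br a \<in> B"
    have B': "Op.subspace B" "\<And>S T. S \<in> B \<Longrightarrow> T \<in> B \<Longrightarrow> S \<circ> T \<in> B"
      using B(2) by (auto simp: is_subalgebra_def)
    have "P k \<in> B" for k
    proof -
      have "(\<lambda>f. \<Sum>i\<in>I. b k i * br (\<xi> i) f) \<in> B" for I
      proof (induction I rule: infinite_finite_induct)
        case (insert i I)
        have "(\<lambda>a. b k i * a) \<circ> br (\<xi> i) \<in> B" by (intro B'(2) gen)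
        then have "((\<lambda>a. b k i * a) \<circ> br (\<xi> i)) + (\<lambda>f. \<Sum>i\<in>I. b k i * br (\<xi> i) f) \<in> B"
          using Op.subspace_add[OF B'(1)] insert.IH by blast
        then show ?case using insert.hyps by (simp add: plus_fun_def comp_def)
      qed (use Op.subspace_0[OF B'(1)] in \<open>simp_all add: zero_fun_def\<close>)
      then show ?thesis by (simp add: P_def[abs_def])
    qed
    then show "F \<subseteq> B" using gen by (auto simp: F_def)
  qed
  have VE: "?V \<subseteq> End_alg sc" using PD poisson_diff_ops_sub_End by blast
  have FE: "F \<subseteq> End_alg sc" using VE Op.span_superset by blast
  define Fl where "Fl L = Op.filt ?V L" for L
  have Fl_sub: "Op.subspace (Fl L)" and Fl_id: "id \<in> Fl L" for L
    by (simp_all only: Fl_def Op.subspace_filt Op.unit_in_filt)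
  have gen: "T \<in> Fl 1" if "T \<in> F" for T
    using Op.gen_in_filt[OF VE Op.span_base[OF that]] by (simp only: Fl_def)
  have comp: "S \<circ> T \<in> Fl (M + L)" if "S \<in> Fl M" "T \<in> Fl L" for S T M L
    using Op.filt_mul[OF VE] that by (simp only: Fl_def)
  have mono: "T \<in> Fl L" if "T \<in> Fl M" "M \<le> L" for T M L
    using that Op.filt_mono[of M L ?V] unfolding Fl_def by blast
  have Y: "set_mset \<beta> \<subseteq> J' \<Longrightarrow> (\<lambda>f. monA \<beta> * f) \<in> Fl (size \<beta>)" for \<beta>
  proof (induction \<beta>)
    case empty
    have "(\<lambda>f. monA {#} * f) = id" by (simp add: fun_eq_iff monA_def)
    then show ?case using Fl_id[of 0] by (simp only: size_empty)
  next
    case (add k \<beta>)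
    then have k: "(\<lambda>f. \<xi> k * f) \<in> F" "set_mset \<beta> \<subseteq> J'" by (auto simp: F_def)
    have "(\<lambda>f. \<xi> k * f) \<circ> (\<lambda>f. monA \<beta> * f) \<in> Fl (1 + size \<beta>)"
      by (rule comp[OF gen[OF k(1)] add.IH[OF k(2)]])
    moreover have "(\<lambda>f. \<xi> k * f) \<circ> (\<lambda>f. monA \<beta> * f) = (\<lambda>f. monA (add_mset k \<beta>) * f)"
      by (simp add: fun_eq_iff monA_def mult.assoc)
    ultimately show ?case by (simp only: size_add_mset plus_1_eq_Suc)
  qed
  \<comment> \<open>Each derivative costs at most two generators, \<open>P k\<close> and
    \<open>g\<close>; the factor 3 leaves room.\<close>
  have Q: "\<exists>q\<in>Fl (3 * size \<alpha>). \<forall>f. e (q f) = e g ^ (2 * size \<alpha>) * Dm \<alpha> (e f)" for \<alpha>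
  proof (induction \<alpha>)
    case empty
    show ?case by (rule bexI[of _ id]) (use Fl_id in auto)
  next
    case (add k \<alpha>)
    then obtain q where q: "q \<in> Fl (3 * size \<alpha>)"
      "\<And>f. e (q f) = e g ^ (2 * size \<alpha>) * Dm \<alpha> (e f)" by blast
    let ?m = "2 * size \<alpha>"
    define q1 where "q1 = (\<lambda>f. g * f) \<circ> (P k \<circ> q)"
    define q2 where "q2 = fun_scale sc (- of_nat ?m) ((\<lambda>f. P k g * f) \<circ> q)"
    have "q1 \<in> Fl (1 + (1 + 3 * size \<alpha>))"
      unfolding q1_def by (intro comp gen q(1)) (auto simp: F_def)
    then have 1: "q1 \<in> Fl (3 * size (add_mset k \<alpha>))" by (rule mono) simp
    have "(\<lambda>f. P k g * f) \<circ> q \<in> Fl (1 + 3 * size \<alpha>)"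
      by (intro comp gen q(1)) (auto simp: F_def)
    then have "q2 \<in> Fl (1 + 3 * size \<alpha>)"
      unfolding q2_def by (rule Op.subspace_scale[OF Fl_sub])
    then have 2: "q2 \<in> Fl (3 * size (add_mset k \<alpha>))" by (rule mono) simp
    have "e ((q1 + q2) f) = e g ^ (2 * size (add_mset k \<alpha>)) * Dm (add_mset k \<alpha>) (e f)" for f
    proof -
      let ?D = "Dm \<alpha> (e f)" and ?G = "e g"
      \<comment> \<open>For \<open>?m = 0\<close> the exponent \<open>?m - 1\<close> is truncated,
        but then the factor \<open>of_nat ?m\<close> vanishes.\<close>
      have pow: "of_nat ?m * ?G ^ (?m - 1) * ?G = of_nat ?m * ?G ^ ?m"
        by (cases ?m) simp_all
      have "e (q1 f) = ?G * (?G * dd k (?G ^ ?m * ?D))"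
        by (simp add: q1_def e_mult eP q(2))
      also have "\<dots> = ?G * (of_nat ?m * ?G ^ (?m - 1) * ?G) * dd k ?G * ?D + ?G ^ (?m + 2) * dd k ?D"
        by (simp add: der_simps(5)[OF dd_der] der_power[OF dd_der] algebra_simps power2_eq_square
          power_add)
      also have "\<dots> = of_nat ?m * (?G * dd k ?G) * (?G ^ ?m * ?D) + ?G ^ (?m + 2) * dd k ?D"
        unfolding pow by (simp add: mult_ac)
      finally have e1: "e (q1 f) = of_nat ?m * (?G * dd k ?G) * (?G ^ ?m * ?D) + ?G ^ (?m + 2) * dd k ?D" .
      have e2: "e (q2 f) = - (of_nat ?m * (?G * dd k ?G) * (?G ^ ?m * ?D))"
        unfolding q2_def fun_scale_def e_sc \<kappa>_uminus \<kappa>_of_nat by (simp add: e_mult eP q(2) mult_ac)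
      have "e ((q1 + q2) f) = e (q1 f) + e (q2 f)" by (simp add: e_add)
      then show ?thesis unfolding e1 e2 by (simp add: Dm_add power_add power2_eq_square)
    qed
    then show ?case using Op.subspace_add[OF Fl_sub 1 2] by blast
  qed
  then obtain q where q: "\<And>\<alpha>. q \<alpha> \<in> Fl (3 * size \<alpha>)"
    "\<And>\<alpha> f. e (q \<alpha> f) = e g ^ (2 * size \<alpha>) * Dm \<alpha> (e f)" by metis
  \<comment> \<open>Coordinate monomials contribute degree up to \<open>L * card J'\<close>, the
    operators \<open>q \<alpha>\<close> level up to \<open>3 * L * card J\<close>; the 1 keeps the
    constant positive.\<close>
  let ?c = "card J' + 3 * card J + 1"
  show ?thesis
  proof (rule Op.GKdim_ge[OF poisson_diff_ops_sub_End fF PD, where c = ?c])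
    fix L
    let ?I1 = "multi_indices J' (L * card J')" and ?I2 = "multi_indices J (L * card J)"
    let ?v = "\<lambda>(\<beta>, \<alpha>). (\<lambda>f. monA \<beta> * f) \<circ> q \<alpha>"
    have "L ^ (card J' + card J) \<le> (L + 1) ^ card J' * (L + 1) ^ card J"
      unfolding power_add by (intro mult_mono power_mono) auto
    also have "\<dots> \<le> card ?I1 * card ?I2" by (intro mult_mono multi_indices_card_ge) auto
    also have "\<dots> = card (?I1 \<times> ?I2)" by (simp add: card_cartesian_product)
    also have "\<dots> \<le> Op.dim (Op.filt ?V (?c * L))"
    proof -
      obtain S where S: "finite S" "Op.filt ?V (?c * L) \<subseteq> Op.span S"
        using Op.filt_finite_dim[OF FE fF, of "?c * L"] Op.filt_span_eq[OF FE] by auto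
      show ?thesis
      proof (rule Op.card_le_dim_family[where v = ?v, OF _ _ S(2,1)])
        show "finite (?I1 \<times> ?I2)" by (simp add: multi_indices_finite_card)
        show "?v ` (?I1 \<times> ?I2) \<subseteq> Op.filt ?V (?c * L)"
        proof clarify
          fix \<beta> \<alpha> assume \<beta>: "\<beta> \<in> ?I1" and \<alpha>: "\<alpha> \<in> ?I2"
          have "(\<lambda>f. monA \<beta> * f) \<circ> q \<alpha> \<in> Fl (size \<beta> + 3 * size \<alpha>)"
            using \<beta> by (intro comp Y q(1)) (simp add: multi_indices_def)
          moreover have "size \<beta> + 3 * size \<alpha> \<le> ?c * L"
            using \<beta> \<alpha> by (simp add: multi_indices_def algebra_simps)
          ultimately show "(\<lambda>f. monA \<beta> * f) \<circ> q \<alpha> \<in> Op.filt ?V (?c * L)"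
            unfolding Fl_def[symmetric] by (rule mono)
        qed
        fix c p assume sum: "(\<Sum>p\<in>?I1 \<times> ?I2. fun_scale sc (c p) (?v p)) = 0" and p: "p \<in> ?I1 \<times> ?I2"
        obtain \<beta> \<alpha> where p': "p = (\<beta>, \<alpha>)" "\<beta> \<in> ?I1" "\<alpha> \<in> ?I2" using p by blast
        \<comment> \<open>Independence in two stages. Collected by \<open>\<alpha>\<close>, the
          relation has field coefficients \<open>a \<alpha>\<close>, which
          \<open>Dm_independent\<close> kills; once the power of \<open>g\<close> is cancelled, the
          frame on \<open>J'\<close> separates the \<open>\<beta>\<close>.\<close>
        define a where "a \<alpha> = e g ^ (2 * size \<alpha>) * (\<Sum>\<beta>\<in>?I1. ks (c (\<beta>, \<alpha>)) (mon \<beta>))" for \<alpha>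
        have "(\<Sum>\<alpha>\<in>?I2. a \<alpha> * Dm \<alpha> (mon \<gamma>)) = 0" for \<gamma>
        proof -
          have "0 = e ((\<Sum>p\<in>?I1 \<times> ?I2. fun_scale sc (c p) (?v p)) (monA \<gamma>))"
            unfolding sum by simp
          also have "\<dots> = (\<Sum>p\<in>?I1 \<times> ?I2. e (fun_scale sc (c p) (?v p) (monA \<gamma>)))"
            by (simp add: sum_fun_apply e_sum)
          also have "\<dots> = (\<Sum>(\<beta>, \<alpha>)\<in>?I1 \<times> ?I2. ks (c (\<beta>, \<alpha>)) (mon \<beta>) * e g ^ (2 * size \<alpha>) * Dm \<alpha> (mon \<gamma>))"
            by (intro sum.cong) (auto simp: fun_scale_def e_sc e_mult e_monA q(2) ks_def mult_ac)
          also have "\<dots> = (\<Sum>\<alpha>\<in>?I2. \<Sum>\<beta>\<in>?I1. ks (c (\<beta>, \<alpha>)) (mon \<beta>) * e g ^ (2 * size \<alpha>) * Dm \<alpha> (mon \<gamma>))"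
            by (subst sum.swap) (simp add: sum.cartesian_product)
          also have "\<dots> = (\<Sum>\<alpha>\<in>?I2. a \<alpha> * Dm \<alpha> (mon \<gamma>))"
            by (simp add: a_def sum_distrib_left sum_distrib_right mult_ac)
          finally show ?thesis by simp
        qed
        from Dm_independent[OF multi_indices_finite_card(1) _ this p'(3)]
        have "a \<alpha> = 0" by (auto simp: multi_indices_def)
        then have "(\<Sum>\<beta>\<in>?I1. ks (c (\<beta>, \<alpha>)) (mon \<beta>)) = 0" using g by (simp add: a_def)
        from N.mon_independent[OF multi_indices_finite_card(1) _ this p'(2)]
        show "c p = 0" unfolding p'(1) by (auto simp: multi_indices_def)
      qed
    qed
    finally show "L ^ (card J' + card J) \<le> Op.dim (Op.filt ?V (?c * L))" .
  qed simp
qed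

end

text \<open>Two frames are used, one for all derivations and one for the Hamiltonian ones. Their
  coordinate sets may be unrelated: only the sizes enter, and these are dimensions of spaces of
  value vectors.\<close>

theorem (in poisson_alg) GK_dimensions:
  defines "t \<equiv> vec.dim ((\<lambda>D. (\<chi> j. D (x j)) :: 'f^'n) ` {D. der D})"
    and "d \<equiv> vec.dim ((\<lambda>D. (\<chi> j. D (x j)) :: 'f^'n) ` ham_space)"
  shows "GKdim sc (*) 1 UNIV = ereal (real t)"
    and "GKdim (fun_scale sc) (\<circ>) id (poisson_diff_ops sc br) = ereal (real (t + d))"
proof -
  have "\<exists>J dd. frame \<kappa> x J dd \<and> (\<forall>k. dd k \<in> {D. der D}) \<and>
      (\<forall>D\<in>{D. der D}. \<forall>z. D z = (\<Sum>k\<in>J. D (x k) * dd k z)) \<and> card J = t"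
    unfolding t_def
    by (rule frame_exists) (auto simp: der_zero der_add der_scale der_commutator)
  then obtain J1 d1 where 1: "frame \<kappa> x J1 d1"
    "\<forall>D\<in>{D. der D}. \<forall>z. D z = (\<Sum>k\<in>J1. D (x k) * d1 k z)" "card J1 = t"
    by (elim exE conjE)
  have "\<exists>J dd. frame \<kappa> x J dd \<and> (\<forall>k. dd k \<in> ham_space) \<and>
      (\<forall>D\<in>ham_space. \<forall>z. D z = (\<Sum>k\<in>J. D (x k) * dd k z)) \<and> card J = d"
    unfolding d_def
    by (rule frame_exists) (fact ham_space_der ham_space_zero ham_space_add ham_space_scale
      ham_space_commutator)+
  then obtain J2 d2 where 2: "frame \<kappa> x J2 d2" "\<forall>k. d2 k \<in> ham_space"
    "\<forall>D\<in>ham_space. \<forall>z. D z = (\<Sum>k\<in>J2. D (x k) * d2 k z)" "card J2 = d"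
    by (elim exE conjE)
  have alg: "\<exists>p. p \<noteq> 0 \<and> coeffs_in (polys J1) p \<and> poly p z = 0" for z
  proof (rule algebraic_if_no_derivation)
    fix D z assume D: "der D" "\<forall>j\<in>J1. D (x j) = 0"
    have "D z = (\<Sum>k\<in>J1. D (x k) * d1 k z)" using 1(2) D(1) by blast
    then show "D z = 0" using D(2) by simp
  qed
  show "GKdim sc (*) 1 UNIV = ereal (real t)"
    using GK_algebra_le[OF alg] GK_algebra_ge[OF 1(1)] 1(3) by simp
  interpret F: frame \<kappa> x J2 d2 by fact
  interpret F: poisson_frame \<kappa> x e sc \<xi> br J2 d2
    by unfold_locales (use 2(2,3) ham_in_ham_space in blast)+
  show "GKdim (fun_scale sc) (\<circ>) id (poisson_diff_ops sc br) = ereal (real (t + d))"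
    using F.GK_operators_le[OF alg] F.GK_operators_ge[OF 1(1)] 1(3) 2(4) by simp
qed

section \<open>The Jacobian matrix and derivations\<close>

text \<open>Rank-nullity read off from an echelon basis of the span of \<open>W\<close>: the pivots
  \<open>J\<close> count the rank, and the solutions are parametrised by the coordinates outside
  \<open>J\<close>.\<close>

lemma dim_annihilator:
  fixes W :: "('f::field^'n) set"
  shows "vec.dim {v. \<forall>w\<in>W. (\<Sum>j\<in>UNIV. w $ j * v $ j) = 0} + vec.dim W = CARD('n)"
proof -
  obtain J and \<rho> :: "'n \<Rightarrow> 'f^'n" where \<rho>: "\<And>k. k \<in> J \<Longrightarrow> \<rho> k \<in> vec.span W"
    "\<And>k l. k \<in> J \<Longrightarrow> l \<in> J \<Longrightarrow> \<rho> k $ l = (if k = l then 1 else 0)"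
    "\<And>v. v \<in> vec.span W \<Longrightarrow> v = (\<Sum>k\<in>J. v $ k *s \<rho> k)" "card J = vec.dim (vec.span W)"
    by (rule subspace_coordinates[OF vec.subspace_span]) (rule that)
  define V :: "('f^'n) set" where "V = {v. \<forall>w\<in>W. (\<Sum>j\<in>UNIV. w $ j * v $ j) = 0}"
  have subV: "vec.subspace {w. (\<Sum>j\<in>UNIV. w $ j * v $ j) = 0}" for v :: "'f^'n"
    unfolding vec.subspace_def
    by (simp add: distrib_right sum.distrib mult.assoc flip: sum_distrib_left)
  have span: "(\<Sum>j\<in>UNIV. w $ j * v $ j) = 0" if "v \<in> V" "w \<in> vec.span W" for v w :: "'f^'n"
  proof -
    have "W \<subseteq> {w. (\<Sum>j\<in>UNIV. w $ j * v $ j) = 0}" using that(1) by (auto simp: V_def)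
    then show ?thesis using vec.span_minimal[OF _ subV] that(2) by blast
  qed
  have split: "(\<Sum>j\<in>UNIV. g j) = (\<Sum>j\<in>J. g j) + (\<Sum>j\<in>-J. g j)" for g :: "'n \<Rightarrow> 'f"
    by (simp add: sum.subset_diff[of J UNIV] Compl_eq_Diff_UNIV add.commute)
  have pivot: "v $ k = - (\<Sum>j\<in>-J. \<rho> k $ j * v $ j)" if "v \<in> V" "k \<in> J" for v :: "'f^'n" and k
  proof -
    have "0 = (\<Sum>j\<in>J. \<rho> k $ j * v $ j) + (\<Sum>j\<in>-J. \<rho> k $ j * v $ j)"
      using span[OF that(1) \<rho>(1)[OF that(2)]] split by simp
    also have "(\<Sum>j\<in>J. \<rho> k $ j * v $ j) = v $ k"
      using that(2) \<rho>(2) by (simp add: if_distrib[of "\<lambda>a. a * _"] cong: if_cong)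
    finally show ?thesis by (simp add: eq_neg_iff_add_eq_0)
  qed
  \<comment> \<open>The solution whose free coordinate \<open>i\<close> is 1 and whose other free
    coordinates are 0; the pivot entries are then forced.\<close>
  define \<tau> :: "'n \<Rightarrow> 'f^'n" where "\<tau> i = (\<chi> l. if l \<in> J then - \<rho> l $ i else if l = i then 1 else 0)" for i
  have \<tau>V: "\<tau> i \<in> V" if i: "i \<in> - J" for i
    unfolding V_def
  proof (intro CollectI ballI)
    fix w :: "'f^'n" assume "w \<in> W"
    then have w: "w = (\<Sum>k\<in>J. w $ k *s \<rho> k)" by (intro \<rho>(3) vec.span_base)
    have "w $ i = (\<Sum>k\<in>J. w $ k *s \<rho> k) $ i" using w by (rule arg_cong)
    then have wi: "w $ i = (\<Sum>k\<in>J. w $ k * \<rho> k $ i)"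
      by (simp only: sum_component vector_smult_component)
    have "(\<Sum>j\<in>UNIV. w $ j * \<tau> i $ j) = (\<Sum>j\<in>J. w $ j * \<tau> i $ j) + (\<Sum>j\<in>-J. w $ j * \<tau> i $ j)"
      by (rule split)
    also have "(\<Sum>j\<in>J. w $ j * \<tau> i $ j) = - w $ i"
      unfolding wi by (simp add: \<tau>_def sum_negf)
    also have "(\<Sum>j\<in>-J. w $ j * \<tau> i $ j) = (\<Sum>j\<in>-J. if j = i then w $ i else 0)"
      by (intro sum.cong) (auto simp: \<tau>_def)
    also have "\<dots> = w $ i" using i by simp
    finally show "(\<Sum>j\<in>UNIV. w $ j * \<tau> i $ j) = 0" by simp
  qed
  have comb: "(\<Sum>i\<in>-J. c i *s \<tau> i) $ l = (if l \<in> J then - (\<Sum>i\<in>-J. \<rho> l $ i * c i) else c l)" for c l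
  proof (cases "l \<in> J")
    case True
    then show ?thesis by (simp add: sum_component \<tau>_def sum_negf mult.commute)
  next
    case False
    have "(\<Sum>i\<in>-J. c i *s \<tau> i) $ l = (\<Sum>i\<in>-J. if i = l then c l else 0)"
      unfolding sum_component using False by (intro sum.cong) (auto simp: \<tau>_def)
    then show ?thesis using False by simp
  qed
  have sub: "V \<subseteq> vec.span (\<tau> ` (- J))"
  proof
    fix v :: "'f^'n" assume v: "v \<in> V"
    have "v = (\<Sum>i\<in>-J. v $ i *s \<tau> i)"
      unfolding vec_eq_iff comb using pivot[OF v] by simp
    also have "\<dots> \<in> vec.span (\<tau> ` (- J))"
      by (intro vec.span_sum vec.span_scale vec.span_base) auto
    finally show "v \<in> vec.span (\<tau> ` (- J))" .
  qed
  have "vec.dim V \<le> card (\<tau> ` (- J))" by (rule vec.dim_le_card[OF sub]) simp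
  also have "\<dots> \<le> card (- J)" by (rule card_image_le) simp
  finally have "vec.dim V \<le> card (- J)" .
  moreover have "card (- J) \<le> vec.dim V"
  proof (rule vec.card_le_dim_family[OF _ _ sub])
    show "\<tau> ` (- J) \<subseteq> V" using \<tau>V by blast
    fix c i assume "(\<Sum>i\<in>-J. c i *s \<tau> i) = 0" "i \<in> - J"
    then show "c i = 0" using comb[of c i] by simp
  qed auto
  moreover have "card (- J) + card J = CARD('n)"
    using card_Un_disjoint[of "- J" J] by simp
  ultimately show ?thesis using \<rho>(4) unfolding V_def by simp
qed

section \<open>Formal partial derivatives of polynomials\<close>

lemma poly_mapping_single_induct:
  assumes single: "\<And>u c. P (Poly_Mapping.single u c)" and add: "\<And>p q. P p \<Longrightarrow> P q \<Longrightarrow> P (p + q)"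
  shows "P (p :: 'a \<Rightarrow>\<^sub>0 'b::comm_monoid_add)"
proof -
  have "P (\<Sum>u\<in>A. Poly_Mapping.single u (Poly_Mapping.lookup p u))" for A
    by (induction A rule: infinite_finite_induct)
      (use single[of undefined 0] in \<open>auto intro: single add\<close>)
  moreover have "(\<Sum>u\<in>Poly_Mapping.keys p. Poly_Mapping.single u (Poly_Mapping.lookup p u)) = p"
    by (rule poly_mapping_eqI) (auto simp: lookup_sum lookup_single when_def in_keys_iff)
  ultimately show ?thesis by metis
qed

lemma mpoly_ring_induct:
  assumes const: "\<And>c. P (pconst c)" and var: "\<And>i. P (pvar i)"
    and add: "\<And>p q. P p \<Longrightarrow> P q \<Longrightarrow> P (p + q)" and mult: "\<And>p q. P p \<Longrightarrow> P q \<Longrightarrow> P (p * q)"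
  shows "P (p :: ('n::finite, 'k::comm_ring_1) mpoly)"
proof (rule poly_mapping_single_induct[of P, OF _ add])
  fix u :: "'n \<Rightarrow>\<^sub>0 nat" and c :: 'k
  show "P (Poly_Mapping.single u c)"
  proof (induction "\<Sum>i\<in>UNIV. Poly_Mapping.lookup u i" arbitrary: u rule: less_induct)
    case less
    show ?case
    proof (cases "u = 0")
      case True
      then show ?thesis using const[of c] by (simp add: pconst_def)
    next
      case False
      then obtain i where i: "Poly_Mapping.lookup u i \<noteq> 0" by (metis lookup_zero poly_mapping_eqI)
      define v where "v = u - Poly_Mapping.single i 1"
      have u: "u = Poly_Mapping.single i 1 + v"
        unfolding v_def using i
        by (intro poly_mapping_eqI) (auto simp: lookup_add lookup_minus lookup_single when_def)
      have "(\<Sum>i\<in>UNIV. Poly_Mapping.lookup v i) < (\<Sum>i\<in>UNIV. Poly_Mapping.lookup u i)"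
        by (simp add: u lookup_add sum.distrib lookup_single when_def)
      then have "P (Poly_Mapping.single v c)" by (rule less)
      then have "P (pvar i * Poly_Mapping.single v c)" using var by (rule mult[rotated])
      then show ?thesis by (simp add: pvar_def mult_single u)
    qed
  qed
qed

lemma pdiff_eq_sum:
  assumes "finite A" "Poly_Mapping.keys p \<subseteq> A"
  shows "pdiff j p = (\<Sum>u\<in>A. Poly_Mapping.single (u - Poly_Mapping.single j 1)
    (of_nat (Poly_Mapping.lookup u j) * Poly_Mapping.lookup p u))"
  unfolding pdiff_def by (rule sum.mono_neutral_left) (use assms in \<open>auto simp: in_keys_iff\<close>)

lemma pdiff_add: "pdiff j (p + q) = pdiff j p + pdiff j q"
proof -
  let ?A = "Poly_Mapping.keys p \<union> Poly_Mapping.keys q"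
  have "Poly_Mapping.keys (p + q) \<subseteq> ?A" by (rule keys_add)
  then show ?thesis
    by (simp add: pdiff_eq_sum[of ?A] lookup_add distrib_left single_add sum.distrib)
qed

lemma pdiff_single: "pdiff j (Poly_Mapping.single u c) =
  Poly_Mapping.single (u - Poly_Mapping.single j 1) (of_nat (Poly_Mapping.lookup u j) * c)"
  by (simp add: pdiff_eq_sum[of "{u}"])

lemma pdiff_pconst: "pdiff j (pconst c) = 0"
  by (simp add: pconst_def pdiff_single)

lemma pdiff_pvar: "pdiff j (pvar i) = (if i = j then 1 else 0)"
  by (simp add: pvar_def pdiff_single lookup_single)

text \<open>Both sides are biadditive, so monomials suffice. An exponent truncated at 0 occurs only
  beside a zero coefficient, which is what the case split sorts out.\<close>

lemma pdiff_mult: "pdiff j (p * q) = pdiff j p * q + p * pdiff j q"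
proof (induction p rule: poly_mapping_single_induct)
  case (1 u a)
  show ?case
  proof (induction q rule: poly_mapping_single_induct)
    case (1 v b)
    let ?e = "Poly_Mapping.single j 1 :: 'a \<Rightarrow>\<^sub>0 nat"
    have u: "u - ?e + v = u + v - ?e" if "Poly_Mapping.lookup u j \<noteq> 0"
      using that by (intro poly_mapping_eqI) (auto simp: lookup_add lookup_minus lookup_single when_def)
    have v: "u + (v - ?e) = u + v - ?e" if "Poly_Mapping.lookup v j \<noteq> 0"
      using that by (intro poly_mapping_eqI) (auto simp: lookup_add lookup_minus lookup_single when_def)
    show ?case
      using u v
      by (cases "Poly_Mapping.lookup u j = 0"; cases "Poly_Mapping.lookup v j = 0")
        (simp_all add: mult_single pdiff_single lookup_add algebra_simps flip: single_add)
  next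
    case (2 p q)
    then show ?case by (simp add: distrib_left pdiff_add algebra_simps)
  qed
next
  case (2 p q)
  then show ?case by (simp add: distrib_right pdiff_add algebra_simps)
qed

section \<open>Derivations of the field and the kernel of the Jacobian matrix\<close>

locale mpoly_fraction_hom =
  fixes \<psi> :: "('n::finite, 'k::field_char_0) mpoly \<Rightarrow> 'f::field"
  assumes \<psi>_add: "\<psi> (p + q) = \<psi> p + \<psi> q" and \<psi>_mult: "\<psi> (p * q) = \<psi> p * \<psi> q"
    and \<psi>_1: "\<psi> 1 = 1" and \<psi>_frac: "\<exists>p q. \<psi> q \<noteq> 0 \<and> z = \<psi> p / \<psi> q"
begin

sublocale field_ext "\<lambda>c. \<psi> (pconst c)" "\<lambda>j. \<psi> (pvar j)"
proof
  show "\<psi> (pconst (a + b)) = \<psi> (pconst a) + \<psi> (pconst b)" for a b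
    by (simp add: pconst_def single_add \<psi>_add)
  show "\<psi> (pconst (a * b)) = \<psi> (pconst a) * \<psi> (pconst b)" for a b
    by (simp add: pconst_def mult_single flip: \<psi>_mult)
  show "\<psi> (pconst 1) = 1" by (simp add: pconst_def \<psi>_1)
qed

lemma \<psi>_0: "\<psi> 0 = 0"
  using \<psi>_add[of 0 0] by (metis add.right_neutral add_left_cancel)

lemma \<psi>_in_polys: "\<psi> p \<in> polys UNIV"
  by (induction p rule: mpoly_ring_induct)
    (auto simp: \<psi>_add \<psi>_mult subring_simps[OF subring_polys] x_in_polys)

sublocale fg_field "\<lambda>c. \<psi> (pconst c)" "\<lambda>j. \<psi> (pvar j)"
  by unfold_locales (use \<psi>_frac \<psi>_in_polys in metis)

lemma der_chain_rule:
  assumes D: "der D"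
  shows "D (\<psi> p) = (\<Sum>j\<in>UNIV. \<psi> (pdiff j p) * D (\<psi> (pvar j)))"
proof (induction p rule: mpoly_ring_induct)
  case (1 c)
  then show ?case by (simp add: pdiff_pconst \<psi>_0 der_simps(1)[OF D])
next
  case (2 i)
  have "(\<Sum>j\<in>UNIV. \<psi> (pdiff j (pvar i)) * D (\<psi> (pvar j))) = (\<Sum>j\<in>UNIV. if j = i then D (\<psi> (pvar i)) else 0)"
    by (intro sum.cong) (auto simp: pdiff_pvar \<psi>_0 \<psi>_1)
  then show ?case by simp
next
  case (3 p q)
  then show ?case by (simp add: pdiff_add \<psi>_add der_simps(4)[OF D] distrib_right sum.distrib)
next
  case (4 p q)
  then show ?case
    by (simp add: pdiff_mult \<psi>_add \<psi>_mult der_simps(5)[OF D] sum.distrib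
      sum_distrib_left sum_distrib_right algebra_simps)
qed

text \<open>The derivative of \<open>p\<close> at the generic point of the variety in the direction
  \<open>v\<close>: a derivation of the polynomial ring into the field along
  \<open>\<psi>\<close>.\<close>

definition dir_deriv :: "'f^'n \<Rightarrow> ('n, 'k) mpoly \<Rightarrow> 'f"
  where "dir_deriv v p = (\<Sum>j\<in>UNIV. \<psi> (pdiff j p) * v $ j)"

lemma dir_deriv_simps:
  "dir_deriv v (p + q) = dir_deriv v p + dir_deriv v q"
  "dir_deriv v (p * q) = dir_deriv v p * \<psi> q + \<psi> p * dir_deriv v q"
  "dir_deriv v (pconst c) = 0" "dir_deriv v (pvar i) = v $ i"
proof -
  show "dir_deriv v (p + q) = dir_deriv v p + dir_deriv v q"
    by (simp add: dir_deriv_def pdiff_add \<psi>_add distrib_right sum.distrib)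
  show "dir_deriv v (p * q) = dir_deriv v p * \<psi> q + \<psi> p * dir_deriv v q"
    by (simp add: dir_deriv_def pdiff_mult \<psi>_add \<psi>_mult sum.distrib
      sum_distrib_left sum_distrib_right algebra_simps)
  show "dir_deriv v (pconst c) = 0" by (simp add: dir_deriv_def pdiff_pconst \<psi>_0)
  have "dir_deriv v (pvar i) = (\<Sum>j\<in>UNIV. if j = i then v $ i else 0)"
    unfolding dir_deriv_def by (intro sum.cong) (auto simp: pdiff_pvar \<psi>_0 \<psi>_1)
  then show "dir_deriv v (pvar i) = v $ i" by simp
qed

text \<open>A direction that kills the kernel of \<open>\<psi>\<close> descends to the image of
  \<open>\<psi>\<close>, and from there it extends to the field.\<close>

lemma der_of_direction:
  assumes wd: "\<And>p. \<psi> p = 0 \<Longrightarrow> dir_deriv v p = 0"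
  shows "\<exists>D. der D \<and> (\<forall>j. D (\<psi> (pvar j)) = v $ j)"
proof -
  define D where "D z = dir_deriv v (SOME p. \<psi> p = z)" for z
  have D: "D (\<psi> p) = dir_deriv v p" for p
  proof -
    define q where "q = (SOME q. \<psi> q = \<psi> p)"
    have q: "\<psi> q = \<psi> p" unfolding q_def by (rule someI) simp
    have "\<psi> (q + pconst (- 1) * p) = 0"
      using q by (simp add: \<psi>_add \<psi>_mult \<kappa>_uminus \<kappa>_1)
    from wd[OF this] have "dir_deriv v q = dir_deriv v p"
      by (simp add: dir_deriv_simps \<kappa>_uminus \<kappa>_1)
    then show ?thesis by (simp add: D_def q_def)
  qed
  have ring: "subring (range \<psi>)"
    unfolding subring_def by (auto simp flip: \<psi>_add \<psi>_mult)
  have "der_on (range \<psi>) D"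
    unfolding der_on_def
  proof (intro conjI allI ballI)
    show "D (\<psi> (pconst c)) = 0" for c by (simp add: D dir_deriv_simps)
    fix a b assume "a \<in> range \<psi>" "b \<in> range \<psi>"
    then obtain p q where pq: "a = \<psi> p" "b = \<psi> q" by blast
    show "D (a + b) = D a + D b" unfolding pq \<psi>_add[symmetric] D by (rule dir_deriv_simps)
    show "D (a * b) = D a * b + a * D b" unfolding pq \<psi>_mult[symmetric] D by (rule dir_deriv_simps)
  qed
  then obtain D' where "der D'" "\<And>b. b \<in> range \<psi> \<Longrightarrow> D' b = D b"
    using der_extends[OF ring] by metis
  then show ?thesis using D dir_deriv_simps(4) by (intro exI[of _ D']) auto
qed

text \<open>The chain rule gives one inclusion. Conversely, a direction killing the generators kills
  \<open>I\<close>, and an element \<open>p\<close> of the kernel of \<open>\<psi>\<close> lies in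
  \<open>I\<close> after multiplication by some \<open>q\<close> with \<open>\<psi> q\<close>
  nonzero; Leibniz at \<open>q * p\<close> leaves \<open>\<psi> q\<close> times the derivative of
  \<open>p\<close>.\<close>

lemma derivation_directions:
  fixes f :: "nat \<Rightarrow> ('n, 'k) mpoly"
  assumes I: "I = genideal mpoly_ring (f ` {..<m})"
    and van: "\<And>p. p \<in> I \<Longrightarrow> \<psi> p = 0"
    and ker: "\<And>p. \<psi> p = 0 \<Longrightarrow> \<exists>q. \<psi> q \<noteq> 0 \<and> q * p \<in> I"
  shows "(\<lambda>D. (\<chi> j. D (\<psi> (pvar j))) :: 'f^'n) ` {D. der D} =
    {v. \<forall>w\<in>{(\<chi> j. \<psi> (pdiff j (f i))) |i. i < m}. (\<Sum>j\<in>UNIV. w $ j * v $ j) = 0}"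
    (is "?L = ?R")
proof -
  interpret R: cring "mpoly_ring :: ('n, 'k) mpoly ring" by (rule cring_from_type_algebra)
  have R: "?R = {v. \<forall>i<m. dir_deriv v (f i) = 0}"
    by (auto simp: dir_deriv_def)
  have fI: "f i \<in> I" if "i < m" for i
    using R.genideal_self[of "f ` {..<m}"] that unfolding I by (auto simp: ring_of_type_algebra_def)
  show ?thesis
    unfolding R
  proof (intro equalityI subsetI)
    fix v assume "v \<in> ?L"
    then obtain D where D: "der D" "v = (\<chi> j. D (\<psi> (pvar j)))" by blast
    have "dir_deriv v (f i) = 0" if "i < m" for i
      using der_chain_rule[OF D(1), of "f i"] van[OF fI[OF that]] der_simps(2)[OF D(1)]
      by (simp add: dir_deriv_def D(2))
    then show "v \<in> {v. \<forall>i<m. dir_deriv v (f i) = 0}" by simp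
  next
    fix v assume v: "v \<in> {v. \<forall>i<m. dir_deriv v (f i) = 0}"
    \<comment> \<open>The condition \<open>\<psi> p = 0\<close> is what makes \<open>?Z\<close> an
      ideal: it removes the Leibniz term in which the other factor is differentiated.\<close>
    let ?Z = "{p. \<psi> p = 0 \<and> dir_deriv v p = 0}"
    have neg: "p \<in> ?Z \<Longrightarrow> pconst (- 1) * p \<in> ?Z" for p
      by (simp add: \<psi>_mult dir_deriv_simps)
    have "ideal ?Z mpoly_ring"
    proof (rule idealI)
      show "subgroup ?Z (add_monoid (mpoly_ring :: ('n, 'k) mpoly ring))"
      proof (rule group.subgroupI[OF R.a_group])
        have "pconst 0 \<in> ?Z" using dir_deriv_simps(3)[of v 0] by simp
        then show "?Z \<noteq> {}" by blast
        fix p assume p: "p \<in> ?Z"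
        have "p + pconst (- 1) * p = 0"
        proof -
          have "p + pconst (- 1) * p = (pconst 1 + pconst (- 1)) * p"
            by (simp add: distrib_right pconst_def)
          also have "pconst 1 + pconst (- 1) = (0 :: ('n, 'k) mpoly)"
            unfolding pconst_def single_add[symmetric] by simp
          also have "0 * p = 0" by simp
          finally show ?thesis .
        qed
        then have "inv\<^bsub>add_monoid mpoly_ring\<^esub> p = pconst (- 1) * p"
          by (intro group.inv_equality[OF R.a_group]) (simp_all add: ring_of_type_algebra_def add.commute)
        then show "inv\<^bsub>add_monoid mpoly_ring\<^esub> p \<in> ?Z" using neg[OF p] by simp
      qed (auto simp: ring_of_type_algebra_def \<psi>_add dir_deriv_simps)
    qed (auto simp: ring_of_type_algebra_def \<psi>_mult dir_deriv_simps R.ring_axioms[unfolded ring_of_type_algebra_def])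
    then have IZ: "I \<subseteq> ?Z"
      unfolding I by (rule R.genideal_minimal) (use v fI van in auto)
    have "\<exists>D. der D \<and> (\<forall>j. D (\<psi> (pvar j)) = v $ j)"
    proof (rule der_of_direction)
      fix p assume p: "\<psi> p = 0"
      obtain q where q: "\<psi> q \<noteq> 0" "q * p \<in> I" using ker[OF p] by blast
      have "dir_deriv v (q * p) = 0" using q(2) IZ by blast
      then show "dir_deriv v p = 0" using p q(1) by (simp add: dir_deriv_simps)
    qed
    then obtain D where "der D" "\<forall>j. D (\<psi> (pvar j)) = v $ j" by blast
    then show "v \<in> ?L" by (intro image_eqI[of _ _ D]) (auto simp: vec_eq_iff)
  qed
qed

end

section \<open>From the localized quotient to its field of fractions\<close>

lemma to_frac_simps:
  "to_frac (a + b) = to_frac a + to_frac b" "to_frac (a * b) = to_frac a * to_frac b"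
  "to_frac 1 = 1" "inj (to_frac :: 'a::idom \<Rightarrow> 'a fract)"
  by (auto simp: to_frac_def One_fract_def eq_fract intro!: injI)

lemma fract_eq_divide: "\<exists>a b. b \<noteq> 0 \<and> z = to_frac a / to_frac (b :: 'a::idom)"
  by (cases z) (auto simp: to_frac_def)

text \<open>Elements of \<open>S\<close> become units, hence nonzero in a domain. Both the
  denominators of fractions and the multipliers that annihilate the kernel come from
  \<open>S\<close>, so their images under \<open>\<phi>\<close> do not vanish.\<close>

lemma localization_ring_hom:
  fixes I :: "('n, 'k::comm_ring_1) mpoly set" and \<iota> :: "('n, 'k) mpoly set \<Rightarrow> 'a::idom"
  assumes I: "ideal I mpoly_ring" and loc: "is_localization (mpoly_ring Quot I) S \<iota>"
    and \<phi>: "\<phi> = (\<lambda>p. \<iota> (I +>\<^bsub>mpoly_ring\<^esub> p))"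
  shows "\<phi> (p + q) = \<phi> p + \<phi> q" "\<phi> (p * q) = \<phi> p * \<phi> q" "\<phi> 1 = 1"
    "p \<in> I \<Longrightarrow> \<phi> p = 0" "\<phi> p = 0 \<Longrightarrow> \<exists>q. \<phi> q \<noteq> 0 \<and> q * p \<in> I"
    "\<exists>p q. \<phi> q \<noteq> 0 \<and> a * \<phi> q = \<phi> p"
proof -
  let ?R = "mpoly_ring :: ('n, 'k) mpoly ring"
  interpret R: cring ?R by (rule cring_from_type_algebra)
  interpret I: ideal I ?R by (rule I)
  have rsimps: "carrier ?R = UNIV" "p \<otimes>\<^bsub>?R\<^esub> q = p * q" "p \<oplus>\<^bsub>?R\<^esub> q = p + q" "\<one>\<^bsub>?R\<^esub> = 1" for p q
    by (simp_all add: ring_of_type_algebra_def)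
  have asimps: "x \<otimes>\<^bsub>ring_of_type_algebra\<^esub> y = x * y" "x \<oplus>\<^bsub>ring_of_type_algebra\<^esub> y = x + y"
    "\<one>\<^bsub>ring_of_type_algebra\<^esub> = (1::'a)" for x y :: 'a
    by (simp_all add: ring_of_type_algebra_def)
  have pi: "(+>\<^bsub>?R\<^esub>) I \<in> ring_hom ?R (?R Quot I)" by (rule I.rcos_ring_hom)
  have \<iota>: "\<iota> \<in> ring_hom (?R Quot I) ring_of_type_algebra" using loc by (simp add: is_localization_def)
  have car: "I +>\<^bsub>?R\<^esub> p \<in> carrier (?R Quot I)" for p
    using ring_hom_closed[OF pi, of p] by (simp add: rsimps)
  have carE: "\<exists>p. r = I +>\<^bsub>?R\<^esub> p" if "r \<in> carrier (?R Quot I)" for r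
    using that by (auto simp: FactRing_def A_RCOSETS_def')
  show \<phi>_add: "\<phi> (p + q) = \<phi> p + \<phi> q" for p q
    using ring_hom_add[OF pi, of p q] ring_hom_add[OF \<iota> car car, of p q]
    by (simp add: \<phi> rsimps asimps)
  show \<phi>_mult: "\<phi> (p * q) = \<phi> p * \<phi> q" for p q
    using ring_hom_mult[OF pi, of p q] ring_hom_mult[OF \<iota> car car, of p q]
    by (simp add: \<phi> rsimps asimps)
  show "\<phi> 1 = 1"
    using ring_hom_one[OF pi] ring_hom_one[OF \<iota>] by (simp add: \<phi> rsimps asimps)
  have \<phi>_0: "\<phi> 0 = 0" using \<phi>_add[of 0 0] by (metis add.right_neutral add_left_cancel)
  have I0: "I +>\<^bsub>?R\<^esub> p = I" if "p \<in> I" for p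
    by (rule R.a_rcos_zero[OF I that])
  have "\<zero>\<^bsub>?R\<^esub> = 0" by (simp add: ring_of_type_algebra_def)
  then have "0 \<in> I" using additive_subgroup.zero_closed[OF I.is_additive_subgroup] by simp
  then show "\<phi> p = 0" if "p \<in> I" for p using I0[OF that] I0[of 0] \<phi>_0 by (simp add: \<phi>)
  have unit: "\<iota> s \<noteq> 0" if "s \<in> S" for s
    using loc that by (auto simp: is_localization_def)
  have SE: "\<exists>q. s = I +>\<^bsub>?R\<^esub> q" if "s \<in> S" for s
    using loc that carE by (auto simp: is_localization_def submonoid_def)
  show "\<exists>q. \<phi> q \<noteq> 0 \<and> q * p \<in> I" if "\<phi> p = 0" for p
  proof -
    have "\<iota> (I +>\<^bsub>?R\<^esub> p) = 0" using that by (simp add: \<phi>)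
    then obtain s where s: "s \<in> S" "s \<otimes>\<^bsub>?R Quot I\<^esub> (I +>\<^bsub>?R\<^esub> p) = \<zero>\<^bsub>?R Quot I\<^esub>"
      using loc car[of p] by (auto simp: is_localization_def)
    obtain q where q: "s = I +>\<^bsub>?R\<^esub> q" using SE[OF s(1)] by blast
    have "I +>\<^bsub>?R\<^esub> (q * p) = I"
      using s(2) ring_hom_mult[OF pi, of q p] by (simp add: q rsimps FactRing_def)
    then have "q * p \<in> I"
      using R.a_coset_join1[of I "q * p"] I.a_subgroup by (simp add: rsimps)
    moreover have "\<phi> q \<noteq> 0" using unit[OF s(1)] by (simp add: \<phi> q)
    ultimately show ?thesis by blast
  qed
  show "\<exists>p q. \<phi> q \<noteq> 0 \<and> a * \<phi> q = \<phi> p" for a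
  proof -
    have "\<exists>r\<in>carrier (?R Quot I). \<exists>s\<in>S. a * \<iota> s = \<iota> r"
      using loc by (simp add: is_localization_def)
    then obtain r s where rs: "r \<in> carrier (?R Quot I)" "s \<in> S" "a * \<iota> s = \<iota> r" by blast
    obtain p q where "r = I +>\<^bsub>?R\<^esub> p" "s = I +>\<^bsub>?R\<^esub> q" using carE[OF rs(1)] SE[OF rs(2)] by blast
    then show ?thesis using rs unit by (intro exI[of _ p] exI[of _ q]) (auto simp: \<phi>)
  qed
qed

theorem proposition1p5:
  fixes f :: "nat \<Rightarrow> ('n::finite, 'k::field_char_0) mpoly"
    and m r d :: nat
    and I :: "('n, 'k) mpoly set"
    and S :: "('n, 'k) mpoly set set"
    and \<iota> :: "('n, 'k) mpoly set \<Rightarrow> 'a::idom"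
    and \<phi> :: "('n, 'k) mpoly \<Rightarrow> 'a"
    and sc :: "'k \<Rightarrow> 'a \<Rightarrow> 'a"
    and br :: "'a \<Rightarrow> 'a \<Rightarrow> 'a"
  assumes "I = genideal mpoly_ring (f ` {..<m})"
    and "primeideal I mpoly_ring"
    and "\<not> maximalideal I mpoly_ring"
    and "is_localization (mpoly_ring Quot I) S \<iota>"
    and "\<phi> = (\<lambda>p. \<iota> (I +>\<^bsub>mpoly_ring\<^esub> p))"
    and "sc = induced_scale \<phi>"
    and "is_poisson_bracket sc br"
    and "r = jacobian_rank \<phi> m f"
    and "d = rank (poisson_matrix \<phi> br)"
  shows "GKdim (fun_scale sc) (\<circ>) id (poisson_diff_ops sc br) = GKdim sc (*) 1 UNIV + ereal (real d)
    \<and> GKdim sc (*) 1 UNIV + ereal (real d) = ereal (real CARD('n) - real r + real d)"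
proof -
  have "ideal I mpoly_ring" using assms(2) by (rule primeideal.axioms(1))
  note \<phi> = localization_ring_hom[OF this assms(4,5)]
  define \<psi> where "\<psi> p = to_frac (\<phi> p)" for p
  have frac0: "to_frac a = 0 \<longleftrightarrow> a = 0" for a :: 'a
    by (simp add: to_frac_def Zero_fract_def eq_fract)
  interpret mpoly_fraction_hom \<psi>
  proof
    show "\<psi> (p + q) = \<psi> p + \<psi> q" "\<psi> (p * q) = \<psi> p * \<psi> q" "\<psi> 1 = 1" for p q
      by (simp_all add: \<psi>_def to_frac_simps \<phi>)
    show "\<exists>p q. \<psi> q \<noteq> 0 \<and> z = \<psi> p / \<psi> q" for z
    proof -
      obtain a b :: 'a where z: "b \<noteq> 0" "z = to_frac a / to_frac b" using fract_eq_divide by blast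
      \<comment> \<open>Numerator and denominator lie in the localization, so each is itself a
        quotient of images of polynomials; the double fraction is then cleared.\<close>
      obtain p q p' q' where pq: "\<phi> q \<noteq> 0" "a * \<phi> q = \<phi> p" "\<phi> q' \<noteq> 0" "b * \<phi> q' = \<phi> p'"
        using \<phi>(6) by metis
      have "to_frac a = \<psi> p / \<psi> q" "to_frac b = \<psi> p' / \<psi> q'"
        using pq by (simp_all add: \<psi>_def frac0 nonzero_eq_divide_eq flip: to_frac_simps(2))
      then have "z = \<psi> (p * q') / \<psi> (q * p')" by (simp add: z \<psi>_def \<phi> to_frac_simps)
      moreover have "\<psi> (q * p') \<noteq> 0" using pq z(1) by (auto simp: \<psi>_def \<phi> frac0)
      ultimately show ?thesis by blast
    qed
  qed
  interpret poisson_alg "\<lambda>c. \<psi> (pconst c)" "\<lambda>j. \<psi> (pvar j)" to_frac sc "\<lambda>j. \<phi> (pvar j)" br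
    by unfold_locales
      (simp_all add: to_frac_simps \<psi>_def assms(6,7) induced_scale_def assms(7)[unfolded assms(6)])
  have jac: "vec.dim ((\<lambda>D. (\<chi> j. D (\<psi> (pvar j))) :: 'a fract^'n) ` {D. der D}) + r = CARD('n)"
  proof -
    have van: "\<psi> p = 0" if "p \<in> I" for p using \<phi>(4)[OF that] by (simp add: \<psi>_def frac0)
    have ker: "\<exists>q. \<psi> q \<noteq> 0 \<and> q * p \<in> I" if "\<psi> p = 0" for p
      using \<phi>(5)[of p] that by (simp add: \<psi>_def frac0)
    have "(\<lambda>D. (\<chi> j. D (\<psi> (pvar j))) :: 'a fract^'n) ` {D. der D} =
        {v. \<forall>w\<in>{(\<chi> j. \<psi> (pdiff j (f i))) |i. i < m}. (\<Sum>j\<in>UNIV. w $ j * v $ j) = 0}"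
      by (rule derivation_directions[OF assms(1) van ker])
    then show ?thesis
      using dim_annihilator[of "{(\<chi> j. \<psi> (pdiff j (f i))) :: 'a fract^'n |i. i < m}"]
      unfolding assms(8) jacobian_rank_def \<psi>_def[symmetric] by (simp only:)
  qed
  have pois: "vec.dim ((\<lambda>D. (\<chi> j. D (\<psi> (pvar j))) :: 'a fract^'n) ` ham_space) = d"
  proof -
    let ?C = "poisson_matrix \<phi> br"
    \<comment> \<open>Row \<open>i\<close> of the matrix is the vector of values of the i-th
      Hamiltonian derivation, so combinations of rows are exactly the value vectors of
      \<open>ham_space\<close>.\<close>
    have C: "?C $ i $ j = ham (\<phi> (pvar i)) (\<psi> (pvar j))" for i j
      by (simp add: poisson_matrix_def ham_x)
    have "(\<lambda>D. (\<chi> j. D (\<psi> (pvar j))) :: 'a fract^'n) ` ham_space = vec.span (rows ?C)"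
    proof (intro equalityI subsetI)
      fix v assume "v \<in> (\<lambda>D. (\<chi> j. D (\<psi> (pvar j))) :: 'a fract^'n) ` ham_space"
      then obtain c where "v = (\<chi> j. \<Sum>i\<in>UNIV. c i * ham (\<phi> (pvar i)) (\<psi> (pvar j)))"
        by (auto simp: ham_space_def)
      then have "v = (\<Sum>i\<in>UNIV. c i *s row i ?C)"
        by (simp add: vec_eq_iff sum_component row_def C)
      also have "\<dots> \<in> vec.span (rows ?C)"
        by (intro vec.span_sum vec.span_scale vec.span_base) (auto simp: rows_def)
      finally show "v \<in> vec.span (rows ?C)" .
    next
      fix v assume "v \<in> vec.span (rows ?C)"
      then show "v \<in> (\<lambda>D. (\<chi> j. D (\<psi> (pvar j))) :: 'a fract^'n) ` ham_space"
      proof (induction rule: vec.span_induct_alt)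
        case base
        show ?case by (rule image_eqI[OF _ ham_space_zero]) (simp add: vec_eq_iff)
      next
        case (step c y v)
        then obtain i D where i: "y = row i ?C" and D: "v = (\<chi> j. D (\<psi> (pvar j)))" "D \<in> ham_space"
          by (auto simp: rows_def)
        show ?case
          by (rule image_eqI[OF _ ham_space_add[OF ham_space_scale[OF ham_in_ham_space,
              of c "\<phi> (pvar i)"] D(2)]])
            (simp add: i D(1) vec_eq_iff row_def C)
      qed
    qed
    then show ?thesis by (simp add: assms(9) row_rank_def_gen)
  qed
  show ?thesis
    \<comment> \<open>Rewriting the number of variables as dimension plus \<open>r\<close> turns the
      real difference into a cancellation.\<close>
    using GK_dimensions jac pois by (simp flip: jac)
qed

end
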